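(* Let $(S_n)_{n\ge0}$ be a nontrivial, centered random walk on $\mathbb R$ with lattice-span $d\ge 0$ and $\mathbb{E}S_1^2<\infty$. Let $G:\mathbb R\to\mathbb R$ be a right-continuous function such that $G(x)=0$ for $x\le 0$, $$G(x)=\mathbb{E}\,G(x+S_1)\mathbf 1_{\{x+S_1>0\}}\quad\text{for all }x>0,$$ and $\sup_{x\ge 0}|G(x)/(1+|x|)|<\infty$. Then there exists a function $\kappa:\mathbb R\to\mathbb R$, $d$-periodic if $d>0$ and constant if $d=0$, such that $$G(x)=\kappa(x)H(x)\quad\text{for all }x\in\mathbb R.$$
   Context: $(S_n)_{n\ge0}$ has i.i.d. increments; under $\mathbb P=\mathbb P_0$ it starts at $S_0=0$, and under $\mathbb P_x$ (expectation $\mathbb E_x$) at $S_0=x$. Nontrivial means $\mathbb P(S_1=0)<1$; centered means $\mathbb E S_1=0$. The lattice-span is $d>0$ if the walk is $d$-arithmetic, i.e. $d$ is the maximal positive number with $\mathbb P(S_1\in d\mathbb Z)=1$, and $d=0$ if the walk is nonarithmetic (no such positive number exists). Put $\tau=\inf\{n\ge0:S_n\le0\}$ and $H(x)=x-\mathbb E_xS_\tau$; in particular $H(x)=0$ for $x\le0$. *)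

theory Defs
  imports "HOL-Probability.Probability" "HOL-Library.Extended_Nat"
begin

text \<open>
  The process \<open>S\<close> under the measure \<open>M\<close> is the walk started at 0.  The walk started at \<open>x\<close>
  is realised on the same space as \<open>\<lambda>n \<omega>. x + S n \<omega>\<close>, so that expectations under
  \<open>P_x\<close> become expectations under \<open>M\<close> of functionals of this shifted process.
\<close>

locale random_walk = prob_space M for M :: "'a measure" +
  fixes S :: "nat \<Rightarrow> 'a \<Rightarrow> real"
  assumes start_measurable: "S 0 \<in> borel_measurable M"
    and start: "AE \<omega> in M. S 0 \<omega> = 0"
    and indep_increments: "indep_vars (\<lambda>_. borel) (\<lambda>n \<omega>. S (Suc n) \<omega> - S n \<omega>) UNIV"
    and ident_increments:
      "\<And>n. distr M borel (\<lambda>\<omega>. S (Suc n) \<omega> - S n \<omega>) = distr M borel (\<lambda>\<omega>. S 1 \<omega> - S 0 \<omega>)"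

definition nontrivial_walk :: "'a measure \<Rightarrow> (nat \<Rightarrow> 'a \<Rightarrow> real) \<Rightarrow> bool" where
  "nontrivial_walk M S \<longleftrightarrow> \<P>(\<omega> in M. S 1 \<omega> = 0) < 1"

definition centered_walk :: "'a measure \<Rightarrow> (nat \<Rightarrow> 'a \<Rightarrow> real) \<Rightarrow> bool" where
  "centered_walk M S \<longleftrightarrow> integrable M (S 1) \<and> (\<integral>\<omega>. S 1 \<omega> \<partial>M) = 0"

definition arithmetic_walk :: "'a measure \<Rightarrow> (nat \<Rightarrow> 'a \<Rightarrow> real) \<Rightarrow> real \<Rightarrow> bool" where
  "arithmetic_walk M S d \<longleftrightarrow>
     d > 0 \<and> \<P>(\<omega> in M. \<exists>k::int. S 1 \<omega> = d * of_int k) = 1 \<and>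
     (\<forall>d'>0. \<P>(\<omega> in M. \<exists>k::int. S 1 \<omega> = d' * of_int k) = 1 \<longrightarrow> d' \<le> d)"

definition has_lattice_span :: "'a measure \<Rightarrow> (nat \<Rightarrow> 'a \<Rightarrow> real) \<Rightarrow> real \<Rightarrow> bool" where
  "has_lattice_span M S d \<longleftrightarrow>
     arithmetic_walk M S d \<or> d = 0 \<and> \<not> (\<exists>d'. arithmetic_walk M S d')"

definition exit_time :: "(nat \<Rightarrow> 'a \<Rightarrow> real) \<Rightarrow> real \<Rightarrow> 'a \<Rightarrow> enat" where
  "exit_time S x \<omega> = Inf {enat n | n. x + S n \<omega> \<le> 0}"

text \<open>
  The value 0 on \<open>\<tau> = \<infinity>\<close> is a convention without effect: a nontrivial centered walk has
  \<open>\<tau> < \<infinity>\<close> almost surely.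
\<close>

definition exit_position :: "(nat \<Rightarrow> 'a \<Rightarrow> real) \<Rightarrow> real \<Rightarrow> 'a \<Rightarrow> real" where
  "exit_position S x \<omega> = (case exit_time S x \<omega> of enat n \<Rightarrow> x + S n \<omega> | \<infinity> \<Rightarrow> 0)"

definition H_fun :: "'a measure \<Rightarrow> (nat \<Rightarrow> 'a \<Rightarrow> real) \<Rightarrow> real \<Rightarrow> real" where
  "H_fun M S x = x - (\<integral>\<omega>. exit_position S x \<omega> \<partial>M)"

end

theory Submission
  imports Defs
begin

text \<open>
  Write \<open>X\<close> for a step of the walk.  A function \<open>g\<close> that vanishes on \<open>x \<le> 0\<close> is called killed
  harmonic if \<open>g x = E g (x + X)\<close> for \<open>x > 0\<close>.  Both \<open>G\<close> and \<open>H\<close> are of this kind, and the point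
  is that such functions are governed by a boundary value.  If \<open>g \<ge> 0\<close>, then harmonicity makes
  \<open>r_n(x) = E[g (x + S_n); S_1 > 0, \<dots>, S_n > 0]\<close> decrease in \<open>n\<close>, because each further step only loses
  paths; the limit \<open>K_g(x)\<close> is the \<^emph>\<open>boundary value\<close> of \<open>g\<close>.

  Two facts turn boundary values into a rigidity statement.  On the one hand the
  Wiener-Hopf factorization (\<open>wiener_hopf\<close>) shows that \<open>K_g\<close> is harmonic for the
  \<^emph>\<open>unkilled, increasing\<close> walk whose steps are the strict ascending ladder heights; for this walk
  the Choquet-Deny theorem (\<open>choquet_deny_half_line\<close>) makes bounded harmonic functions invariant
  under almost every step.  On the other hand \<open>g\<close> is determined by \<open>K_g\<close>: letting the walk run until it
  first goes down gives \<open>g x = K_g x + E g (x + Z)\<close> with a descending ladder height \<open>Z \<le> 0\<close>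
  (\<open>riesz_decomposition\<close>), and iterating this drives the argument below \<open>0\<close>
  (\<open>killed_harmonic_unique\<close>).

  For \<open>H\<close> the boundary value is a constant \<open>c\<close>, the mean depth of a descending ladder height,
  because \<open>x \<le> H x \<le> (1 + \<eta>) x + C\<close> on the half-line for every \<open>\<eta> > 0\<close> (\<open>boundary_renewal\<close>).  This is where the
  second moment enters: explicit superharmonic functions built from kinks \<open>min y b\<close> bound the
  expected depth at exit (\<open>linear_superharmonic\<close>).  The growth bound on \<open>G\<close> becomes \<open>\<bar>G\<bar> \<le> D H\<close>, so
  \<open>D H + G\<close> and \<open>D H - G\<close> are nonnegative and killed harmonic, and their boundary values add up to
  the constant \<open>2 D c\<close>.  Hence both are bounded and ladder invariant, and uniqueness yields \<open>G = \<kappa> H\<close> with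
  a factor \<open>\<kappa>\<close> that is invariant under almost every step of the walk
  (\<open>harmonic_factorization\<close>).

  It remains to see that \<open>\<kappa>\<close> has the span as a period.  \<open>H\<close> itself may jump, but invariance allows
  \<open>\<kappa>\<close> to be evaluated far to the right, where \<open>H x\<close> is close to \<open>x\<close> in ratio; so \<open>\<kappa>\<close> inherits right
  continuity from \<open>G\<close> (\<open>factor_right_continuous\<close>).  Then almost every step is a period of \<open>\<kappa>\<close> on the
  half-line, the periods form a subgroup, and this subgroup contains \<open>d\<close> in the arithmetic case
  and arbitrarily small elements otherwise.
\<close>

section \<open>A nontrivial centered step law and its barriers\<close>

locale centered_law = prob_space \<mu> for \<mu> :: "real measure" +
  assumes sets_law [measurable_cong, simp]: "sets \<mu> = sets borel"
    and integrable_law [simp]: "integrable \<mu> (\<lambda>x. x)"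
    and mean_zero [simp]: "(\<integral>x. x \<partial>\<mu>) = 0"
    and integrable_square: "integrable \<mu> (\<lambda>x. x\<^sup>2)"
    and nontrivial: "measure \<mu> {0} < 1"
begin

lemma space_law [simp]: "space \<mu> = UNIV"
  using sets_eq_imp_space_eq[OF sets_law] by simp

lemma prob_UNIV [simp]: "measure \<mu> UNIV = 1"
  using prob_space by simp

lemma not_AE_zero: "\<not> (AE x in \<mu>. x = 0)"
proof
  assume "AE x in \<mu>. x = 0"
  then have "measure \<mu> {0} = 1"
    using prob_eq_1[of "{0}"] by simp
  then show False
    using nontrivial by simp
qed

lemma not_AE_nonpos: "\<not> (AE x in \<mu>. x \<le> 0)"
proof
  assume *: "AE x in \<mu>. x \<le> 0"
  have "(\<integral>x. - x \<partial>\<mu>) = 0 \<longleftrightarrow> (AE x in \<mu>. - x = 0)"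
    by (rule integral_nonneg_eq_0_iff_AE) (use * in auto)
  then show False
    using not_AE_zero by simp
qed

lemma not_AE_nonneg: "\<not> (AE x in \<mu>. 0 \<le> x)"
proof
  assume *: "AE x in \<mu>. 0 \<le> x"
  have "(\<integral>x. x \<partial>\<mu>) = 0 \<longleftrightarrow> (AE x in \<mu>. x = 0)"
    by (rule integral_nonneg_eq_0_iff_AE) (use * in auto)
  then show False
    using not_AE_zero by simp
qed

lemma positive_tail:
  fixes f :: "real \<Rightarrow> real"
  assumes [measurable]: "f \<in> borel_measurable borel" and "\<not> (AE x in \<mu>. f x \<le> 0)"
  shows "\<exists>\<delta>>0. 0 < measure \<mu> {x. \<delta> \<le> f x}"
proof (rule ccontr)
  assume no: "\<not> ?thesis"
  have "AE x in \<mu>. \<not> 1 / real (Suc n) \<le> f x" for n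
  proof -
    have "\<not> 0 < measure \<mu> {x. 1 / real (Suc n) \<le> f x}"
      using no by (metis of_nat_0_less_iff zero_less_Suc zero_less_divide_1_iff)
    then have "measure \<mu> {x. 1 / real (Suc n) \<le> f x} = 0"
      by (simp only: zero_less_measure_iff not_not)
    then show ?thesis
      by (subst AE_iff_measurable[OF _ refl]) (auto simp: emeasure_eq_measure)
  qed
  then have "AE x in \<mu>. \<forall>n. \<not> 1 / real (Suc n) \<le> f x"
    by (simp only: AE_all_countable) blast
  then have "AE x in \<mu>. f x \<le> 0"
  proof eventually_elim
    case (elim x)
    show ?case
    proof (rule ccontr)
      assume "\<not> f x \<le> 0"
      then have "0 < f x" by simp
      from nat_approx_posE[OF this] elim show False by (metis less_imp_le)
    qed
  qed
  then show False using assms(2) by simp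
qed

text \<open>
  A centered step that is not almost surely zero charges both open half-lines, hence by
  continuity of measure also two closed half-lines at a positive distance from the origin.
\<close>

lemma uniform_step:
  obtains \<delta> where "0 < \<delta>" "0 < measure \<mu> {\<delta>..}" "0 < measure \<mu> {..-\<delta>}"
proof -
  obtain a where a: "0 < a" "0 < measure \<mu> {x. a \<le> x}"
    using positive_tail[of "\<lambda>x. x"] not_AE_nonpos by auto
  obtain b where b: "0 < b" "0 < measure \<mu> {x. b \<le> - x}"
    using positive_tail[of uminus] not_AE_nonneg by auto
  have "measure \<mu> {x. a \<le> x} \<le> measure \<mu> {min a b..}"
    "measure \<mu> {x. b \<le> - x} \<le> measure \<mu> {..- min a b}"
    by (intro finite_measure_mono; auto)+
  then show ?thesis
    using a b by (intro that[of "min a b"]) auto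
qed

lemma integrable_bounded:
  fixes f :: "real \<Rightarrow> real"
  assumes "f \<in> borel_measurable borel" "\<And>x. \<bar>f x\<bar> \<le> B"
  shows "integrable \<mu> f"
  by (rule integrable_const_bound[of _ B]) (use assms in \<open>auto intro!: AE_I2\<close>)

lemma integrable_linear_growth:
  fixes f :: "real \<Rightarrow> real"
  assumes "f \<in> borel_measurable borel" "\<And>x. \<bar>f x\<bar> \<le> A + B * \<bar>x\<bar>"
  shows "integrable \<mu> f"
  by (rule Bochner_Integration.integrable_bound[of _ "\<lambda>x. A + B * \<bar>x\<bar>"])
     (use assms in \<open>auto intro!: AE_I2 order_trans[OF _ abs_ge_self]\<close>)

text \<open>
  A truncated exponential with a steep rate: a jump down by \<open>\<delta>\<close>, which has probability at least
  \<open>p\<close>, multiplies \<open>exp (- l * y)\<close> by \<open>exp (l * \<delta>) \<ge> 2 / p\<close>, so its mean at least doubles in one step.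
  The resulting bounded superharmonic function shows that the killed walk spends a finite expected time in each
  bounded part of the half-line.
\<close>

lemma exponential_barrier:
  obtains l L v where "0 < l" "0 \<le> L" "v \<in> borel_measurable borel" "\<And>y. 0 \<le> v y" "\<And>y. v y \<le> L"
    "\<And>y. 0 < y \<Longrightarrow> (\<integral>x. v (y + x) \<partial>\<mu>) + exp (- l * y) \<le> v y"
proof -
  obtain \<delta> where \<delta>: "0 < \<delta>" "0 < measure \<mu> {..-\<delta>}" by (rule uniform_step)
  define p where "p = measure \<mu> {..-\<delta>}"
  have p: "0 < p" using \<delta> by (simp add: p_def)
  \<comment> \<open>the rate for which \<open>p * exp (l * \<delta>) \<ge> 2\<close>\<close>
  define l where "l = (1 + \<bar>ln (2 / p)\<bar>) / \<delta>"
  have l: "0 < l" using \<delta> by (simp add: l_def)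
  have "l * \<delta> = 1 + \<bar>ln (2 / p)\<bar>" using \<delta> by (simp add: l_def)
  then have "exp (l * \<delta>) \<ge> exp (ln (2 / p))" by (simp del: exp_ln)
  then have pexp: "p * exp (l * \<delta>) \<ge> 2" using p by (simp add: field_simps)
  define f where "f y = min (exp (- l * y)) (exp (l * \<delta>))" for y
  define v where "v y = exp (l * \<delta>) - f y" for y
  have f_meas [measurable]: "f \<in> borel_measurable borel" unfolding f_def[abs_def] by measurable
  have f_bounds: "0 \<le> f y" "f y \<le> exp (l * \<delta>)" for y by (auto simp: f_def)
  have int_f: "integrable \<mu> (\<lambda>x. f (y + x))" for y
    by (rule integrable_bounded[of _ "exp (l * \<delta>)"]) (use f_bounds in \<open>auto simp: abs_of_nonneg\<close>)
  have drift: "(\<integral>x. v (y + x) \<partial>\<mu>) + exp (- l * y) \<le> v y" if "0 < y" for y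
  proof -
    have "exp (- l * y) \<le> exp (l * \<delta>)"
    proof -
      have "0 \<le> l * y" "0 \<le> l * \<delta>" using l \<delta> that by auto
      then show ?thesis by simp
    qed
    then have fy: "f y = exp (- l * y)" by (simp add: f_def)
    have low: "exp (l * \<delta>) * exp (- l * y) * indicator {..-\<delta>} x \<le> f (y + x)" for x
    proof (cases "x \<le> - \<delta>")
      case True
      have "exp (l * \<delta>) * exp (- l * y) = exp (l * (\<delta> - y))"
        by (simp add: exp_add[symmetric] algebra_simps)
      moreover have "l * (\<delta> - y) \<le> l * \<delta>" using l that by simp
      moreover have "l * (\<delta> - y) \<le> - l * (y + x)"
      proof -
        have "l * (\<delta> - y) \<le> l * (- x - y)" using l True by (intro mult_left_mono) auto
        then show ?thesis by (simp add: algebra_simps)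
      qed
      ultimately show ?thesis using True by (simp add: f_def)
    next
      case False
      then show ?thesis using f_bounds by simp
    qed
    have "2 * exp (- l * y) \<le> p * exp (l * \<delta>) * exp (- l * y)"
      using pexp by simp
    also have "\<dots> = (\<integral>x. exp (l * \<delta>) * exp (- l * y) * indicator {..-\<delta>} x \<partial>\<mu>)"
      by (simp add: p_def)
    also have "\<dots> \<le> (\<integral>x. f (y + x) \<partial>\<mu>)"
      by (intro integral_mono int_f low integrable_bounded[of _ "exp (l * \<delta>) * exp (- l * y)"])
         (auto split: split_indicator)
    finally have "2 * exp (- l * y) \<le> (\<integral>x. f (y + x) \<partial>\<mu>)" .
    moreover have "(\<integral>x. v (y + x) \<partial>\<mu>) = exp (l * \<delta>) - (\<integral>x. f (y + x) \<partial>\<mu>)"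
      by (simp add: v_def int_f)
    ultimately show ?thesis using fy by (simp add: v_def)
  qed
  show ?thesis
  proof (rule that[of l "exp (l * \<delta>)" v])
    show "v \<in> borel_measurable borel" unfolding v_def[abs_def] by measurable
    show "0 \<le> v y" "v y \<le> exp (l * \<delta>)" for y
      using f_bounds[of y] by (simp_all add: v_def)
  qed (use l drift in simp_all)
qed

lemma integrable_max_shift: "integrable \<mu> (\<lambda>x. max 0 (x - t))"
  by (rule integrable_linear_growth[of _ "\<bar>t\<bar>" 1]) auto

lemma integrable_max_neg: "integrable \<mu> (\<lambda>x. max 0 (- x - t))"
  by (rule integrable_linear_growth[of _ "\<bar>t\<bar>" 1]) auto

lemma integrable_min_shift: "integrable \<mu> (\<lambda>x. min (y + x) b)"
  by (rule integrable_linear_growth[of _ "\<bar>y\<bar> + \<bar>b\<bar>" 1]) auto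

text \<open>
  The function \<open>min y b\<close> is concave, and for a centered walk its one-step loss is the mean
  overshoot over \<open>b\<close>.  It thus measures the time spent just below \<open>b\<close>, which makes positive combinations of
  kinks a substitute for the inverse of \<open>I - P\<close>.
\<close>

lemma kink_drift:
  assumes "y \<le> b"
  shows "(\<integral>x. min (y + x) b \<partial>\<mu>) = min y b - (\<integral>x. max 0 (x - (b - y)) \<partial>\<mu>)"
proof -
  have "(\<integral>x. min (y + x) b \<partial>\<mu>) = (\<integral>x. y + x - max 0 (x - (b - y)) \<partial>\<mu>)"
    by (intro Bochner_Integration.integral_cong) auto
  also have "\<dots> = y - (\<integral>x. max 0 (x - (b - y)) \<partial>\<mu>)"
    using integrable_max_shift by simp
  finally show ?thesis using assms by simp
qed

lemma kink_superharmonic: "(\<integral>x. min (y + x) b \<partial>\<mu>) \<le> min y b"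
proof (cases "y \<le> b")
  case True
  then show ?thesis using kink_drift[OF True] by (simp add: integral_nonneg_AE)
next
  case False
  have "(\<integral>x. min (y + x) b \<partial>\<mu>) \<le> (\<integral>x. b \<partial>\<mu>)"
    by (intro integral_mono integrable_min_shift) auto
  then show ?thesis using False by simp
qed

text \<open>
  For \<open>t > 0\<close> this is the mean depth below \<open>0\<close> that the walk reaches in one step from \<open>t\<close>.
\<close>

definition lower_tail :: "real \<Rightarrow> real" where
  "lower_tail t = (\<integral>x. max 0 (- x - t) \<partial>\<mu>)"

lemma lower_tail_nonneg: "0 \<le> lower_tail t"
  by (simp add: lower_tail_def integral_nonneg_AE)

lemma lower_tail_antimono: "s \<le> t \<Longrightarrow> lower_tail t \<le> lower_tail s"
  unfolding lower_tail_def by (intro integral_mono integrable_max_neg) auto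

lemma sum_truncated_le:
  fixes t :: real
  assumes "0 < \<delta>"
  shows "(\<Sum>k<N. max 0 (t - real k * \<delta>)) \<le> t\<^sup>2 / \<delta> + \<bar>t\<bar>"
proof (cases "t \<le> 0")
  case True
  have "max 0 (t - real k * \<delta>) = 0" for k
    using True assms by (simp add: max_def) (smt (verit) mult_nonneg_nonneg of_nat_0_le_iff)
  then show ?thesis using assms by simp
next
  case False
  define m where "m = nat \<lfloor>t / \<delta>\<rfloor>"
  have m: "real m \<le> t / \<delta>" using False assms by (simp add: m_def)
  have zero: "max 0 (t - real k * \<delta>) = 0" if "k > m" for k
  proof -
    have "t / \<delta> \<le> real k" using that unfolding m_def by linarith
    then have "t \<le> real k * \<delta>" using assms by (simp add: field_simps)
    then show ?thesis by simp
  qed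
  have "(\<Sum>k<N. max 0 (t - real k * \<delta>)) \<le> (\<Sum>k<N. if k \<le> m then t else 0)"
  proof (intro sum_mono)
    fix k
    show "max 0 (t - real k * \<delta>) \<le> (if k \<le> m then t else 0)"
      using zero[of k] False assms by (auto simp: not_le)
  qed
  also have "\<dots> = (\<Sum>k\<in>{..<N} \<inter> {..m}. t)"
    by (simp add: sum.If_cases atMost_def)
  also have "\<dots> \<le> (\<Sum>k\<in>{..m}. t)"
    using False by (intro sum_mono2) auto
  also have "\<dots> = (real m + 1) * t" by simp
  also have "\<dots> \<le> (t / \<delta> + 1) * t" using m False by (intro mult_right_mono) auto
  also have "\<dots> = t\<^sup>2 / \<delta> + \<bar>t\<bar>" using False by (simp add: field_simps power2_eq_square)
  finally show ?thesis .
qed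

text \<open>
  Finite variance is what makes the mean depths summable along a grid: the sum over the grid of
  \<open>max 0 (t - k * \<delta>)\<close> is quadratic in \<open>t\<close>.
\<close>

lemma lower_tail_summable:
  assumes "0 < \<delta>"
  shows "summable (\<lambda>k. lower_tail (real k * \<delta>))"
proof (rule summableI_nonneg_bounded)
  fix N
  have "(\<Sum>k<N. lower_tail (real k * \<delta>)) = (\<integral>x. (\<Sum>k<N. max 0 (- x - real k * \<delta>)) \<partial>\<mu>)"
    unfolding lower_tail_def by (subst Bochner_Integration.integral_sum) (auto intro: integrable_max_neg)
  also have "\<dots> \<le> (\<integral>x. x\<^sup>2 / \<delta> + \<bar>x\<bar> \<partial>\<mu>)"
  proof (intro integral_mono)
    show "integrable \<mu> (\<lambda>x. \<Sum>k<N. max 0 (- x - real k * \<delta>))"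
      by (auto intro: integrable_max_neg)
    show "integrable \<mu> (\<lambda>x. x\<^sup>2 / \<delta> + \<bar>x\<bar>)"
      using integrable_square by auto
    show "(\<Sum>k<N. max 0 (- x - real k * \<delta>)) \<le> x\<^sup>2 / \<delta> + \<bar>x\<bar>" for x
      using sum_truncated_le[OF assms, where N = N and t = "- x"] by simp
  qed
  finally show "(\<Sum>k<N. lower_tail (real k * \<delta>)) \<le> (\<integral>x. x\<^sup>2 / \<delta> + \<bar>x\<bar> \<partial>\<mu>)" .
qed (rule lower_tail_nonneg)

text \<open>
  Kinks at the grid points \<open>b i\<close> with weights proportional to \<open>lower_tail\<close> compensate the mean
  depth of a jump out of the half-line.  Starting the grid far to the right makes the total
  weight, and hence the slope of \<open>w\<close>, as small as desired; the price is that the compensation only works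
  beyond a threshold \<open>M\<close>.
\<close>

lemma kink_barrier:
  assumes "0 < \<epsilon>"
  obtains w M where "w \<in> borel_measurable borel" "\<And>y. y \<le> 0 \<Longrightarrow> \<epsilon> * y \<le> w y"
    "\<And>y. 0 \<le> y \<Longrightarrow> 0 \<le> w y" "\<And>y. 0 \<le> y \<Longrightarrow> w y \<le> \<epsilon> * y"
    "\<And>y. integrable \<mu> (\<lambda>x. w (y + x))"
    "\<And>y. 0 < y \<Longrightarrow> (\<integral>x. w (y + x) \<partial>\<mu>) \<le> w y"
    "\<And>y. M < y \<Longrightarrow> (\<integral>x. w (y + x) \<partial>\<mu>) + lower_tail y \<le> w y" "0 \<le> M"
proof -
  obtain \<delta>2 where \<delta>2: "0 < \<delta>2" "0 < measure \<mu> {\<delta>2..}" by (rule uniform_step)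
  define \<delta> where "\<delta> = \<delta>2 / 2"
  have \<delta>: "0 < \<delta>" using \<delta>2 by (simp add: \<delta>_def)
  \<comment> \<open>a lower bound for the mean overshoot over a kink at distance at most \<open>\<delta>\<close> above\<close>
  define c where "c = \<delta> * measure \<mu> {\<delta>2..}"
  have c: "0 < c" using \<delta> \<delta>2 by (simp add: c_def)
  have kink: "(\<integral>x. min (y + x) b \<partial>\<mu>) + c \<le> min y b" if "y \<le> b" "b \<le> y + \<delta>" for y b
  proof -
    have "c = (\<integral>x. \<delta> * indicator {\<delta>2..} x \<partial>\<mu>)" by (simp add: c_def)
    also have "\<dots> \<le> (\<integral>x. max 0 (x - (b - y)) \<partial>\<mu>)"
      using that \<delta>
      by (intro integral_mono integrable_max_shift)
         (auto intro!: integrable_bounded[of _ \<delta>] simp: \<delta>_def split: split_indicator)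
    finally show ?thesis using kink_drift[OF that(1)] by linarith
  qed
  have summ: "summable (\<lambda>k. lower_tail (real k * \<delta>) / c)"
    using lower_tail_summable[OF \<delta>] by (rule summable_divide)
  \<comment> \<open>the tail of the weights beyond the grid point \<open>J\<close> is the slope of \<open>w\<close> at the origin\<close>
  obtain J where J: "norm (\<Sum>k. lower_tail (real (k + J) * \<delta>) / c) < \<epsilon>"
    using suminf_exist_split[OF assms summ] by blast
  define a where "a i = lower_tail (real (i + J) * \<delta>) / c" for i
  define b where "b i = real (i + J + 1) * \<delta>" for i
  have a0: "0 \<le> a i" for i using c by (simp add: a_def lower_tail_nonneg)
  have b0: "0 < b i" for i using \<delta> by (simp add: b_def add_pos_nonneg)
  have a_sum: "summable a" unfolding a_def using summ by (subst summable_iff_shift)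
  have a_le: "(\<Sum>i. a i) \<le> \<epsilon>"
    using J unfolding a_def[symmetric] by simp
  have a_sum_nn: "0 \<le> (\<Sum>i. a i)" by (intro suminf_nonneg a_sum a0)
  define w where "w y = (\<Sum>i. a i * min y (b i))" for y
  have minb: "\<bar>min y (b i)\<bar> \<le> \<bar>y\<bar>" for y i using b0[of i] by auto
  have term_bound: "norm (a i * min y (b i)) \<le> a i * \<bar>y\<bar>" for i y
    using a0[of i] minb[of y i] by (simp add: abs_mult mult_left_mono)
  have w_summ: "summable (\<lambda>i. a i * min y (b i))" for y
    by (rule summable_comparison_test'[OF summable_mult2[OF a_sum, of "\<bar>y\<bar>"] term_bound])
  have w_meas [measurable]: "w \<in> borel_measurable borel" unfolding w_def[abs_def] by measurable
  have w_neg: "\<epsilon> * y \<le> w y" if "y \<le> 0" for y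
  proof -
    have "w y = (\<Sum>i. a i * y)"
      unfolding w_def using that b0 by (intro suminf_cong) (simp add: min_def, smt (verit) b0)
    also have "\<dots> = (\<Sum>i. a i) * y" by (rule suminf_mult2[OF a_sum, symmetric])
    finally show ?thesis using a_le that by (simp add: mult_right_mono_neg)
  qed
  have w_pos: "0 \<le> w y" if "0 \<le> y" for y
    unfolding w_def using that a0 b0 by (intro suminf_nonneg w_summ mult_nonneg_nonneg) (auto simp: less_imp_le)
  have w_up: "w y \<le> \<epsilon> * y" if "0 \<le> y" for y
  proof -
    have "w y \<le> (\<Sum>i. a i * y)"
      unfolding w_def
      by (intro suminf_le w_summ summable_mult2 a_sum mult_left_mono a0) simp
    also have "\<dots> = (\<Sum>i. a i) * y" by (rule suminf_mult2[OF a_sum, symmetric])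
    also have "\<dots> \<le> \<epsilon> * y" using a_le that by (rule mult_right_mono)
    finally show ?thesis .
  qed
  have w_abs: "\<bar>w y\<bar> \<le> \<epsilon> * \<bar>y\<bar>" for y
  proof (cases "0 \<le> y")
    case True
    then show ?thesis using w_pos w_up by simp
  next
    case False
    then have "w y \<le> (\<Sum>i. 0)"
      unfolding w_def using b0 a0
      by (intro suminf_le w_summ) (auto intro!: mult_nonneg_nonpos simp: min_def)
    then show ?thesis using False w_neg[of y] by simp
  qed
  have w_int: "integrable \<mu> (\<lambda>x. w (y + x))" for y
  proof (rule integrable_linear_growth[of _ "\<epsilon> * \<bar>y\<bar>" \<epsilon>])
    show "\<bar>w (y + x)\<bar> \<le> \<epsilon> * \<bar>y\<bar> + \<epsilon> * \<bar>x\<bar>" for x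
    proof -
      have "\<epsilon> * \<bar>y + x\<bar> \<le> \<epsilon> * (\<bar>y\<bar> + \<bar>x\<bar>)" using assms by (intro mult_left_mono) auto
      then show ?thesis using w_abs[of "y + x"] by (simp add: distrib_left)
    qed
  qed auto
  have w_expand: "(\<lambda>i. a i * (\<integral>x. min (y + x) (b i) \<partial>\<mu>)) sums (\<integral>x. w (y + x) \<partial>\<mu>)" for y
  proof -
    have int_abs: "integrable \<mu> (\<lambda>x. \<bar>y + x\<bar>)" by auto
    have "(\<lambda>i. (\<integral>x. a i * min (y + x) (b i) \<partial>\<mu>)) sums (\<integral>x. (\<Sum>i. a i * min (y + x) (b i)) \<partial>\<mu>)"
    proof (rule sums_integral)
      show "integrable \<mu> (\<lambda>x. a i * min (y + x) (b i))" for i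
        using integrable_min_shift by auto
      show "AE x in \<mu>. summable (\<lambda>i. norm (a i * min (y + x) (b i)))"
        by (intro AE_I2 summable_comparison_test'[OF summable_mult2[OF a_sum]])
           (use term_bound in simp)
      show "summable (\<lambda>i. \<integral>x. norm (a i * min (y + x) (b i)) \<partial>\<mu>)"
      proof (rule summable_comparison_test'[OF summable_mult2[OF a_sum, of "\<integral>x. \<bar>y + x\<bar> \<partial>\<mu>"]])
        fix i
        have "norm (\<integral>x. norm (a i * min (y + x) (b i)) \<partial>\<mu>) = (\<integral>x. norm (a i * min (y + x) (b i)) \<partial>\<mu>)"
          by (simp add: integral_nonneg_AE)
        also have "\<dots> \<le> (\<integral>x. a i * \<bar>y + x\<bar> \<partial>\<mu>)"
          using integrable_min_shift int_abs
          by (intro integral_mono term_bound) auto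
        finally show "norm (\<integral>x. norm (a i * min (y + x) (b i)) \<partial>\<mu>) \<le> a i * (\<integral>x. \<bar>y + x\<bar> \<partial>\<mu>)"
          by simp
      qed
    qed
    then show ?thesis using integrable_min_shift by (simp add: w_def)
  qed
  have terms: "a i * (\<integral>x. min (y + x) (b i) \<partial>\<mu>) \<le> a i * min y (b i)" for i y
    by (intro mult_left_mono kink_superharmonic a0)
  have w_super: "(\<integral>x. w (y + x) \<partial>\<mu>) \<le> w y" for y
    unfolding w_def[of y] by (rule sums_le[OF terms w_expand summable_sums[OF w_summ]])
  have w_drift: "(\<integral>x. w (y + x) \<partial>\<mu>) + lower_tail y \<le> w y" if y: "real J * \<delta> < y" for y
  proof -
    have "0 < y" using y \<delta> by (smt (verit) mult_nonneg_nonneg of_nat_0_le_iff)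
    \<comment> \<open>only the kink at the first grid point above \<open>y\<close> is needed\<close>
    define j where "j = nat \<lceil>y / \<delta>\<rceil>"
    have "real J < y / \<delta>" using y \<delta> by (simp add: field_simps)
    then have jJ: "J + 1 \<le> j" unfolding j_def by linarith
    have j1: "y / \<delta> \<le> real j" "real j - 1 < y / \<delta>"
      unfolding j_def using \<open>real J < y / \<delta>\<close> by linarith+
    define i where "i = j - 1 - J"
    have ij: "i + J + 1 = j" "real (i + J) = real j - 1" using jJ by (auto simp: i_def)
    have bi: "y \<le> b i" "b i \<le> y + \<delta>" and lt: "real (i + J) * \<delta> < y"
      using j1 \<delta> unfolding b_def ij by (auto simp: field_simps)
    have ai: "lower_tail y / c \<le> a i"
      unfolding a_def using lt c by (intro divide_right_mono lower_tail_antimono) auto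
    have gap: "lower_tail y \<le> a i * min y (b i) - a i * (\<integral>x. min (y + x) (b i) \<partial>\<mu>)"
    proof -
      have "lower_tail y = lower_tail y / c * c" using c by simp
      also have "\<dots> \<le> a i * c" using ai c by (intro mult_right_mono) auto
      also have "\<dots> \<le> a i * (min y (b i) - (\<integral>x. min (y + x) (b i) \<partial>\<mu>))"
        using kink[OF bi] by (intro mult_left_mono a0) auto
      finally show ?thesis by (simp add: right_diff_distrib)
    qed
    have s: "(\<lambda>k. a k * min y (b k) - a k * (\<integral>x. min (y + x) (b k) \<partial>\<mu>)) sums (w y - (\<integral>x. w (y + x) \<partial>\<mu>))"
      unfolding w_def[of y] by (intro sums_diff summable_sums w_summ w_expand)
    have "(\<Sum>k\<in>{i}. a k * min y (b k) - a k * (\<integral>x. min (y + x) (b k) \<partial>\<mu>))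
        \<le> w y - (\<integral>x. w (y + x) \<partial>\<mu>)"
      unfolding sums_unique[OF s]
    proof (rule sum_le_suminf)
      show "summable (\<lambda>k. a k * min y (b k) - a k * (\<integral>x. min (y + x) (b k) \<partial>\<mu>))"
        using s by (rule sums_summable)
    qed (use terms in simp_all)
    then show ?thesis using gap by simp
  qed
  show ?thesis
  proof (rule that[of w "real J * \<delta>"])
    show "0 \<le> real J * \<delta>" using \<delta> by simp
  qed (fact w_meas w_neg w_pos w_up w_int | rule w_super | erule w_drift)+
qed

text \<open>
  The negative part of the walk grows by \<open>lower_tail y\<close> in one step from \<open>y\<close>.  The kinks pay for
  this beyond \<open>M\<close> and a multiple of the exponential barrier pays for it on \<open>(0, M]\<close>.  Since the kinks have
  slope at most \<open>\<epsilon>\<close>, the sum remains nonnegative on the negative axis, where it must dominate a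
  positive multiple of \<open>- y\<close>, and its asymptotic slope on the positive axis can be taken close to \<open>1\<close>.
\<close>

lemma linear_superharmonic:
  assumes "0 < \<eta>"
  obtains V C where "V \<in> borel_measurable borel" "0 \<le> C" "\<And>y. 0 \<le> V y"
    "\<And>y. 0 < y \<Longrightarrow> y \<le> V y" "\<And>y. 0 < y \<Longrightarrow> V y \<le> (1 + \<eta>) * y + C"
    "\<And>y. integrable \<mu> (\<lambda>x. V (y + x))"
    "\<And>y. 0 < y \<Longrightarrow> (\<integral>x. V (y + x) \<partial>\<mu>) \<le> V y"
proof -
  \<comment> \<open>chosen such that \<open>1 / (1 - \<epsilon>) = 1 + \<eta>\<close>\<close>
  define \<epsilon> where "\<epsilon> = \<eta> / (1 + \<eta>)"
  have \<epsilon>: "0 < \<epsilon>" "\<epsilon> < 1" using assms by (auto simp: \<epsilon>_def)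
  have \<epsilon>\<eta>: "1 / (1 - \<epsilon>) = 1 + \<eta>" "\<epsilon> * (1 + \<eta>) = \<eta>"
    using assms by (auto simp: \<epsilon>_def field_simps)
  obtain w M where w: "w \<in> borel_measurable borel" "\<And>y. y \<le> 0 \<Longrightarrow> \<epsilon> * y \<le> w y"
    "\<And>y. 0 \<le> y \<Longrightarrow> 0 \<le> w y" "\<And>y. 0 \<le> y \<Longrightarrow> w y \<le> \<epsilon> * y"
    "\<And>y. integrable \<mu> (\<lambda>x. w (y + x))"
    "\<And>y. 0 < y \<Longrightarrow> (\<integral>x. w (y + x) \<partial>\<mu>) \<le> w y"
    "\<And>y. M < y \<Longrightarrow> (\<integral>x. w (y + x) \<partial>\<mu>) + lower_tail y \<le> w y" "0 \<le> M"
    using kink_barrier[OF \<epsilon>(1)] by blast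
  obtain l L v where v: "0 < l" "0 \<le> L" "v \<in> borel_measurable borel" "\<And>y. 0 \<le> v y" "\<And>y. v y \<le> L"
    "\<And>y. 0 < y \<Longrightarrow> (\<integral>x. v (y + x) \<partial>\<mu>) + exp (- l * y) \<le> v y"
    using exponential_barrier by blast
  note [measurable] = w(1) v(3)
  have v_int: "integrable \<mu> (\<lambda>x. v (y + x))" for y
    by (rule integrable_bounded[of _ L]) (use v in auto)
  \<comment> \<open>large enough for \<open>B * exp (- l * y)\<close> to exceed \<open>lower_tail y\<close> on \<open>(0, M]\<close>\<close>
  define B where "B = lower_tail 0 * exp (l * M)"
  have B: "0 \<le> B" by (simp add: B_def lower_tail_nonneg)
  define u where "u y = w y + B * v y" for y
  have u_int: "integrable \<mu> (\<lambda>x. u (y + x))" for y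
    unfolding u_def using w(5) v_int by auto
  have u_drift: "(\<integral>x. u (y + x) \<partial>\<mu>) + lower_tail y \<le> u y" if "0 < y" for y
  proof -
    have eq: "(\<integral>x. u (y + x) \<partial>\<mu>) = (\<integral>x. w (y + x) \<partial>\<mu>) + B * (\<integral>x. v (y + x) \<partial>\<mu>)"
      unfolding u_def using w(5) v_int by simp
    have vv: "B * (\<integral>x. v (y + x) \<partial>\<mu>) + B * exp (- l * y) \<le> B * v y"
      using v(6)[OF that] B by (metis distrib_left mult_left_mono)
    show ?thesis
    proof (cases "M < y")
      case True
      have "0 \<le> B * exp (- l * y)" using B by simp
      then show ?thesis using w(7)[OF True] vv eq by (simp add: u_def)
    next
      case False
      have "lower_tail y \<le> lower_tail 0" using that by (intro lower_tail_antimono) auto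
      also have "\<dots> \<le> B * exp (- l * y)"
      proof -
        have "exp 0 \<le> exp (l * M + - l * y)" using False v(1) by (simp add: mult_left_mono)
        then have "lower_tail 0 * 1 \<le> lower_tail 0 * (exp (l * M) * exp (- l * y))"
          unfolding exp_add by (intro mult_left_mono lower_tail_nonneg) simp
        then show ?thesis by (simp add: B_def mult.assoc)
      qed
      finally show ?thesis using w(6)[OF that] vv eq by (simp add: u_def)
    qed
  qed
  define V where "V y = y + (1 + \<eta>) * (max 0 (- y) + u y)" for y
  have neg_int: "integrable \<mu> (\<lambda>x. max 0 (- (y + x)))" for y
    using integrable_max_neg[of y] by (simp add: algebra_simps)
  have V_nonneg: "0 \<le> V y" for y
  proof (cases "0 \<le> y")
    case True
    then show ?thesis using w(3)[of y] v(4)[of y] B assms by (simp add: V_def u_def)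
  next
    case False
    have "(1 - \<epsilon>) * (- y) \<le> max 0 (- y) + u y"
      using False w(2)[of y] mult_nonneg_nonneg[OF B v(4)[of y]] by (simp add: u_def algebra_simps)
    then have "(1 + \<eta>) * ((1 - \<epsilon>) * (- y)) \<le> (1 + \<eta>) * (max 0 (- y) + u y)"
      using assms by (intro mult_left_mono) auto
    moreover have "(1 + \<eta>) * ((1 - \<epsilon>) * (- y)) = - y"
    proof -
      have "(1 + \<eta>) * (1 - \<epsilon>) = 1" using \<epsilon>\<eta>(2) by (simp add: algebra_simps)
      then show ?thesis by (metis mult.assoc mult_1)
    qed
    ultimately show ?thesis unfolding V_def by linarith
  qed
  have V_low: "y \<le> V y" if "0 < y" for y
    using that w(3)[of y] v(4)[of y] B assms by (simp add: V_def u_def)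
  have V_up: "V y \<le> (1 + \<eta>) * y + (1 + \<eta>) * (B * L)" if "0 < y" for y
  proof -
    have "u y \<le> \<epsilon> * y + B * L"
      unfolding u_def using that w(4)[of y] v(5)[of y] B by (intro add_mono mult_left_mono) auto
    then have "(1 + \<eta>) * u y \<le> (1 + \<eta>) * (\<epsilon> * y + B * L)" using assms by (intro mult_left_mono) auto
    also have "\<dots> = \<eta> * y + (1 + \<eta>) * (B * L)" using \<epsilon>\<eta>(2) by (metis distrib_left mult.assoc mult.commute)
    finally show ?thesis using that by (simp add: V_def algebra_simps)
  qed
  have V_int: "integrable \<mu> (\<lambda>x. V (y + x))" for y
    unfolding V_def using neg_int u_int by auto
  have V_super: "(\<integral>x. V (y + x) \<partial>\<mu>) \<le> V y" if "0 < y" for y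
  proof -
    have lt: "(\<integral>x. max 0 (- (y + x)) \<partial>\<mu>) = lower_tail y"
      unfolding lower_tail_def by (intro Bochner_Integration.integral_cong) (auto simp: algebra_simps)
    have "(\<integral>x. V (y + x) \<partial>\<mu>) = y + (1 + \<eta>) * (lower_tail y + (\<integral>x. u (y + x) \<partial>\<mu>))"
      unfolding V_def using neg_int u_int lt by simp
    also have "\<dots> \<le> y + (1 + \<eta>) * u y"
      using u_drift[OF that] assms by (intro add_left_mono mult_left_mono) auto
    finally show ?thesis using that by (simp add: V_def)
  qed
  show ?thesis
  proof (rule that[of V "(1 + \<eta>) * (B * L)"])
    show "V \<in> borel_measurable borel" unfolding V_def[abs_def] u_def by measurable
    show "0 \<le> (1 + \<eta>) * (B * L)" using assms B v(2) by simp
  qed (fact V_nonneg V_low V_up V_int V_super)+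
qed

end

section \<open>The killed semigroup and the renewal function\<close>

lemma ennreal_bounded_sums_tendsto_zero:
  fixes f :: "nat \<Rightarrow> ennreal"
  assumes "\<And>N. (\<Sum>n<N. f n) \<le> C" "C < \<infinity>"
  shows "f \<longlonglongrightarrow> 0"
proof -
  obtain K where K: "C = ennreal K" "0 \<le> K" using assms(2) by (cases C) auto
  have le: "f n \<le> C" for n
  proof -
    have "f n \<le> (\<Sum>k<Suc n. f k)" by simp
    then show ?thesis using assms(1) order_trans by blast
  qed
  define r where "r n = enn2real (f n)" for n
  have f: "f n = ennreal (r n)" for n
    using le[of n] assms(2) by (simp add: r_def order.strict_trans1)
  have r0: "0 \<le> r n" for n by (simp add: r_def)
  have "(\<Sum>n<N. r n) \<le> K" for N
    using assms(1)[of N] K r0 by (simp add: f sum_ennreal sum_nonneg)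
  then have "summable r" using r0 by (intro summableI_nonneg_bounded)
  then have "r \<longlonglongrightarrow> 0" by (rule summable_LIMSEQ_zero)
  then have "(\<lambda>n. ennreal (r n)) \<longlonglongrightarrow> ennreal 0" by (rule tendsto_ennrealI)
  then show ?thesis by (simp add: f[symmetric])
qed

context centered_law
begin

text \<open>
  The transition operator of the walk killed upon entering \<open>(-\<infinity>, 0]\<close>.  The starting point itself is not
  required to be positive; at the starting point \<open>0\<close> the iterates integrate over the paths with positive
  partial sums.
\<close>

definition kill_op :: "(real \<Rightarrow> ennreal) \<Rightarrow> real \<Rightarrow> ennreal" where
  "kill_op f x = (\<integral>\<^sup>+y. f (x + y) * indicator {0<..} (x + y) \<partial>\<mu>)"

abbreviation killed :: "nat \<Rightarrow> (real \<Rightarrow> ennreal) \<Rightarrow> real \<Rightarrow> ennreal" where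
  "killed n \<equiv> kill_op ^^ n"

lemma kill_op_measurable [measurable]:
  assumes [measurable]: "f \<in> borel_measurable borel"
  shows "kill_op f \<in> borel_measurable borel"
  unfolding kill_op_def[abs_def] by measurable

lemma killed_measurable [measurable]:
  assumes "f \<in> borel_measurable borel"
  shows "killed n f \<in> borel_measurable borel"
  using assms by (induction n) auto

lemma killed_Suc: "killed (Suc n) f = killed n (kill_op f)"
  by (simp add: funpow_swap1)

lemma kill_op_mono:
  assumes "\<And>y. 0 < y \<Longrightarrow> f y \<le> g y"
  shows "kill_op f x \<le> kill_op g x"
  unfolding kill_op_def by (intro nn_integral_mono) (auto split: split_indicator intro: assms)

text \<open>
  The set \<open>A\<close> allows the starting point \<open>0\<close> in addition to the open half-line.
\<close>

lemma killed_mono: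
  assumes "{0<..} \<subseteq> A" "\<And>y. y \<in> A \<Longrightarrow> f y \<le> g y" "x \<in> A"
  shows "killed n f x \<le> killed n g x"
  using assms(3)
proof (induction n arbitrary: x)
  case 0
  then show ?case using assms(2) by simp
next
  case (Suc n)
  have "kill_op (killed n f) x \<le> kill_op (killed n g) x"
    by (rule kill_op_mono) (use Suc.IH assms(1) in auto)
  then show ?case by simp
qed

lemma killed_superharmonic:
  assumes "{0<..} \<subseteq> A" "\<And>y. y \<in> A \<Longrightarrow> kill_op g y \<le> g y" "x \<in> A"
  shows "killed (Suc n) g x \<le> killed n g x" "killed n g x \<le> g x"
proof -
  show *: "killed (Suc n) g x \<le> killed n g x" for n
    unfolding killed_Suc by (rule killed_mono[OF assms])
  show "killed n g x \<le> g x"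
    by (induction n) (use * order_trans in fastforce)+
qed

lemma killed_add:
  assumes [measurable]: "f \<in> borel_measurable borel" "g \<in> borel_measurable borel"
  shows "killed n (\<lambda>y. f y + g y) x = killed n f x + killed n g x"
proof (induction n arbitrary: x)
  case (Suc n)
  have "killed n (\<lambda>y. f y + g y) = (\<lambda>x. killed n f x + killed n g x)"
    using Suc by auto
  then have "killed (Suc n) (\<lambda>y. f y + g y) x = kill_op (\<lambda>x. killed n f x + killed n g x) x"
    by simp
  also have "\<dots> = kill_op (killed n f) x + kill_op (killed n g) x"
    unfolding kill_op_def[of _ x] by (simp add: distrib_right nn_integral_add)
  finally show ?case by simp
qed simp

lemma killed_cmult:
  assumes [measurable]: "f \<in> borel_measurable borel"
  shows "killed n (\<lambda>y. c * f y) x = c * killed n f x"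
proof (induction n arbitrary: x)
  case (Suc n)
  have "killed n (\<lambda>y. c * f y) = (\<lambda>x. c * killed n f x)"
    using Suc by auto
  then have "killed (Suc n) (\<lambda>y. c * f y) x = kill_op (\<lambda>x. c * killed n f x) x"
    by simp
  also have "\<dots> = c * kill_op (killed n f) x"
    unfolding kill_op_def[of _ x] by (simp add: mult.assoc nn_integral_cmult)
  finally show ?case by simp
qed simp

lemma killed_linear:
  assumes "f \<in> borel_measurable borel" "g \<in> borel_measurable borel"
  shows "killed n (\<lambda>y. a * f y + b * g y) x = a * killed n f x + b * killed n g x"
  using assms by (simp add: killed_add killed_cmult)

lemma kill_op_le_ennreal:
  assumes "integrable \<mu> (\<lambda>x. V (y + x))" "\<And>y. 0 \<le> V y" "(\<integral>x. V (y + x) \<partial>\<mu>) \<le> v"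
  shows "kill_op (\<lambda>y. ennreal (V y)) y \<le> ennreal v"
proof -
  have "kill_op (\<lambda>y. ennreal (V y)) y \<le> (\<integral>\<^sup>+x. ennreal (V (y + x)) \<partial>\<mu>)"
    unfolding kill_op_def by (intro nn_integral_mono) (simp split: split_indicator)
  also have "\<dots> = ennreal (\<integral>x. V (y + x) \<partial>\<mu>)"
    by (rule nn_integral_eq_integral) (use assms in auto)
  finally show ?thesis using assms(3) by (meson ennreal_leI order_trans)
qed

text \<open>
  A linear superharmonic \<open>V\<close> makes it unlikely to be alive far away, and the exponential barrier makes it
  unlikely to be alive nearby.  Shifting both by \<open>1\<close> keeps the estimates valid for the starting point \<open>0\<close>.
\<close>

lemma survival_tendsto_zero:
  assumes "0 \<le> x"
  shows "(\<lambda>n. killed n (\<lambda>_. 1) x) \<longlonglongrightarrow> 0"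
proof -
  obtain V C where V: "V \<in> borel_measurable borel" "\<And>y. 0 \<le> V y"
    "\<And>y. 0 < y \<Longrightarrow> y \<le> V y"
    "\<And>y. integrable \<mu> (\<lambda>x. V (y + x))"
    "\<And>y. 0 < y \<Longrightarrow> (\<integral>x. V (y + x) \<partial>\<mu>) \<le> V y"
    using linear_superharmonic[of 1] by (metis zero_less_one)
  obtain l L v where v: "0 < l" "v \<in> borel_measurable borel" "\<And>y. 0 \<le> v y" "\<And>y. v y \<le> L"
    "\<And>y. 0 < y \<Longrightarrow> (\<integral>x. v (y + x) \<partial>\<mu>) + exp (- l * y) \<le> v y"
    using exponential_barrier by metis
  note [measurable] = V(1) v(2)
  define V1 where "V1 y = ennreal (V (y + 1))" for y
  define v1 where "v1 y = ennreal (v (y + 1))" for y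
  define e1 where "e1 y = ennreal (exp (- l * (y + 1)))" for y
  have [measurable]: "V1 \<in> borel_measurable borel" "v1 \<in> borel_measurable borel" "e1 \<in> borel_measurable borel"
    unfolding V1_def[abs_def] v1_def[abs_def] e1_def[abs_def] by measurable
  have A: "{0<..} \<subseteq> {0::real..}" "x \<in> {0..}" using assms by auto
  have V1_super: "killed n V1 x \<le> V1 x" for n
  proof (rule killed_superharmonic(2)[OF A(1) _ A(2)])
    fix y :: real assume "y \<in> {0..}"
    then show "kill_op V1 y \<le> V1 y"
      unfolding V1_def using V(4)[of "y + 1"] V(5)[of "y + 1"] V(2)
      by (intro kill_op_le_ennreal[where V = "\<lambda>y. V (y + 1)"]) (auto simp: algebra_simps)
  qed
  have v_int: "integrable \<mu> (\<lambda>x. v (y + x))" for y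
    by (rule integrable_bounded[of _ L]) (use v in auto)
  have v1_drift: "kill_op v1 y + e1 y \<le> v1 y" if "0 \<le> y" for y
  proof -
    have "kill_op v1 y \<le> ennreal (\<integral>x. v (y + 1 + x) \<partial>\<mu>)"
      unfolding v1_def using v_int[of "y + 1"] v(3)
      by (intro kill_op_le_ennreal[where V = "\<lambda>y. v (y + 1)"]) (auto simp: algebra_simps)
    then have "kill_op v1 y + e1 y \<le> ennreal ((\<integral>x. v (y + 1 + x) \<partial>\<mu>) + exp (- l * (y + 1)))"
      unfolding e1_def using v(3) by (subst ennreal_plus) (auto intro!: integral_nonneg_AE add_right_mono)
    also have "\<dots> \<le> v1 y"
      unfolding v1_def using v(5)[of "y + 1"] that by (intro ennreal_leI) auto
    finally show ?thesis .
  qed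
  have "(\<Sum>n<N. killed n e1 x) + killed N v1 x \<le> v1 x" for N
  proof (induction N)
    case (Suc N)
    have "killed N e1 x + killed (Suc N) v1 x = killed N (\<lambda>y. e1 y + kill_op v1 y) x"
      unfolding killed_Suc by (subst killed_add) auto
    also have "\<dots> \<le> killed N v1 x"
      by (rule killed_mono[OF A(1) _ A(2)]) (use v1_drift in \<open>auto simp: add.commute\<close>)
    finally have "(\<Sum>n<N. killed n e1 x) + (killed N e1 x + killed (Suc N) v1 x) \<le> v1 x"
      using Suc.IH by (meson add_left_mono order_trans)
    then show ?case by (simp add: add.assoc)
  qed simp
  then have "(\<Sum>n<N. killed n e1 x) \<le> v1 x" for N
    by (meson le_iff_add order_trans)
  then have e1_lim: "(\<lambda>n. killed n e1 x) \<longlonglongrightarrow> 0"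
    by (rule ennreal_bounded_sums_tendsto_zero) (simp add: v1_def)
  have bound: "killed n (\<lambda>_. 1) x \<le> ennreal (1 / R) * V1 x + ennreal (exp (l * R)) * killed n e1 x"
    if "0 < R" for R n
  proof -
    have "killed n (\<lambda>_. 1) x \<le> killed n (\<lambda>y. ennreal (1 / R) * V1 y + ennreal (exp (l * R)) * e1 y) x"
    proof (rule killed_mono[OF A(1) _ A(2)])
      fix y :: real assume y: "y \<in> {0..}"
      have "1 \<le> 1 / R * V (y + 1) + exp (l * R) * exp (- l * (y + 1))"
      proof (cases "R \<le> y + 1")
        case True
        then have "R \<le> V (y + 1)" using V(3)[of "y + 1"] y by simp
        then have "1 \<le> 1 / R * V (y + 1)" using that by (simp add: field_simps)
        then show ?thesis by (simp add: add_increasing2)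
      next
        case False
        then have "l * (y + 1) \<le> l * R" using v(1) by (intro mult_left_mono) auto
        then have "1 \<le> exp (l * R) * exp (- l * (y + 1))"
          unfolding exp_add[symmetric] by simp
        then show ?thesis using V(2)[of "y + 1"] that by (simp add: add_increasing)
      qed
      then have "ennreal 1 \<le> ennreal (1 / R * V (y + 1) + exp (l * R) * exp (- l * (y + 1)))"
        by (rule ennreal_leI)
      also have "\<dots> = ennreal (1 / R) * V1 y + ennreal (exp (l * R)) * e1 y"
        unfolding V1_def e1_def using that V(2)[of "y + 1"]
        by (subst ennreal_plus) (auto simp: ennreal_mult simp del: times_divide_eq_left)
      finally show "1 \<le> ennreal (1 / R) * V1 y + ennreal (exp (l * R)) * e1 y" by simp
    qed
    also have "\<dots> = ennreal (1 / R) * killed n V1 x + ennreal (exp (l * R)) * killed n e1 x"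
      by (rule killed_linear) auto
    also have "\<dots> \<le> ennreal (1 / R) * V1 x + ennreal (exp (l * R)) * killed n e1 x"
      by (intro add_right_mono mult_left_mono V1_super) simp
    finally show ?thesis .
  qed
  show ?thesis
  proof (rule order_tendstoI)
    fix a :: ennreal assume "0 < a"
    define W where "W = V (x + 1)"
    have W: "0 \<le> W" "V1 x = ennreal W" using V(2) by (auto simp: W_def V1_def)
    obtain b where b: "0 < b" "ennreal b < a"
      using \<open>0 < a\<close> by (metis dense ennreal_cases ennreal_less_zero_iff less_top_ennreal order_less_imp_not_less top.not_eq_extremum zero_less_iff_neq_zero ennreal_eq_0_iff not_le)
    define R where "R = (W + 1) / b"
    have R: "0 < R" using W b by (simp add: R_def)
    have "(\<lambda>n. ennreal (1 / R) * V1 x + ennreal (exp (l * R)) * killed n e1 x)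
        \<longlonglongrightarrow> ennreal (1 / R) * V1 x + ennreal (exp (l * R)) * 0"
      by (intro tendsto_add tendsto_const ennreal_tendsto_cmult e1_lim) auto
    moreover have "ennreal (1 / R) * V1 x + ennreal (exp (l * R)) * 0 < a"
    proof -
      have "1 / R * W \<le> b" using W b by (simp add: R_def field_simps)
      then have "ennreal (1 / R) * V1 x \<le> ennreal b"
        using R W by (simp add: ennreal_mult[symmetric] ennreal_leI)
      then show ?thesis using b(2) by simp
    qed
    ultimately have "eventually (\<lambda>n. ennreal (1 / R) * V1 x + ennreal (exp (l * R)) * killed n e1 x < a) sequentially"
      by (rule order_tendstoD(2))
    then show "eventually (\<lambda>n. killed n (\<lambda>_. 1) x < a) sequentially"
      by eventually_elim (use bound[OF R] order.strict_trans1 in blast)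
  qed simp
qed

lemma positive_part_subharmonic: "ennreal x \<le> kill_op ennreal x"
proof -
  have int: "integrable \<mu> (\<lambda>y. max 0 (x + y))"
    by (rule integrable_linear_growth[of _ "\<bar>x\<bar>" 1]) auto
  have "x = (\<integral>y. x + y \<partial>\<mu>)" by simp
  also have "\<dots> \<le> (\<integral>y. max 0 (x + y) \<partial>\<mu>)" using int by (intro integral_mono) auto
  finally have "ennreal x \<le> ennreal (\<integral>y. max 0 (x + y) \<partial>\<mu>)" by (rule ennreal_leI)
  also have "\<dots> = (\<integral>\<^sup>+y. ennreal (max 0 (x + y)) \<partial>\<mu>)"
    by (rule nn_integral_eq_integral[symmetric]) (use int in auto)
  also have "\<dots> = kill_op ennreal x"
    unfolding kill_op_def
    by (intro nn_integral_cong) (auto split: split_indicator simp: max_def ennreal_neg)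
  finally show ?thesis .
qed

lemma killed_positive_part_incseq: "incseq (\<lambda>n. killed n ennreal x)"
proof (rule incseq_SucI)
  show "killed n ennreal x \<le> killed (Suc n) ennreal x" for n
    unfolding killed_Suc by (rule killed_mono[of UNIV]) (auto intro: positive_part_subharmonic)
qed

text \<open>
  The limit of \<open>E[x + S_n; \<tau> > n]\<close>.  By optional stopping it is \<open>x - E (x + S_\<tau>)\<close>, that is, the function \<open>H\<close>;
  see \<open>H_fun_eq_renewal\<close>.  In this form harmonicity is monotone convergence.
\<close>

definition renewal_ennreal :: "real \<Rightarrow> ennreal" where
  "renewal_ennreal x = (SUP n. killed n ennreal x) * indicator {0<..} x"

definition renewal :: "real \<Rightarrow> real" where
  "renewal x = enn2real (renewal_ennreal x)"

lemma renewal_ennreal_measurable [measurable]: "renewal_ennreal \<in> borel_measurable borel"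
  unfolding renewal_ennreal_def[abs_def] by measurable

lemma renewal_measurable [measurable]: "renewal \<in> borel_measurable borel"
  unfolding renewal_def[abs_def] by measurable

lemma renewal_ennreal_upper:
  assumes "0 < \<eta>"
  shows "\<exists>C\<ge>0. \<forall>x>0. renewal_ennreal x \<le> ennreal ((1 + \<eta>) * x + C)"
proof -
  obtain V C where V: "V \<in> borel_measurable borel" "0 \<le> C" "\<And>y. 0 \<le> V y"
    "\<And>y. 0 < y \<Longrightarrow> y \<le> V y" "\<And>y. 0 < y \<Longrightarrow> V y \<le> (1 + \<eta>) * y + C"
    "\<And>y. integrable \<mu> (\<lambda>x. V (y + x))"
    "\<And>y. 0 < y \<Longrightarrow> (\<integral>x. V (y + x) \<partial>\<mu>) \<le> V y"
    using linear_superharmonic[OF assms] by metis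
  have "renewal_ennreal x \<le> ennreal ((1 + \<eta>) * x + C)" if "0 < x" for x
  proof -
    have "killed n ennreal x \<le> ennreal ((1 + \<eta>) * x + C)" for n
    proof -
      have "killed n ennreal x \<le> killed n (\<lambda>y. ennreal (V y)) x"
        by (rule killed_mono[of "{0<..}"]) (use V(4) that in \<open>auto intro: ennreal_leI\<close>)
      also have "\<dots> \<le> ennreal (V x)"
        by (rule killed_superharmonic(2)[of "{0<..}"])
           (use V that in \<open>auto intro!: kill_op_le_ennreal\<close>)
      also have "\<dots> \<le> ennreal ((1 + \<eta>) * x + C)" using V(5)[OF that] by (rule ennreal_leI)
      finally show ?thesis .
    qed
    then show ?thesis using that by (auto simp: renewal_ennreal_def intro: SUP_least)
  qed
  then show ?thesis using V(2) by blast
qed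

lemma ennreal_renewal: "ennreal (renewal x) = renewal_ennreal x"
proof (cases "0 < x")
  case True
  obtain C where "renewal_ennreal x \<le> ennreal ((1 + 1) * x + C)"
    using renewal_ennreal_upper[of 1] True by auto
  then have "renewal_ennreal x < \<top>" by (simp add: order.strict_trans1)
  then show ?thesis by (simp add: renewal_def)
qed (simp add: renewal_def renewal_ennreal_def)

lemma renewal_nonneg: "0 \<le> renewal x" by (simp add: renewal_def)

lemma renewal_nonpos: "x \<le> 0 \<Longrightarrow> renewal x = 0"
  by (simp add: renewal_def renewal_ennreal_def)

lemma ennreal_renewal_SUP: "0 < x \<Longrightarrow> ennreal (renewal x) = (SUP n. killed n ennreal x)"
  by (simp add: ennreal_renewal renewal_ennreal_def)

lemma renewal_ge: "x \<le> renewal x"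
proof (cases "0 < x")
  case True
  have "killed 0 ennreal x \<le> (SUP n. killed n ennreal x)" by (intro SUP_upper) auto
  then have "ennreal x \<le> ennreal (renewal x)" using True by (simp add: ennreal_renewal_SUP)
  then show ?thesis using renewal_nonneg by (simp add: ennreal_le_iff)
qed (use renewal_nonneg[of x] in linarith)

lemma renewal_upper:
  assumes "0 < \<eta>"
  shows "\<exists>C\<ge>0. \<forall>x>0. renewal x \<le> (1 + \<eta>) * x + C"
proof -
  obtain C where C: "0 \<le> C" "\<forall>x>0. renewal_ennreal x \<le> ennreal ((1 + \<eta>) * x + C)"
    using renewal_ennreal_upper[OF assms] by auto
  have "renewal x \<le> (1 + \<eta>) * x + C" if "0 < x" for x
  proof -
    have "ennreal (renewal x) \<le> ennreal ((1 + \<eta>) * x + C)"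
      using C(2) that by (simp add: ennreal_renewal)
    moreover have "0 \<le> (1 + \<eta>) * x + C" using C(1) that assms by simp
    ultimately show ?thesis by (simp add: ennreal_le_iff)
  qed
  then show ?thesis using C(1) by blast
qed

lemma renewal_harmonic:
  assumes "0 < x"
  shows "(\<integral>\<^sup>+y. ennreal (renewal (x + y)) \<partial>\<mu>) = ennreal (renewal x)"
proof -
  have "(\<integral>\<^sup>+y. ennreal (renewal (x + y)) \<partial>\<mu>)
      = (\<integral>\<^sup>+y. (SUP n. killed n ennreal (x + y) * indicator {0<..} (x + y)) \<partial>\<mu>)"
    unfolding ennreal_renewal renewal_ennreal_def by (simp add: SUP_mult_right_ennreal)
  also have "\<dots> = (SUP n. \<integral>\<^sup>+y. killed n ennreal (x + y) * indicator {0<..} (x + y) \<partial>\<mu>)"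
    using killed_positive_part_incseq
    by (intro nn_integral_monotone_convergence_SUP)
       (auto simp: incseq_def le_fun_def intro!: mult_right_mono)
  also have "\<dots> = (SUP n. killed (Suc n) ennreal x)"
    by (simp add: kill_op_def)
  also have "\<dots> = (SUP n. killed n ennreal x)"
    by (rule SUP_eq)
       (use killed_positive_part_incseq[of x] in \<open>auto simp: incseq_Suc_iff simp del: funpow.simps\<close>)
  finally show ?thesis using assms by (simp add: ennreal_renewal_SUP)
qed

text \<open>
  Iterating subharmonicity compares \<open>g\<close> with \<open>C\<close> times the sum of the survival probability, which tends to \<open>0\<close>,
  and of \<open>E[x + S_n; \<tau> > n]\<close>, which increases to the renewal function.
\<close>

lemma subharmonic_le_renewal:
  assumes [measurable]: "g \<in> borel_measurable borel"
    and sub: "\<And>x. 0 < x \<Longrightarrow> g x \<le> kill_op g x"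
    and growth: "\<And>x. 0 < x \<Longrightarrow> g x \<le> ennreal C * (1 + ennreal x)"
    and "0 < x"
  shows "g x \<le> ennreal C * ennreal (renewal x)"
proof (rule LIMSEQ_le_const)
  have "(\<lambda>n. ennreal C * killed n (\<lambda>_. 1) x + ennreal C * ennreal (renewal x))
      \<longlonglongrightarrow> ennreal C * 0 + ennreal C * ennreal (renewal x)"
    using \<open>0 < x\<close> by (intro tendsto_add tendsto_const ennreal_tendsto_cmult survival_tendsto_zero) auto
  then show "(\<lambda>n. ennreal C * killed n (\<lambda>_. 1) x + ennreal C * ennreal (renewal x))
      \<longlonglongrightarrow> ennreal C * ennreal (renewal x)"
    by simp
  have "g x \<le> ennreal C * killed n (\<lambda>_. 1) x + ennreal C * ennreal (renewal x)" for n
  proof -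
    have "g x \<le> killed n g x"
    proof (induction n)
      case (Suc n)
      have "killed n g x \<le> killed n (kill_op g) x"
        by (rule killed_mono[of "{0<..}"]) (use sub \<open>0 < x\<close> in auto)
      then show ?case using Suc unfolding killed_Suc by (rule order_trans[rotated])
    qed simp
    also have "\<dots> \<le> killed n (\<lambda>x. ennreal C * (1 + ennreal x)) x"
      by (rule killed_mono[of "{0<..}"]) (use growth \<open>0 < x\<close> in auto)
    also have "\<dots> = ennreal C * (killed n (\<lambda>_. 1) x + killed n ennreal x)"
      by (simp add: killed_add killed_cmult)
    also have "\<dots> \<le> ennreal C * (killed n (\<lambda>_. 1) x + ennreal (renewal x))"
      using \<open>0 < x\<close> by (intro mult_left_mono add_left_mono) (auto simp: ennreal_renewal_SUP intro: SUP_upper)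
    finally show ?thesis by (simp add: distrib_left)
  qed
  then show "\<exists>N. \<forall>n\<ge>N. g x \<le> ennreal C * killed n (\<lambda>_. 1) x + ennreal C * ennreal (renewal x)"
    by blast
qed

end

section \<open>Sums of measures and the Wiener-Hopf identity\<close>

definition sum_measure :: "(nat \<Rightarrow> real measure) \<Rightarrow> real measure" where
  "sum_measure m = measure_of UNIV (sets borel) (\<lambda>A. \<Sum>n. emeasure (m n) A)"

lemma sets_sum_measure [simp, measurable_cong]: "sets (sum_measure m) = sets borel"
  unfolding sum_measure_def using sets.sets_measure_of_eq[of borel] by simp

lemma space_sum_measure [simp]: "space (sum_measure m) = UNIV"
  using sets_eq_imp_space_eq[OF sets_sum_measure] by simp

lemma emeasure_sum_measure:
  assumes m: "\<And>n. sets (m n) = sets borel" and A: "A \<in> sets borel"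
  shows "emeasure (sum_measure m) A = (\<Sum>n. emeasure (m n) A)"
proof (rule emeasure_measure_of[OF sum_measure_def])
  show "countably_additive (sets (sum_measure m)) (\<lambda>A. \<Sum>n. emeasure (m n) A)"
  proof (rule countably_additiveI)
    fix B :: "nat \<Rightarrow> real set"
    assume B: "range B \<subseteq> sets (sum_measure m)" "disjoint_family B"
    have "(\<Sum>i. \<Sum>n. emeasure (m n) (B i)) = (\<Sum>i. \<integral>\<^sup>+n. emeasure (m n) (B i) \<partial>count_space UNIV)"
      by (simp add: nn_integral_count_space_nat)
    also have "\<dots> = (\<integral>\<^sup>+n. (\<Sum>i. emeasure (m n) (B i)) \<partial>count_space UNIV)"
      by (rule nn_integral_suminf[symmetric]) auto
    also have "\<dots> = (\<integral>\<^sup>+n. emeasure (m n) (\<Union>i. B i) \<partial>count_space UNIV)"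
      using B m by (intro nn_integral_cong suminf_emeasure) auto
    finally show "(\<Sum>i. \<Sum>n. emeasure (m n) (B i)) = (\<Sum>n. emeasure (m n) (\<Union>i. B i))"
      by (simp add: nn_integral_count_space_nat)
  qed
qed (use A in \<open>auto simp: positive_def\<close>)

lemma nn_integral_sum_measure:
  assumes m [measurable_cong]: "\<And>n. sets (m n) = sets borel" and f: "f \<in> borel_measurable borel"
  shows "(\<integral>\<^sup>+x. f x \<partial>sum_measure m) = (\<Sum>n. \<integral>\<^sup>+x. f x \<partial>m n)"
  using f
proof (induction rule: borel_measurable_induct)
  case (cong f g)
  then show ?case by simp
next
  case (set A)
  then show ?case using m by (simp add: emeasure_sum_measure)
next
  case (mult u c)
  note [measurable] = mult(2)
  have "(\<integral>\<^sup>+x. u x \<partial>sum_measure m) = (\<Sum>n. \<integral>\<^sup>+x. u x \<partial>m n)" using mult by simp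
  then show ?case by (simp add: nn_integral_cmult)
next
  case (add u v)
  note [measurable] = add.hyps(1,3)
  show ?case using add.IH by (simp add: nn_integral_add suminf_add)
next
  case (seq U)
  note [measurable] = seq.hyps(1)
  have "(\<integral>\<^sup>+x. (SUP i. U i) x \<partial>sum_measure m) = (SUP i. \<integral>\<^sup>+x. U i x \<partial>sum_measure m)"
    using seq.hyps(3) by (simp add: image_comp nn_integral_monotone_convergence_SUP)
  also have "\<dots> = (SUP i. \<Sum>n. \<integral>\<^sup>+x. U i x \<partial>m n)" using seq.IH by simp
  also have "\<dots> = (\<Sum>n. SUP i. \<integral>\<^sup>+x. U i x \<partial>m n)"
    using seq.hyps(3) by (intro ennreal_suminf_SUP_eq[symmetric])
      (auto simp: incseq_def le_fun_def intro!: nn_integral_mono)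
  also have "\<dots> = (\<Sum>n. \<integral>\<^sup>+x. (SUP i. U i) x \<partial>m n)"
    using seq.hyps(3) by (simp add: image_comp nn_integral_monotone_convergence_SUP)
  finally show ?case .
qed

context centered_law
begin

text \<open>
  \<open>stay A n\<close> is the law of \<open>S_n\<close> on the event that \<open>S_1, \<dots>, S_n\<close> lie in \<open>A\<close>, for the walk started at
  \<open>0\<close>, and \<open>leave A n\<close> below is the law of \<open>S_{n+1}\<close> on the event that \<open>n + 1\<close> is the first time outside \<open>A\<close>.
  The start itself is not constrained.
\<close>

primrec stay :: "real set \<Rightarrow> nat \<Rightarrow> real measure" where
  "stay A 0 = return borel 0"
| "stay A (Suc n) = density (stay A n \<star> \<mu>) (indicator A)"

abbreviation climb :: "nat \<Rightarrow> real measure" where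
  "climb \<equiv> stay {0<..}"

definition leave :: "real set \<Rightarrow> nat \<Rightarrow> real measure" where
  "leave A n = density (stay A n \<star> \<mu>) (indicator (- A))"

lemma sets_stay [simp, measurable_cong]: "sets (stay A n) = sets borel"
  by (cases n) auto

lemma space_stay [simp]: "space (stay A n) = UNIV"
  using sets_eq_imp_space_eq[OF sets_stay] by simp

lemma sets_leave [simp, measurable_cong]: "sets (leave A n) = sets borel"
  by (simp add: leave_def)

lemma space_leave [simp]: "space (leave A n) = UNIV"
  using sets_eq_imp_space_eq[OF sets_leave] by simp

abbreviation ladder :: "nat \<Rightarrow> real measure" where
  "ladder \<equiv> leave {..0}"

lemma finite_measure_density_indicator:
  assumes "finite_measure M" "A \<in> sets M"
  shows "finite_measure (density M (indicator A))"
proof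
  interpret finite_measure M by fact
  have "emeasure (density M (indicator A)) (space M) = emeasure M A"
    using assms(2) sets.sets_into_space[OF assms(2)]
    by (subst emeasure_density) (auto simp: Int_absorb1 Int_commute intro!: nn_integral_cong arg_cong[where f = "emeasure M"] simp flip: nn_integral_indicator split: split_indicator)
  then show "emeasure (density M (indicator A)) (space (density M (indicator A))) \<noteq> \<infinity>"
    by simp
qed

lemma finite_measure_law: "finite_measure \<mu>"
  by unfold_locales

lemma finite_measure_stay:
  assumes "A \<in> sets borel"
  shows "finite_measure (stay A n)"
proof (induction n)
  case 0
  show ?case
    using prob_space_return[of "0::real" borel] by (simp add: prob_space.axioms(1))
next
  case (Suc n)
  then show ?case
    using assms by (auto intro!: finite_measure_density_indicator convolution_finite finite_measure_law)
qed

lemma finite_measure_leave: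
  assumes "A \<in> sets borel"
  shows "finite_measure (leave A n)"
  using assms unfolding leave_def
  by (auto intro!: finite_measure_density_indicator convolution_finite finite_measure_law finite_measure_stay)

lemma sigma_finite_stay: "A \<in> sets borel \<Longrightarrow> sigma_finite_measure (stay A n)"
  using finite_measure_stay by (auto intro: finite_measure.axioms)

lemma sigma_finite_leave: "A \<in> sets borel \<Longrightarrow> sigma_finite_measure (leave A n)"
  using finite_measure_leave by (auto intro: finite_measure.axioms)

lemma nn_integral_stay_Suc:
  assumes [measurable]: "A \<in> sets borel" "f \<in> borel_measurable borel"
  shows "(\<integral>\<^sup>+x. f x \<partial>stay A (Suc n)) = (\<integral>\<^sup>+x. \<integral>\<^sup>+y. f (x + y) * indicator A (x + y) \<partial>\<mu> \<partial>stay A n)"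
  using finite_measure_stay[OF assms(1), of n]
  by (simp add: nn_integral_density nn_integral_convolution finite_measure_law mult.commute)

lemma nn_integral_leave:
  assumes [measurable]: "A \<in> sets borel" "f \<in> borel_measurable borel"
  shows "(\<integral>\<^sup>+x. f x \<partial>leave A n) = (\<integral>\<^sup>+x. \<integral>\<^sup>+y. f (x + y) * indicator (- A) (x + y) \<partial>\<mu> \<partial>stay A n)"
  unfolding leave_def using finite_measure_stay[OF assms(1), of n]
  by (simp add: nn_integral_density nn_integral_convolution finite_measure_law mult.commute)

lemma nn_integral_stay_leave:
  assumes [measurable]: "A \<in> sets borel" "f \<in> borel_measurable borel"
  shows "(\<integral>\<^sup>+x. \<integral>\<^sup>+y. f (x + y) \<partial>\<mu> \<partial>stay A n) = (\<integral>\<^sup>+x. f x \<partial>stay A (Suc n)) + (\<integral>\<^sup>+x. f x \<partial>leave A n)"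
proof -
  have "(\<integral>\<^sup>+x. \<integral>\<^sup>+y. f (x + y) \<partial>\<mu> \<partial>stay A n)
      = (\<integral>\<^sup>+x. \<integral>\<^sup>+y. f (x + y) * indicator A (x + y) + f (x + y) * indicator (- A) (x + y) \<partial>\<mu> \<partial>stay A n)"
    by (intro nn_integral_cong) (auto split: split_indicator)
  also have "\<dots> = (\<integral>\<^sup>+x. f x \<partial>stay A (Suc n)) + (\<integral>\<^sup>+x. f x \<partial>leave A n)"
    unfolding nn_integral_stay_Suc[OF assms] nn_integral_leave[OF assms]
    by (subst nn_integral_add[symmetric]) (auto intro!: nn_integral_cong nn_integral_add)
  finally show ?thesis .
qed

lemma nn_integral_stay_killed:
  assumes "f \<in> borel_measurable borel"
  shows "(\<integral>\<^sup>+x. f x \<partial>stay {0<..} n) = killed n f 0"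
  using assms
proof (induction n arbitrary: f)
  case 0
  then show ?case by (simp add: nn_integral_return)
next
  case (Suc n)
  have "(\<integral>\<^sup>+x. f x \<partial>stay {0<..} (Suc n)) = (\<integral>\<^sup>+x. kill_op f x \<partial>stay {0<..} n)"
    using Suc.prems by (simp add: nn_integral_stay_Suc kill_op_def del: stay.simps)
  then show ?case using Suc by (simp add: killed_Suc kill_op_measurable del: funpow.simps)
qed

lemma AE_stay:
  assumes [measurable]: "A \<in> sets borel"
  shows "AE x in stay A n. x = 0 \<or> x \<in> A"
proof (cases n)
  case 0
  have "AE x in return borel 0. x = 0 \<or> x \<in> A"
    by (subst AE_return) auto
  then show ?thesis by (simp only: 0 stay.simps)
next
  case (Suc m)
  have "AE x in density (stay A m \<star> \<mu>) (indicator A). x = 0 \<or> x \<in> A"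
    by (subst AE_density) (auto split: split_indicator)
  then show ?thesis by (simp only: Suc stay.simps)
qed

lemma AE_leave: "A \<in> sets borel \<Longrightarrow> AE x in leave A n. x \<notin> A"
  unfolding leave_def by (auto simp: AE_density split: split_indicator_asm)

text \<open>
  Take \<open>k\<close> steps of a walk staying positive, \<open>j\<close> independent steps of a walk staying nonpositive, and one
  more free step.  Attaching the free step to the second walk either prolongs it or makes it leave
  upwards; attaching it to the first walk either prolongs that one or makes it leave downwards, and
  in the last case the total is nonpositive, where \<open>f\<close> vanishes.  So moving one step from the second walk
  to the first one changes the total by exactly one ladder term, and the identity telescopes.
\<close>

lemma wiener_hopf_aux:
  assumes f [measurable]: "f \<in> borel_measurable borel" and f0: "\<And>x. x \<le> 0 \<Longrightarrow> f x = 0"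
  shows "(\<integral>\<^sup>+x. f x \<partial>climb (Suc n))
    = (\<Sum>k\<le>n. \<integral>\<^sup>+y. \<integral>\<^sup>+z. f (y + z) \<partial>climb k \<partial>ladder (n - k))"
proof -
  define C where "C k j = (\<integral>\<^sup>+z. \<integral>\<^sup>+y. f (z + y) \<partial>stay {..0} j \<partial>climb k)" for k j
  define B where "B k j = (\<integral>\<^sup>+z. \<integral>\<^sup>+y. f (z + y) \<partial>ladder j \<partial>climb k)" for k j
  interpret mu: sigma_finite_measure \<mu> by unfold_locales
  have meas_c: "(\<lambda>z. \<integral>\<^sup>+y. f (z + y) \<partial>stay {..0} j) \<in> borel_measurable borel" for j
  proof -
    interpret sigma_finite_measure "stay {..0} j" by (rule sigma_finite_stay) simp
    show ?thesis by measurable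
  qed
  have step: "C (Suc k) j = C k (Suc j) + B k j" for k j
  proof -
    interpret c: sigma_finite_measure "stay {..0} j" by (rule sigma_finite_stay) simp
    interpret a: sigma_finite_measure "climb k" by (rule sigma_finite_stay) simp
    interpret P: pair_sigma_finite "stay {..0} j" \<mu> ..
    have "(\<integral>\<^sup>+z. \<integral>\<^sup>+w. \<integral>\<^sup>+y. f ((z + w) + y) \<partial>stay {..0} j \<partial>\<mu> \<partial>climb k)
        = C (Suc k) j + (\<integral>\<^sup>+z. \<integral>\<^sup>+y. f (z + y) \<partial>stay {..0} j \<partial>leave {0<..} k)"
      unfolding C_def using meas_c by (intro nn_integral_stay_leave) auto
    also have "(\<integral>\<^sup>+z. \<integral>\<^sup>+y. f (z + y) \<partial>stay {..0} j \<partial>leave {0<..} k) = (\<integral>\<^sup>+z. 0 \<partial>leave {0<..} k)"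
    proof (rule nn_integral_cong_AE)
      have "AE z in leave {0<..} k. z \<notin> {0<..}" by (rule AE_leave) simp
      then show "AE z in leave {0<..} k. (\<integral>\<^sup>+y. f (z + y) \<partial>stay {..0} j) = 0"
      proof eventually_elim
        case (elim z)
        have "AE y in stay {..0} j. y = 0 \<or> y \<in> {..0}" by (rule AE_stay) simp
        then have "AE y in stay {..0} j. f (z + y) = 0"
          by eventually_elim (use elim in \<open>auto intro!: f0\<close>)
        then have "(\<integral>\<^sup>+y. f (z + y) \<partial>stay {..0} j) = (\<integral>\<^sup>+y. 0 \<partial>stay {..0} j)"
          by (rule nn_integral_cong_AE)
        then show ?case by simp
      qed
    qed
    finally have one: "(\<integral>\<^sup>+z. \<integral>\<^sup>+w. \<integral>\<^sup>+y. f ((z + w) + y) \<partial>stay {..0} j \<partial>\<mu> \<partial>climb k) = C (Suc k) j"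
      by simp
    have "(\<integral>\<^sup>+z. \<integral>\<^sup>+w. \<integral>\<^sup>+y. f ((z + w) + y) \<partial>stay {..0} j \<partial>\<mu> \<partial>climb k)
        = (\<integral>\<^sup>+z. \<integral>\<^sup>+y. \<integral>\<^sup>+w. f (z + (y + w)) \<partial>\<mu> \<partial>stay {..0} j \<partial>climb k)"
      by (subst P.Fubini'[symmetric]) (auto simp: ac_simps)
    also have "\<dots> = (\<integral>\<^sup>+z. (\<integral>\<^sup>+y. f (z + y) \<partial>stay {..0} (Suc j)) + (\<integral>\<^sup>+y. f (z + y) \<partial>ladder j) \<partial>climb k)"
      by (intro nn_integral_cong nn_integral_stay_leave) auto
    also have "\<dots> = C k (Suc j) + B k j"
    proof -
      interpret b: sigma_finite_measure "ladder j" by (rule sigma_finite_leave) simp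
      show ?thesis unfolding C_def B_def using meas_c[of "Suc j"]
        by (intro nn_integral_add) auto
    qed
    finally show ?thesis using one by simp
  qed
  have C0: "C 0 (Suc n) = 0"
  proof -
    have "AE y in stay {..0} (Suc n). y = 0 \<or> y \<in> {..0}" by (rule AE_stay) simp
    then have "AE y in stay {..0} (Suc n). f (0 + y) = 0"
      by eventually_elim (auto intro!: f0)
    then have "(\<integral>\<^sup>+y. f (0 + y) \<partial>stay {..0} (Suc n)) = (\<integral>\<^sup>+y. 0 \<partial>stay {..0} (Suc n))"
      by (rule nn_integral_cong_AE)
    then show ?thesis using meas_c[of "Suc n"] by (simp add: C_def nn_integral_return del: stay.simps(2))
  qed
  have tele: "C m (Suc n - m) = (\<Sum>k<m. B k (n - k))" if "m \<le> Suc n" for m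
    using that
  proof (induction m)
    case 0
    then show ?case using C0 by simp
  next
    case (Suc m)
    then have "Suc n - m = Suc (n - m)" "Suc n - Suc m = n - m" by auto
    then show ?case using Suc step[of m "n - m"] by simp
  qed
  have "(\<integral>\<^sup>+x. f x \<partial>climb (Suc n)) = C (Suc n) 0"
    by (simp add: C_def nn_integral_return del: stay.simps(2))
  also have "\<dots> = (\<Sum>k\<le>n. B k (n - k))"
    using tele[of "Suc n"] by (simp add: lessThan_Suc_atMost)
  also have "\<dots> = (\<Sum>k\<le>n. \<integral>\<^sup>+y. \<integral>\<^sup>+z. f (y + z) \<partial>climb k \<partial>ladder (n - k))"
  proof (rule sum.cong[OF refl])
    fix k
    interpret b: sigma_finite_measure "ladder (n - k)" by (rule sigma_finite_leave) simp
    interpret a: sigma_finite_measure "climb k" by (rule sigma_finite_stay) simp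
    interpret P: pair_sigma_finite "ladder (n - k)" "climb k" ..
    show "B k (n - k) = (\<integral>\<^sup>+y. \<integral>\<^sup>+z. f (y + z) \<partial>climb k \<partial>ladder (n - k))"
      unfolding B_def by (subst P.Fubini') (auto simp: ac_simps)
  qed
  finally show ?thesis .
qed

text \<open>
  The measures \<open>leave {..0}\<close> are the laws of the strict ascending ladder height, split according to the
  ladder epoch.  The identity is a renewal equation for the laws of the positive walk.
\<close>

lemma wiener_hopf:
  assumes f [measurable]: "f \<in> borel_measurable borel"
  shows "(\<integral>\<^sup>+x. f x \<partial>climb (Suc n))
    = (\<Sum>k\<le>n. \<integral>\<^sup>+y. \<integral>\<^sup>+z. f (y + z) \<partial>climb k \<partial>ladder (n - k))"
proof -
  define h where "h x = f x * indicator {0<..} x" for x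
  have [measurable]: "h \<in> borel_measurable borel" unfolding h_def[abs_def] by measurable
  have "(\<integral>\<^sup>+x. f x \<partial>climb (Suc n)) = (\<integral>\<^sup>+x. h x \<partial>climb (Suc n))"
    by (simp add: nn_integral_stay_Suc h_def mult.assoc del: stay.simps) (simp flip: indicator_inter_arith)
  also have "\<dots> = (\<Sum>k\<le>n. \<integral>\<^sup>+y. \<integral>\<^sup>+z. h (y + z) \<partial>climb k \<partial>ladder (n - k))"
    by (rule wiener_hopf_aux) (auto simp: h_def)
  also have "\<dots> = (\<Sum>k\<le>n. \<integral>\<^sup>+y. \<integral>\<^sup>+z. f (y + z) \<partial>climb k \<partial>ladder (n - k))"
  proof (intro sum.cong refl nn_integral_cong_AE)
    fix k
    have "AE y in ladder (n - k). y \<notin> {..0}" by (rule AE_leave) simp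
    then show "AE y in ladder (n - k). (\<integral>\<^sup>+z. h (y + z) \<partial>climb k) = (\<integral>\<^sup>+z. f (y + z) \<partial>climb k)"
    proof eventually_elim
      case (elim y)
      have "AE z in climb k. z = 0 \<or> z \<in> {0<..}" by (rule AE_stay) simp
      then have "AE z in climb k. h (y + z) = f (y + z)"
        by eventually_elim (use elim in \<open>auto simp: h_def\<close>)
      then show ?case by (rule nn_integral_cong_AE)
    qed
  qed
  finally show ?thesis .
qed

end

section \<open>Bounded harmonic functions of an increasing walk\<close>

text \<open>
  For bounded harmonic \<open>f\<close> let \<open>g x = E (f (x + Z) - f x)\<^sup>2\<close>.  Then \<open>E (f (x + Z))\<^sup>2 = (f x)\<^sup>2 + g x\<close>, and \<open>g\<close>
  is subharmonic, because each difference \<open>f (x + z) - f x\<close> is harmonic in \<open>x\<close> and squaring is convex.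
  Each step of the walk therefore adds at least \<open>g x\<close> to the bounded quantity \<open>E (f (x + Z_1 + \<dots> + Z_n))\<^sup>2\<close>,
  which forces \<open>g x = 0\<close>.
\<close>

lemma choquet_deny_half_line:
  fixes f :: "real \<Rightarrow> real"
  assumes "prob_space \<nu>" and sets_nu [measurable_cong, simp]: "sets \<nu> = sets borel"
    and pos: "AE z in \<nu>. 0 < z"
    and f [measurable]: "f \<in> borel_measurable borel" and bound: "\<And>x. \<bar>f x\<bar> \<le> B"
    and harm: "\<And>x. 0 < x \<Longrightarrow> (\<integral>z. f (x + z) \<partial>\<nu>) = f x"
    and "0 < x"
  shows "AE z in \<nu>. f (x + z) = f x"
proof -
  interpret prob_space \<nu> by fact
  have space_nu: "space \<nu> = UNIV" using sets_eq_imp_space_eq[OF sets_nu] by simp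
  have bdd: "integrable \<nu> h" if "h \<in> borel_measurable borel" "\<And>x. \<bar>h x\<bar> \<le> K" for h :: "real \<Rightarrow> real" and K
    by (rule integrable_const_bound[of _ K]) (use that in \<open>auto intro!: AE_I2\<close>)
  have B0: "0 \<le> B" using bound[of 0] by linarith
  have diff_bound: "\<bar>f a - f b\<bar> \<le> 2 * B" for a b
    using bound[of a] bound[of b] by linarith
  have sq: "\<bar>y\<^sup>2\<bar> \<le> K\<^sup>2" if "\<bar>y\<bar> \<le> K" for y K :: real
    using that abs_le_square_iff[of y K] by simp
  have sq_bound: "\<bar>(f a - f b)\<^sup>2\<bar> \<le> (2 * B)\<^sup>2" for a b
    by (rule sq[OF diff_bound])
  have f2_bound: "\<bar>(f a)\<^sup>2\<bar> \<le> B\<^sup>2" for a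
    by (rule sq[OF bound])
  define g where "g x = (\<integral>z. (f (x + z) - f x)\<^sup>2 \<partial>\<nu>)" for x
  have int_f: "integrable \<nu> (\<lambda>z. f (x + z))" for x
    by (rule bdd[of _ B]) (use bound in auto)
  have int_f2: "integrable \<nu> (\<lambda>z. (f (x + z))\<^sup>2)" for x
    by (rule bdd[of _ "B\<^sup>2"]) (use f2_bound in auto)
  have int_d: "integrable \<nu> (\<lambda>z. (f (x + z) - f x)\<^sup>2)" for x
    by (rule bdd[of _ "(2 * B)\<^sup>2"]) (use sq_bound in auto)
  have g_meas [measurable]: "g \<in> borel_measurable borel" unfolding g_def[abs_def] by measurable
  have g_nonneg: "0 \<le> g x" for x unfolding g_def by (intro integral_nonneg_AE) auto
  have g_bound: "\<bar>g x\<bar> \<le> (2 * B)\<^sup>2" for x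
  proof -
    have "g x \<le> (\<integral>z. (2 * B)\<^sup>2 \<partial>\<nu>)"
      unfolding g_def using sq_bound by (intro integral_mono int_d) auto
    then show ?thesis using g_nonneg[of x] by (simp add: prob_space)
  qed
  have int_g: "integrable \<nu> (\<lambda>z. g (x + z))" for x
    by (rule bdd[of _ "(2 * B)\<^sup>2"]) (use g_bound in auto)
  have square: "(\<integral>z. (f (x + z))\<^sup>2 \<partial>\<nu>) = (f x)\<^sup>2 + g x" if "0 < x" for x
  proof -
    have "g x = (\<integral>z. (f (x + z))\<^sup>2 - 2 * f x * f (x + z) + (f x)\<^sup>2 \<partial>\<nu>)"
      unfolding g_def by (intro Bochner_Integration.integral_cong) (auto simp: power2_eq_square algebra_simps)
    also have "\<dots> = (\<integral>z. (f (x + z))\<^sup>2 \<partial>\<nu>) - 2 * f x * f x + (f x)\<^sup>2"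
      using int_f int_f2 harm[OF that] by (simp add: prob_space)
    finally show ?thesis by (simp add: power2_eq_square)
  qed
  have sub: "g x \<le> (\<integral>w. g (x + w) \<partial>\<nu>)" if "0 < x" for x
  proof -
    interpret P: pair_prob_space \<nu> \<nu> ..
    have [measurable]: "(\<lambda>(z, w). (f (x + z + w) - f (x + w))\<^sup>2) \<in> borel_measurable (\<nu> \<Otimes>\<^sub>M \<nu>)"
      by measurable
    have int2: "integrable (\<nu> \<Otimes>\<^sub>M \<nu>) (\<lambda>(z, w). (f (x + z + w) - f (x + w))\<^sup>2)"
      by (rule P.P.integrable_const_bound[of _ "(2 * B)\<^sup>2"]) (use sq_bound in \<open>auto intro!: AE_I2\<close>)
    have "g x \<le> (\<integral>z. (\<integral>w. (f (x + z + w) - f (x + w))\<^sup>2 \<partial>\<nu>) \<partial>\<nu>)"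
      unfolding g_def
    proof (rule integral_mono_AE[OF int_d])
      show "integrable \<nu> (\<lambda>z. \<integral>w. (f (x + z + w) - f (x + w))\<^sup>2 \<partial>\<nu>)"
        using P.integrable_fst[OF int2] by simp
      show "AE z in \<nu>. (f (x + z) - f x)\<^sup>2 \<le> (\<integral>w. (f (x + z + w) - f (x + w))\<^sup>2 \<partial>\<nu>)"
        using pos
      proof eventually_elim
        case (elim z)
        define h where "h w = f (x + z + w) - f (x + w)" for w
        have h_meas [measurable]: "h \<in> borel_measurable borel" unfolding h_def[abs_def] by measurable
        have "integrable \<nu> h" by (rule bdd[of _ "2 * B"]) (use diff_bound in \<open>auto simp: h_def\<close>)
        moreover have "integrable \<nu> (\<lambda>w. (h w)\<^sup>2)"
          by (rule bdd[of _ "(2 * B)\<^sup>2"]) (use sq_bound in \<open>auto simp: h_def\<close>)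
        ultimately have "0 \<le> (\<integral>w. (h w)\<^sup>2 \<partial>\<nu>) - (\<integral>w. h w \<partial>\<nu>)\<^sup>2"
          using variance_eq[of h] variance_positive[of h] by simp
        moreover have "(\<integral>w. h w \<partial>\<nu>) = f (x + z) - f x"
          unfolding h_def using harm[of "x + z"] harm[OF that] elim that int_f by simp
        ultimately show ?case by (simp add: h_def)
      qed
    qed
    also have "\<dots> = (\<integral>w. (\<integral>z. (f (x + z + w) - f (x + w))\<^sup>2 \<partial>\<nu>) \<partial>\<nu>)"
      using P.Fubini_integral[of "\<lambda>z w. (f (x + z + w) - f (x + w))\<^sup>2"] int2 by simp
    also have "\<dots> = (\<integral>w. g (x + w) \<partial>\<nu>)"
      unfolding g_def by (simp add: ac_simps)
    finally show ?thesis .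
  qed
  have iter: "(f x)\<^sup>2 + real N * g x \<le> B\<^sup>2" if "0 < x" for x N
    using that
  proof (induction N arbitrary: x)
    case 0
    then show ?case using f2_bound[of x] by simp
  next
    case (Suc N)
    have "(\<integral>z. (f (x + z))\<^sup>2 + real N * g (x + z) \<partial>\<nu>) \<le> (\<integral>z. B\<^sup>2 \<partial>\<nu>)"
    proof (rule integral_mono_AE)
      show "AE z in \<nu>. (f (x + z))\<^sup>2 + real N * g (x + z) \<le> B\<^sup>2"
        using pos by eventually_elim (use Suc in auto)
    qed (use int_f2 int_g in auto)
    then have "(f x)\<^sup>2 + g x + real N * (\<integral>z. g (x + z) \<partial>\<nu>) \<le> B\<^sup>2"
      using int_f2 int_g square[OF Suc.prems] by (simp add: prob_space)
    moreover have "real N * g x \<le> real N * (\<integral>z. g (x + z) \<partial>\<nu>)"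
      using sub[OF Suc.prems] by (intro mult_left_mono) auto
    ultimately show ?case by (simp add: algebra_simps)
  qed
  have "g x = 0"
  proof (rule ccontr)
    assume "g x \<noteq> 0"
    then have "0 < g x" using g_nonneg[of x] by simp
    then obtain N where "B\<^sup>2 < real N * g x" using reals_Archimedean3 by blast
    then show False using iter[OF \<open>0 < x\<close>, of N] zero_le_power2[of "f x"] by linarith
  qed
  then have "AE z in \<nu>. (f (x + z) - f x)\<^sup>2 = 0"
    unfolding g_def by (subst (asm) integral_nonneg_eq_0_iff_AE) (use int_d in auto)
  then show ?thesis by eventually_elim simp
qed


section \<open>Boundary values of killed harmonic functions\<close>

context centered_law
begin

definition killed_harmonic :: "(real \<Rightarrow> ennreal) \<Rightarrow> bool" where
  "killed_harmonic g \<longleftrightarrow> g \<in> borel_measurable borel \<and> (\<forall>x\<le>0. g x = 0)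
     \<and> (\<forall>x>0. (\<integral>\<^sup>+y. g (x + y) \<partial>\<mu>) = g x)"

text \<open>
  Only the displacement \<open>s\<close> is required to stay positive, so for \<open>x > 0\<close> the point \<open>x + s\<close> stays above its
  starting level, which is more restrictive than survival.
\<close>

definition meander :: "nat \<Rightarrow> (real \<Rightarrow> ennreal) \<Rightarrow> real \<Rightarrow> ennreal" where
  "meander n g x = (\<integral>\<^sup>+s. g (x + s) \<partial>climb n)"

definition boundary :: "(real \<Rightarrow> ennreal) \<Rightarrow> real \<Rightarrow> ennreal" where
  "boundary g x = (INF n. meander n g x)"

lemma killed_harmonic_measurable: "killed_harmonic g \<Longrightarrow> g \<in> borel_measurable borel"
  by (simp add: killed_harmonic_def)

lemma meander_measurable [measurable]:
  assumes [measurable]: "g \<in> borel_measurable borel"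
  shows "meander n g \<in> borel_measurable borel"
proof -
  interpret sigma_finite_measure "climb n" by (rule sigma_finite_stay) simp
  show ?thesis unfolding meander_def[abs_def] by measurable
qed

lemma boundary_measurable [measurable]:
  assumes [measurable]: "g \<in> borel_measurable borel"
  shows "boundary g \<in> borel_measurable borel"
  unfolding boundary_def[abs_def] by measurable

lemma meander_killed:
  "g \<in> borel_measurable borel \<Longrightarrow> meander n g x = killed n (\<lambda>s. g (x + s)) 0"
  unfolding meander_def by (rule nn_integral_stay_killed) simp

lemma meander_0: "g \<in> borel_measurable borel \<Longrightarrow> meander 0 g x = g x"
  by (simp add: meander_killed)

lemma meander_Suc:
  assumes g: "killed_harmonic g" and "0 < x"
  shows "meander n g x = meander (Suc n) g x + (\<integral>\<^sup>+s. g (x + s) \<partial>leave {0<..} n)"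
proof -
  have [measurable]: "g \<in> borel_measurable borel" using g by (rule killed_harmonic_measurable)
  have "AE s in climb n. s = 0 \<or> s \<in> {0<..}" by (rule AE_stay) simp
  then have "AE s in climb n. g (x + s) = (\<integral>\<^sup>+y. g (x + (s + y)) \<partial>\<mu>)"
  proof eventually_elim
    case (elim s)
    then have "0 < x + s" using \<open>0 < x\<close> by auto
    then have "(\<integral>\<^sup>+y. g (x + s + y) \<partial>\<mu>) = g (x + s)" using g by (simp add: killed_harmonic_def)
    then show ?case by (simp add: add.assoc)
  qed
  then have "meander n g x = (\<integral>\<^sup>+s. \<integral>\<^sup>+y. g (x + (s + y)) \<partial>\<mu> \<partial>climb n)"
    unfolding meander_def by (rule nn_integral_cong_AE)
  also have "\<dots> = meander (Suc n) g x + (\<integral>\<^sup>+s. g (x + s) \<partial>leave {0<..} n)"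
    unfolding meander_def by (rule nn_integral_stay_leave) auto
  finally show ?thesis .
qed

lemma meander_decseq:
  assumes "killed_harmonic g" "0 < x"
  shows "decseq (\<lambda>n. meander n g x)"
proof (rule decseq_SucI)
  show "meander (Suc n) g x \<le> meander n g x" for n
    by (subst (2) meander_Suc[OF assms]) simp
qed

lemma meander_tendsto:
  assumes "killed_harmonic g" "0 < x"
  shows "(\<lambda>n. meander n g x) \<longlonglongrightarrow> boundary g x"
  unfolding boundary_def by (rule LIMSEQ_INF[OF meander_decseq[OF assms]])

lemma boundary_le:
  assumes "killed_harmonic g"
  shows "boundary g x \<le> g x"
proof -
  have "boundary g x \<le> meander 0 g x"
    unfolding boundary_def by (rule INF_lower) simp
  then show ?thesis by (simp only: meander_0[OF killed_harmonic_measurable[OF assms]])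
qed

text \<open>
  The law of the first weak descending ladder height; \<open>ascent_law\<close> below is that of the first strict
  ascending one.  Each is a sum over the possible ladder epochs.
\<close>

definition descent_law :: "real measure" where
  "descent_law = sum_measure (leave {0<..})"

definition ascent_law :: "real measure" where
  "ascent_law = sum_measure (ladder)"

lemma sets_laws [simp, measurable_cong]:
  "sets descent_law = sets borel" "sets ascent_law = sets borel"
  by (simp_all add: descent_law_def ascent_law_def)

lemma space_laws [simp]: "space descent_law = UNIV" "space ascent_law = UNIV"
  by (simp_all add: descent_law_def ascent_law_def)

text \<open>
  Stopping when the walk first falls to or below its starting level; the boundary value is the contribution of
  the paths that have not done so.
\<close>

lemma riesz_decomposition:
  assumes g: "killed_harmonic g" and "0 < x"
  shows "g x = boundary g x + (\<integral>\<^sup>+s. g (x + s) \<partial>descent_law)"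
proof -
  have [measurable]: "g \<in> borel_measurable borel" using g by (rule killed_harmonic_measurable)
  have sum: "g x = meander n g x + (\<Sum>k<n. \<integral>\<^sup>+s. g (x + s) \<partial>leave {0<..} k)" for n
  proof (induction n)
    case 0
    then show ?case by (simp add: meander_0)
  next
    case (Suc n)
    then show ?case using meander_Suc[OF assms, of n] by (simp add: ac_simps)
  qed
  have "(\<lambda>n. meander n g x + (\<Sum>k<n. \<integral>\<^sup>+s. g (x + s) \<partial>leave {0<..} k))
      \<longlonglongrightarrow> boundary g x + (\<Sum>k. \<integral>\<^sup>+s. g (x + s) \<partial>leave {0<..} k)"
    by (intro tendsto_add meander_tendsto assms summable_LIMSEQ) auto
  then have "(\<lambda>n. g x) \<longlonglongrightarrow> boundary g x + (\<Sum>k. \<integral>\<^sup>+s. g (x + s) \<partial>leave {0<..} k)"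
    unfolding sum[symmetric] .
  then have "g x = boundary g x + (\<Sum>k. \<integral>\<^sup>+s. g (x + s) \<partial>leave {0<..} k)"
    by (rule LIMSEQ_unique[OF tendsto_const])
  then show ?thesis by (simp add: descent_law_def nn_integral_sum_measure)
qed

abbreviation renewal_e :: "real \<Rightarrow> ennreal" where
  "renewal_e x \<equiv> ennreal (renewal x)"

lemma killed_harmonic_renewal: "killed_harmonic renewal_e"
  unfolding killed_harmonic_def
proof (intro conjI allI impI)
  show "renewal_e x = 0" if "x \<le> 0" for x using renewal_nonpos[OF that] by simp
qed (auto intro: renewal_harmonic)

text \<open>
  The limit of \<open>E[S_n; S_1 > 0, \<dots>, S_n > 0]\<close>, which by optional stopping is the mean depth of the first
  descending ladder height.
\<close>

definition ladder_mean :: ennreal where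
  "ladder_mean = (SUP n. killed n ennreal 0)"

lemma stay_mass: "emeasure (climb n) UNIV = killed n (\<lambda>_. 1) 0"
proof -
  have "emeasure (climb n) UNIV = (\<integral>\<^sup>+x. 1 \<partial>climb n)" by simp
  also have "\<dots> = killed n (\<lambda>_. 1) 0" by (rule nn_integral_stay_killed) simp
  finally show ?thesis .
qed

text \<open>
  Given that the walk survives, the displacement dominates: the contribution of the constant part of
  \<open>(1 + \<eta>) * (x + s) + C\<close> is a multiple of the survival probability.  Only the slope, arbitrarily close to \<open>1\<close>,
  remains in the limit.
\<close>

lemma boundary_renewal:
  assumes "0 < x"
  shows "boundary renewal_e x = ladder_mean"
proof (rule antisym)
  have lim_c: "(\<lambda>n. killed n ennreal 0) \<longlonglongrightarrow> ladder_mean"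
    unfolding ladder_mean_def by (rule LIMSEQ_SUP[OF killed_positive_part_incseq])
  have A: "{0<..} \<subseteq> {0::real..}" "0 \<in> {0::real..}" by auto
  show le: "ladder_mean \<le> boundary renewal_e x"
  proof (rule LIMSEQ_le[OF lim_c meander_tendsto[OF killed_harmonic_renewal assms]])
    have "killed n ennreal 0 \<le> meander n renewal_e x" for n
      unfolding meander_killed[OF killed_harmonic_measurable[OF killed_harmonic_renewal]]
    proof (rule killed_mono[OF A(1) _ A(2)])
      fix y :: real
      have "y \<le> renewal (x + y)" using renewal_ge[of "x + y"] assms by linarith
      then show "ennreal y \<le> renewal_e (x + y)" by (rule ennreal_leI)
    qed
    then show "\<exists>N. \<forall>n\<ge>N. killed n ennreal 0 \<le> meander n renewal_e x" by blast
  qed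
  have fin: "ladder_mean < \<top>"
    using le boundary_le[OF killed_harmonic_renewal, of x] by (simp add: order.strict_trans1)
  have upper: "boundary renewal_e x \<le> ennreal (1 + \<eta>) * ladder_mean" if "0 < \<eta>" for \<eta>
  proof -
    obtain C where C: "0 \<le> C" "\<And>x. 0 < x \<Longrightarrow> renewal x \<le> (1 + \<eta>) * x + C"
      using renewal_upper[OF \<open>0 < \<eta>\<close>] by blast
    define D where "D = (1 + \<eta>) * x + C"
    have D: "0 \<le> D" using C(1) assms that by (simp add: D_def)
    have "meander n renewal_e x \<le> ennreal (1 + \<eta>) * killed n ennreal 0 + ennreal D * killed n (\<lambda>_. 1) 0" for n
    proof -
      have "meander n renewal_e x \<le> killed n (\<lambda>y. ennreal (1 + \<eta>) * ennreal y + ennreal D * 1) 0"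
        unfolding meander_killed[OF killed_harmonic_measurable[OF killed_harmonic_renewal]]
      proof (rule killed_mono[OF A(1) _ A(2)])
        fix y :: real assume y: "y \<in> {0..}"
        have "renewal (x + y) \<le> (1 + \<eta>) * y + D"
          using C(2)[of "x + y"] y assms by (simp add: D_def algebra_simps)
        then have "renewal_e (x + y) \<le> ennreal ((1 + \<eta>) * y + D)" by (rule ennreal_leI)
        also have "\<dots> = ennreal (1 + \<eta>) * ennreal y + ennreal D * 1"
          using y D that by (simp add: ennreal_plus ennreal_mult)
        finally show "renewal_e (x + y) \<le> ennreal (1 + \<eta>) * ennreal y + ennreal D * 1" .
      qed
      also have "\<dots> = ennreal (1 + \<eta>) * killed n ennreal 0 + ennreal D * killed n (\<lambda>_. 1) 0"
        by (rule killed_linear) auto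
      finally show ?thesis .
    qed
    moreover have "(\<lambda>n. ennreal (1 + \<eta>) * killed n ennreal 0 + ennreal D * killed n (\<lambda>_. 1) 0)
        \<longlonglongrightarrow> ennreal (1 + \<eta>) * ladder_mean + ennreal D * 0"
      by (intro tendsto_add ennreal_tendsto_cmult lim_c survival_tendsto_zero) auto
    ultimately have "boundary renewal_e x \<le> ennreal (1 + \<eta>) * ladder_mean + ennreal D * 0"
      by (intro LIMSEQ_le[OF meander_tendsto[OF killed_harmonic_renewal assms]]) auto
    then show ?thesis by simp
  qed
  show "boundary renewal_e x \<le> ladder_mean"
  proof -
    obtain c where c: "ladder_mean = ennreal c" "0 \<le> c" using fin by (cases ladder_mean) auto
    have "boundary renewal_e x < \<top>"
      using boundary_le[OF killed_harmonic_renewal, of x] by (simp add: order.strict_trans1)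
    then obtain b where b: "boundary renewal_e x = ennreal b" "0 \<le> b" by (cases "boundary renewal_e x") auto
    have "b \<le> c + e" if "0 < e" for e
    proof -
      define \<eta> where "\<eta> = e / (c + 1)"
      have "0 < \<eta>" using that c by (simp add: \<eta>_def)
      then have "b \<le> (1 + \<eta>) * c"
      proof -
        have "ennreal b \<le> ennreal ((1 + \<eta>) * c)"
          using upper[OF \<open>0 < \<eta>\<close>] c(2) \<open>0 < \<eta>\<close> unfolding b(1) c(1)
          by (subst ennreal_mult) auto
        then show ?thesis using c(2) \<open>0 < \<eta>\<close> by (subst (asm) ennreal_le_iff) auto
      qed
      moreover have "\<eta> * c \<le> e"
        using that c by (simp add: \<eta>_def field_simps)
      ultimately show ?thesis by (simp add: algebra_simps)
    qed
    then have "b \<le> c" by (rule field_le_epsilon)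
    then show ?thesis unfolding b(1) c(1) by (rule ennreal_leI)
  qed
qed

lemma ladder_mean_finite: "ladder_mean < \<top>"
  using boundary_renewal[of 1] boundary_le[OF killed_harmonic_renewal, of 1]
  by (simp add: order.strict_trans1)

lemma ladder_mean_pos: "0 < ladder_mean"
proof -
  have "0 < (\<integral>\<^sup>+y. ennreal y \<partial>\<mu>)"
    unfolding zero_less_iff_neq_zero using not_AE_nonpos by (subst nn_integral_0_iff_AE) (auto simp: ennreal_eq_0_iff)
  moreover have "(\<integral>\<^sup>+y. ennreal y \<partial>\<mu>) = killed 1 ennreal 0"
    unfolding funpow_0 One_nat_def funpow.simps o_apply id_apply kill_op_def
    by (intro nn_integral_cong) (auto split: split_indicator simp: ennreal_neg)
  moreover have "killed 1 ennreal 0 \<le> ladder_mean"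
    unfolding ladder_mean_def by (intro SUP_upper) auto
  ultimately show ?thesis by (simp only: order.strict_trans2)
qed

lemma meander_wiener_hopf:
  assumes "g \<in> borel_measurable borel"
  shows "meander (Suc n) g x = (\<Sum>k\<le>n. \<integral>\<^sup>+y. meander k g (x + y) \<partial>ladder (n - k))"
proof -
  have "(\<lambda>s. g (x + s)) \<in> borel_measurable borel" using assms by simp
  from wiener_hopf[OF this, of n] show ?thesis unfolding meander_def by (simp only: add.assoc)
qed

text \<open>
  Insert the decreasing limit into the renewal equation, whose terms are all at least their limits.
  Equality follows in \<open>boundary_ascent_harmonic\<close> once \<open>ascent_law\<close> has full mass.
\<close>

lemma boundary_ascent_le:
  assumes g: "killed_harmonic g" and "0 < x"
  shows "(\<integral>\<^sup>+z. boundary g (x + z) \<partial>ascent_law) \<le> boundary g x"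
proof -
  have [measurable]: "g \<in> borel_measurable borel" using g by (rule killed_harmonic_measurable)
  have "(\<lambda>n. \<Sum>j<Suc n. \<integral>\<^sup>+z. boundary g (x + z) \<partial>ladder j)
      \<longlonglongrightarrow> (\<Sum>j. \<integral>\<^sup>+z. boundary g (x + z) \<partial>ladder j)"
    by (intro LIMSEQ_Suc summable_LIMSEQ) auto
  moreover have "(\<lambda>n. meander (Suc n) g x) \<longlonglongrightarrow> boundary g x"
    by (intro LIMSEQ_Suc meander_tendsto assms)
  moreover have "(\<Sum>j<Suc n. \<integral>\<^sup>+z. boundary g (x + z) \<partial>ladder j) \<le> meander (Suc n) g x" for n
  proof -
    have "(\<Sum>j<Suc n. \<integral>\<^sup>+z. boundary g (x + z) \<partial>ladder j)
        = (\<Sum>k<Suc n. \<integral>\<^sup>+z. boundary g (x + z) \<partial>ladder (Suc n - Suc k))"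
      by (rule sum.nat_diff_reindex[symmetric])
    also have "\<dots> = (\<Sum>k\<le>n. \<integral>\<^sup>+z. boundary g (x + z) \<partial>ladder (n - k))"
      by (simp add: lessThan_Suc_atMost)
    also have "\<dots> \<le> (\<Sum>k\<le>n. \<integral>\<^sup>+y. meander k g (x + y) \<partial>ladder (n - k))"
      by (intro sum_mono nn_integral_mono) (auto simp: boundary_def intro: INF_lower)
    finally show ?thesis by (simp add: meander_wiener_hopf)
  qed
  ultimately have "(\<Sum>j. \<integral>\<^sup>+z. boundary g (x + z) \<partial>ladder j) \<le> boundary g x"
    by (intro LIMSEQ_le) auto
  then show ?thesis by (simp add: ascent_law_def nn_integral_sum_measure)
qed

lemma AE_ascent_pos: "AE z in ascent_law. 0 < z"
proof -
  have "(\<integral>\<^sup>+z. indicator {..0} z \<partial>ascent_law) = (\<Sum>n. \<integral>\<^sup>+z. indicator {..0} z \<partial>ladder n)"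
    unfolding ascent_law_def by (rule nn_integral_sum_measure) auto
  also have "\<dots> = (\<Sum>n. 0)"
  proof (rule suminf_cong)
    fix n
    have "AE z in ladder n. z \<notin> {..0}" by (rule AE_leave) simp
    then have "AE z in ladder n. (indicator {..0} z :: ennreal) = 0"
      by eventually_elim simp
    then show "(\<integral>\<^sup>+z. indicator {..0} z \<partial>ladder n) = 0"
      by (subst nn_integral_0_iff_AE) auto
  qed
  finally have "(\<integral>\<^sup>+z. indicator {..0} z \<partial>ascent_law) = 0" by simp
  then have "AE z in ascent_law. (indicator {..0} z :: ennreal) = 0"
    by (subst (asm) nn_integral_0_iff_AE) auto
  then show ?thesis by eventually_elim (auto simp: indicator_eq_0_iff)
qed

text \<open>
  The constant boundary value of the renewal function dominates its own mean under \<open>ascent_law\<close>.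
\<close>

lemma ascent_mass_le_1: "emeasure ascent_law UNIV \<le> 1"
proof -
  have "ladder_mean * emeasure ascent_law UNIV = (\<integral>\<^sup>+z. ladder_mean \<partial>ascent_law)" by simp
  also have "\<dots> = (\<integral>\<^sup>+z. boundary renewal_e (1 + z) \<partial>ascent_law)"
    by (intro nn_integral_cong_AE) (use AE_ascent_pos in \<open>auto simp: boundary_renewal elim!: eventually_mono\<close>)
  also have "\<dots> \<le> boundary renewal_e 1"
    by (rule boundary_ascent_le[OF killed_harmonic_renewal]) simp
  also have "\<dots> = ladder_mean * 1" by (simp add: boundary_renewal)
  finally show ?thesis
    using ladder_mean_pos ladder_mean_finite by (subst (asm) ennreal_mult_le_mult_iff) auto
qed

lemma killed_square_le:
  "killed n (\<lambda>s. ennreal (s\<^sup>2)) 0 \<le> ennreal (\<integral>x. x\<^sup>2 \<partial>\<mu>) * (\<Sum>k<n. killed k (\<lambda>_. 1) 0)"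
proof (induction n)
  case (Suc n)
  define v where "v = (\<integral>x. x\<^sup>2 \<partial>\<mu>)"
  have v: "0 \<le> v" by (simp add: v_def integral_nonneg_AE)
  have "kill_op (\<lambda>s. ennreal (s\<^sup>2)) y \<le> ennreal (y\<^sup>2 + v)" for y
  proof (rule kill_op_le_ennreal)
    have eq: "(\<lambda>x. (y + x)\<^sup>2) = (\<lambda>x. y\<^sup>2 + 2 * y * x + x\<^sup>2)"
      by (auto simp: power2_eq_square algebra_simps)
    show "integrable \<mu> (\<lambda>x. (y + x)\<^sup>2)" unfolding eq using integrable_square by auto
    show "(\<integral>x. (y + x)\<^sup>2 \<partial>\<mu>) \<le> y\<^sup>2 + v"
      unfolding eq v_def using integrable_square by simp
  qed simp
  then have "killed (Suc n) (\<lambda>s. ennreal (s\<^sup>2)) 0 \<le> killed n (\<lambda>s. ennreal (s\<^sup>2) + ennreal v * 1) 0"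
    unfolding killed_Suc by (intro killed_mono[of UNIV]) (auto simp: ennreal_plus v)
  also have "\<dots> = killed n (\<lambda>s. ennreal (s\<^sup>2)) 0 + ennreal v * killed n (\<lambda>_. 1) 0"
    by (subst killed_add) (simp_all only: killed_cmult borel_measurable_const, auto)
  also have "\<dots> \<le> ennreal v * (\<Sum>k<n. killed k (\<lambda>_. 1) 0) + ennreal v * killed n (\<lambda>_. 1) 0"
    using Suc by (intro add_right_mono) (simp add: v_def)
  also have "\<dots> = ennreal v * (\<Sum>k<Suc n. killed k (\<lambda>_. 1) 0)"
    by (simp add: distrib_left)
  finally show ?case by (simp only: v_def)
qed simp

text \<open>
  If the descending ladder epoch had finite mean, the second moments \<open>E[S_n\<^sup>2; S_1 > 0, \<dots>, S_n > 0]\<close> would be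
  bounded.  As the survival probability tends to \<open>0\<close>, the first moments would tend to \<open>0\<close>, but
  they increase to \<open>ladder_mean > 0\<close>.
\<close>

lemma survival_sum_infinite:
  assumes "\<And>n. (\<Sum>k<n. killed k (\<lambda>_. 1) 0) \<le> ennreal S"
  shows False
proof -
  define v where "v = (\<integral>x. x\<^sup>2 \<partial>\<mu>)"
  have v: "0 \<le> v" by (simp add: v_def integral_nonneg_AE)
  define B where "B = v * max 0 S"
  have B: "0 \<le> B" using v by (simp add: B_def)
  have sq: "killed n (\<lambda>s. ennreal (s\<^sup>2)) 0 \<le> ennreal B" for n
  proof -
    have "killed n (\<lambda>s. ennreal (s\<^sup>2)) 0 \<le> ennreal v * ennreal S"
      using killed_square_le[of n] mult_left_mono[OF assms[of n], of "ennreal v"] by (simp add: v_def)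
    also have "\<dots> = ennreal B" using v by (simp add: B_def ennreal_mult max_def ennreal_neg)
    finally show ?thesis .
  qed
  have A: "{0<..} \<subseteq> {0::real..}" "0 \<in> {0::real..}" by auto
  have le: "ladder_mean \<le> ennreal (B / R)" if "0 < R" for R
  proof (rule LIMSEQ_le)
    show "(\<lambda>n. killed n ennreal 0) \<longlonglongrightarrow> ladder_mean"
      unfolding ladder_mean_def by (rule LIMSEQ_SUP[OF killed_positive_part_incseq])
    have "(\<lambda>n. ennreal R * killed n (\<lambda>_. 1) 0 + ennreal (B / R)) \<longlonglongrightarrow> ennreal R * 0 + ennreal (B / R)"
      by (intro tendsto_add tendsto_const ennreal_tendsto_cmult survival_tendsto_zero) auto
    then show "(\<lambda>n. ennreal R * killed n (\<lambda>_. 1) 0 + ennreal (B / R)) \<longlonglongrightarrow> ennreal (B / R)" by simp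
    have "killed n ennreal 0 \<le> ennreal R * killed n (\<lambda>_. 1) 0 + ennreal (B / R)" for n
    proof -
      have "killed n ennreal 0 \<le> killed n (\<lambda>s. ennreal R * 1 + ennreal (1 / R) * ennreal (s\<^sup>2)) 0"
      proof (rule killed_mono[OF A(1) _ A(2)])
        fix y :: real assume "y \<in> {0..}"
        have "y \<le> R + 1 / R * y\<^sup>2"
        proof (cases "y \<le> R")
          case True
          then show ?thesis using that by (simp add: add_increasing2)
        next
          case False
          then have "R * y \<le> y * y" using that by (intro mult_right_mono) auto
          then have "y \<le> 1 / R * y\<^sup>2" using that by (simp add: field_simps power2_eq_square)
          then show ?thesis using that by linarith
        qed
        then have "ennreal y \<le> ennreal (R + 1 / R * y\<^sup>2)" by (rule ennreal_leI)
        also have "\<dots> = ennreal R * 1 + ennreal (1 / R) * ennreal (y\<^sup>2)"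
          using that by (subst ennreal_plus) (auto simp: ennreal_mult simp del: times_divide_eq_left)
        finally show "ennreal y \<le> ennreal R * 1 + ennreal (1 / R) * ennreal (y\<^sup>2)" .
      qed
      also have "\<dots> = ennreal R * killed n (\<lambda>_. 1) 0 + ennreal (1 / R) * killed n (\<lambda>s. ennreal (s\<^sup>2)) 0"
        by (rule killed_linear) auto
      also have "\<dots> \<le> ennreal R * killed n (\<lambda>_. 1) 0 + ennreal (1 / R) * ennreal B"
        by (intro add_left_mono mult_left_mono sq) simp
      also have "ennreal (1 / R) * ennreal B = ennreal (B / R)"
        using that B by (simp add: ennreal_mult[symmetric])
      finally show ?thesis .
    qed
    then show "\<exists>N. \<forall>n\<ge>N. killed n ennreal 0 \<le> ennreal R * killed n (\<lambda>_. 1) 0 + ennreal (B / R)" by blast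
  qed
  obtain c where c: "ladder_mean = ennreal c" "0 < c"
    using ladder_mean_finite ladder_mean_pos by (cases ladder_mean) (auto simp: ennreal_zero_less_divide)
  have "c \<le> B / ((B + 1) / (c / 2))"
  proof -
    have R: "0 < (B + 1) / (c / 2)" using B c by simp
    have "0 \<le> B / ((B + 1) / (c / 2))" using B c by simp
    then show ?thesis using le[OF R] unfolding c(1) by (simp only: ennreal_le_iff)
  qed
  also have "\<dots> \<le> c / 2" using B c by (simp add: field_simps)
  finally show False using c(2) by simp
qed

text \<open>
  A defective ladder height would make the renewal equation sum to a finite mean for the descending
  ladder epoch, contrary to \<open>survival_sum_infinite\<close>.
\<close>

lemma ascent_mass: "emeasure ascent_law UNIV = 1"
proof (rule ccontr)
  assume "emeasure ascent_law UNIV \<noteq> 1"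
  with ascent_mass_le_1 have lt: "emeasure ascent_law UNIV < 1" by simp
  then obtain \<beta> where \<beta>: "emeasure ascent_law UNIV = ennreal \<beta>" "0 \<le> \<beta>" "\<beta> < 1"
    by (cases "emeasure ascent_law UNIV") (auto simp: ennreal_less_one_iff)
  define \<alpha> where "\<alpha> n = killed n (\<lambda>_. 1) 0" for n
  define b where "b j = emeasure (ladder j) UNIV" for j
  have b_sum: "(\<Sum>j<n. b j) \<le> ennreal \<beta>" for n
  proof -
    have "emeasure ascent_law UNIV = (\<Sum>j. b j)"
      unfolding ascent_law_def b_def by (rule emeasure_sum_measure) auto
    moreover have "(\<Sum>j<n. b j) \<le> (\<Sum>j. b j)" by (rule sum_le_suminf) auto
    ultimately show ?thesis using \<beta> by simp
  qed
  have ren: "\<alpha> (Suc n) = (\<Sum>k\<le>n. b (n - k) * \<alpha> k)" for n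
    using wiener_hopf[of "\<lambda>_. 1" n] nn_integral_stay_killed[of "\<lambda>_. 1"]
    by (simp add: \<alpha>_def b_def stay_mass mult.commute del: stay.simps funpow.simps)
  have step: "(\<Sum>n<Suc N. \<alpha> n) \<le> 1 + ennreal \<beta> * (\<Sum>n<N. \<alpha> n)" for N
  proof -
    have "(\<Sum>n<Suc N. \<alpha> n) = \<alpha> 0 + (\<Sum>n<N. \<alpha> (Suc n))" by (rule sum.lessThan_Suc_shift)
    also have "\<alpha> 0 = 1" by (simp add: \<alpha>_def)
    also have "(\<Sum>n<N. \<alpha> (Suc n)) = (\<Sum>(k,j)\<in>{(k,j). k + j < N}. b j * \<alpha> k)"
      unfolding ren sum.triangle_reindex ..
    also have "\<dots> \<le> (\<Sum>(k,j)\<in>{..<N} \<times> {..<N}. b j * \<alpha> k)"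
      by (rule sum_mono2) auto
    also have "\<dots> = (\<Sum>k<N. (\<Sum>j<N. b j) * \<alpha> k)"
      by (simp add: sum.cartesian_product[symmetric] sum_distrib_right)
    also have "\<dots> \<le> (\<Sum>k<N. ennreal \<beta> * \<alpha> k)"
      by (intro sum_mono mult_right_mono b_sum) simp
    also have "\<dots> = ennreal \<beta> * (\<Sum>n<N. \<alpha> n)" by (simp add: sum_distrib_left)
    finally show ?thesis by (simp add: add_left_mono)
  qed
  have "(\<Sum>n<N. \<alpha> n) \<le> ennreal (1 / (1 - \<beta>))" for N
  proof (induction N)
    case (Suc N)
    have "(\<Sum>n<Suc N. \<alpha> n) \<le> 1 + ennreal \<beta> * ennreal (1 / (1 - \<beta>))"
      using step[of N] Suc by (meson add_left_mono mult_left_mono order_trans zero_le)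
    also have "\<dots> = ennreal (1 + \<beta> * (1 / (1 - \<beta>)))"
      using \<beta> by (subst ennreal_plus) (auto simp: ennreal_mult[symmetric])
    also have "1 + \<beta> * (1 / (1 - \<beta>)) = 1 / (1 - \<beta>)" using \<beta> by (simp add: field_simps)
    finally show ?case .
  qed simp
  then show False unfolding \<alpha>_def by (rule survival_sum_infinite)
qed

lemma prob_space_ascent: "prob_space ascent_law"
proof (rule prob_spaceI)
  show "emeasure ascent_law (space ascent_law) = 1"
    by (simp only: space_laws ascent_mass)
qed

text \<open>
  Both boundary values dominate their means under \<open>ascent_law\<close>, and their sum is a constant.  So neither inequality can be
  strict.
\<close>

lemma boundary_ascent_harmonic:
  assumes g: "killed_harmonic g" "killed_harmonic g'"
    and sum: "\<And>x. 0 < x \<Longrightarrow> g x + g' x = ennreal D * renewal_e x" and "0 < x"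
  shows "(\<integral>\<^sup>+z. boundary g (x + z) \<partial>ascent_law) = boundary g x"
    and "boundary g x + boundary g' x = ennreal D * ladder_mean"
proof -
  note [measurable] = g[THEN killed_harmonic_measurable]
  have bsum: "boundary g x + boundary g' x = ennreal D * ladder_mean" if "0 < x" for x
  proof -
    have "(\<lambda>n. meander n g x + meander n g' x) \<longlonglongrightarrow> boundary g x + boundary g' x"
      by (intro tendsto_add meander_tendsto g that)
    moreover have "meander n g x + meander n g' x = ennreal D * meander n renewal_e x" for n
    proof -
      have "AE s in climb n. s = 0 \<or> s \<in> {0<..}" by (rule AE_stay) simp
      then have "AE s in climb n. g (x + s) + g' (x + s) = ennreal D * renewal_e (x + s)"
        by eventually_elim (use sum that in auto)
      then have "(\<integral>\<^sup>+s. g (x + s) + g' (x + s) \<partial>climb n)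
          = (\<integral>\<^sup>+s. ennreal D * renewal_e (x + s) \<partial>climb n)"
        by (rule nn_integral_cong_AE)
      then show ?thesis unfolding meander_def by (simp add: nn_integral_add nn_integral_cmult)
    qed
    moreover have "(\<lambda>n. ennreal D * meander n renewal_e x) \<longlonglongrightarrow> ennreal D * boundary renewal_e x"
      by (intro ennreal_tendsto_cmult meander_tendsto killed_harmonic_renewal that) simp
    ultimately show ?thesis using LIMSEQ_unique boundary_renewal[OF that] by fastforce
  qed
  then show total: "boundary g x + boundary g' x = ennreal D * ladder_mean" using \<open>0 < x\<close> by blast
  have fin: "ennreal D * ladder_mean < \<top>"
    using ladder_mean_finite by (simp add: ennreal_mult_less_top)
  let ?p = "\<integral>\<^sup>+z. boundary g (x + z) \<partial>ascent_law" and ?q = "\<integral>\<^sup>+z. boundary g' (x + z) \<partial>ascent_law"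
  have "?p + ?q = (\<integral>\<^sup>+z. boundary g (x + z) + boundary g' (x + z) \<partial>ascent_law)"
    by (rule nn_integral_add[symmetric]) auto
  also have "\<dots> = (\<integral>\<^sup>+z. ennreal D * ladder_mean \<partial>ascent_law)"
    by (intro nn_integral_cong_AE) (use AE_ascent_pos \<open>0 < x\<close> in \<open>auto simp: bsum elim!: eventually_mono\<close>)
  also have "\<dots> = ennreal D * ladder_mean" by (simp add: ascent_mass)
  finally have pq: "?p + ?q = boundary g x + boundary g' x" using total by simp
  have le: "?p \<le> boundary g x" "?q \<le> boundary g' x"
    using boundary_ascent_le g \<open>0 < x\<close> by auto
  have fq: "boundary g' x < \<top>"
    using total fin by (metis ennreal_add_eq_top less_top)
  show "?p = boundary g x"
  proof (rule antisym[OF le(1)])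
    have "boundary g x + boundary g' x \<le> ?p + boundary g' x"
      using pq le(2) by (metis add_left_mono)
    then show "boundary g x \<le> ?p"
 using fq ennreal_add_left_cancel_le[of "boundary g' x" "boundary g x" ?p] by (auto simp: add.commute)
  qed
qed

end

section \<open>Invariance and uniqueness\<close>

lemma AE_sum_measure_component:
  assumes m: "\<And>n. sets (m n) = sets borel" and P: "{x. P x} \<in> sets borel"
    and ae: "AE x in sum_measure m. P x"
  shows "AE x in m n. P x"
proof -
  have nP: "{x. \<not> P x} \<in> sets borel" using P by (metis Collect_neg_eq sets.compl_sets space_borel Compl_eq_Diff_UNIV)
  have space_m: "space (m k) = UNIV" for k using sets_eq_imp_space_eq[OF m] by simp
  have "emeasure (sum_measure m) {x. \<not> P x} = 0"
    using ae nP by (subst (asm) AE_iff_measurable[OF _ refl]) auto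
  then have "(\<Sum>n. emeasure (m n) {x. \<not> P x}) = 0"
    using emeasure_sum_measure[OF m nP] by simp
  then have "emeasure (m n) {x. \<not> P x} = 0"
    by (simp add: suminf_eq_zero_iff)
  then show ?thesis
    by (subst AE_iff_measurable[OF _ refl]) (use nP m space_m in auto)
qed

context centered_law
begin

text \<open>
  Repeating a step of size at least \<open>\<delta>\<close> reaches any height while staying positive.
\<close>

lemma stay_unbounded: "\<exists>n. \<not> (AE s in climb n. s \<le> L)"
proof -
  obtain \<delta> where \<delta>: "0 < \<delta>" "0 < measure \<mu> {\<delta>..}" by (rule uniform_step)
  have pos: "0 < emeasure (climb n) {real n * \<delta>..}" for n
  proof (induction n)
    case 0
    then show ?case by simp
  next
    case (Suc n)
    have "emeasure (climb n) {real n * \<delta>..} * emeasure \<mu> {\<delta>..}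
        = (\<integral>\<^sup>+x. indicator {real n * \<delta>..} x * emeasure \<mu> {\<delta>..} \<partial>climb n)"
      by (subst nn_integral_multc) auto
    also have "\<dots> = (\<integral>\<^sup>+x. \<integral>\<^sup>+y. indicator {real n * \<delta>..} x * indicator {\<delta>..} y \<partial>\<mu> \<partial>climb n)"
      by (intro nn_integral_cong) (simp add: nn_integral_cmult)
    also have "\<dots> \<le> (\<integral>\<^sup>+x. \<integral>\<^sup>+y. indicator {real (Suc n) * \<delta>..} (x + y) * indicator {0<..} (x + y) \<partial>\<mu> \<partial>climb n)"
    proof (intro nn_integral_mono)
      fix x y :: real
      have "0 \<le> real n * \<delta>" using \<delta> by simp
      then have "0 < x + y" if "real n * \<delta> \<le> x" "\<delta> \<le> y" using that \<delta>(1) by linarith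
      then show "indicator {real n * \<delta>..} x * indicator {\<delta>..} y
          \<le> (indicator {real (Suc n) * \<delta>..} (x + y) * indicator {0<..} (x + y) :: ennreal)"
        using \<delta>(1) by (auto simp: algebra_simps split: split_indicator)
    qed
    also have "\<dots> = emeasure (climb (Suc n)) {real (Suc n) * \<delta>..}"
      by (subst nn_integral_stay_Suc[symmetric]) (auto simp del: stay.simps)
    finally have "emeasure (climb n) {real n * \<delta>..} * emeasure \<mu> {\<delta>..}
        \<le> emeasure (climb (Suc n)) {real (Suc n) * \<delta>..}" .
    moreover have "0 < emeasure (climb n) {real n * \<delta>..} * emeasure \<mu> {\<delta>..}"
      using Suc.IH \<delta>(2) by (simp add: ennreal_zero_less_mult_iff emeasure_eq_measure)
    ultimately show ?case by (rule order.strict_trans2[rotated])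
  qed
  obtain n where n: "L < real n * \<delta>" using reals_Archimedean3[OF \<delta>(1)] by blast
  have "\<not> (AE s in climb n. s \<le> L)"
  proof
    assume "AE s in climb n. s \<le> L"
    then have "emeasure (climb n) {s. \<not> s \<le> L} = 0"
      by (subst (asm) AE_iff_measurable[OF _ refl]) auto
    moreover have "emeasure (climb n) {real n * \<delta>..} \<le> emeasure (climb n) {s. \<not> s \<le> L}"
      using n by (intro emeasure_mono) auto
    ultimately show False using pos[of n] by simp
  qed
  then show ?thesis by blast
qed

text \<open>
  Invariance of \<open>f\<close> along all paths that stay above their starting point \<open>x > 0\<close>.
\<close>

definition meander_invariant :: "(real \<Rightarrow> real) \<Rightarrow> bool" where
  "meander_invariant f \<longleftrightarrow> f \<in> borel_measurable borel
     \<and> (\<forall>n. \<forall>x>0. AE s in climb n. f (x + s) = f x)"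

text \<open>
  A path that stays above its starting level reaches its end point through ladder points; the renewal
  equation splits off one of them, and induction on the length handles the rest.
\<close>

lemma meander_invariantI:
  assumes f [measurable]: "f \<in> borel_measurable borel"
    and inv: "\<And>x. 0 < x \<Longrightarrow> AE z in ascent_law. f (x + z) = f x"
  shows "meander_invariant f"
proof -
  have leave_inv: "AE z in ladder j. f (x + z) = f x" if "0 < x" for x j
    using inv[OF that] unfolding ascent_law_def
    by (rule AE_sum_measure_component[rotated 2]) auto
  have "AE s in climb n. f (x + s) = f x" if "0 < x" for n x
    using that
  proof (induction n arbitrary: x rule: less_induct)
    case (less n)
    show ?case
    proof (cases n)
      case 0
      have "AE s in return borel 0. f (x + s) = f x" by (subst AE_return) auto
      then show ?thesis by (simp only: 0 stay.simps)
    next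
      case (Suc m)
      define h :: "real \<Rightarrow> ennreal" where "h s = indicator {s. f (x + s) \<noteq> f x} s" for s
      have [measurable]: "h \<in> borel_measurable borel" unfolding h_def[abs_def] by measurable
      have "(\<integral>\<^sup>+s. h s \<partial>climb (Suc m))
          = (\<Sum>k\<le>m. \<integral>\<^sup>+y. \<integral>\<^sup>+z. h (y + z) \<partial>climb k \<partial>ladder (m - k))"
        by (rule wiener_hopf) simp
      also have "\<dots> = (\<Sum>k\<le>m. \<integral>\<^sup>+y. 0 \<partial>ladder (m - k))"
      proof (intro sum.cong refl nn_integral_cong_AE)
        fix k assume k: "k \<in> {..m}"
        have "AE y in ladder (m - k). y \<notin> {..0}" by (rule AE_leave) simp
        then show "AE y in ladder (m - k). (\<integral>\<^sup>+z. h (y + z) \<partial>climb k) = 0"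
          using leave_inv[OF less.prems, of "m - k"]
        proof eventually_elim
          case (elim y)
          have "0 < x + y" using elim(1) less.prems by simp
          then have "AE z in climb k. f ((x + y) + z) = f (x + y)"
            using k Suc by (intro less.IH) auto
          then have "AE z in climb k. h (y + z) = 0"
            by eventually_elim (use elim(2) in \<open>auto simp: h_def add.assoc\<close>)
          then show ?case by (subst nn_integral_cong_AE) auto
        qed
      qed
      finally have "(\<integral>\<^sup>+s. h s \<partial>climb (Suc m)) = 0" by simp
      then have "AE s in climb (Suc m). h s = 0"
        by (subst (asm) nn_integral_0_iff_AE) auto
      then show ?thesis unfolding Suc by eventually_elim (auto simp: h_def indicator_eq_0_iff)
    qed
  qed
  then show ?thesis using f by (simp add: meander_invariant_def)
qed

text \<open>
  Upward steps are themselves meanders.  For a step \<open>y\<close> downwards, insert a high climb \<open>s\<close>: the climb followed by \<open>y\<close>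
  is a meander from \<open>x\<close>, and the same climb is a meander from \<open>x + y\<close>.  Both end at the same point, so
  \<open>f\<close> agrees at \<open>x\<close> and at \<open>x + y\<close>.
\<close>

lemma meander_invariant_step:
  assumes f: "meander_invariant f" and "0 < x"
  shows "AE y in \<mu>. 0 < x + y \<longrightarrow> f (x + y) = f x"
proof -
  have [measurable]: "f \<in> borel_measurable borel" using f by (simp add: meander_invariant_def)
  have swap: "AE y in \<mu>. AE s in climb n. 0 < s + y \<longrightarrow> f (x + (s + y)) = f x" for n
  proof -
    interpret a: sigma_finite_measure "climb n" by (rule sigma_finite_stay) simp
    interpret P: pair_sigma_finite "climb n" \<mu> ..
    define h :: "real \<Rightarrow> ennreal" where "h s = indicator {s. f (x + s) \<noteq> f x} s" for s
    have [measurable]: "h \<in> borel_measurable borel" unfolding h_def[abs_def] by measurable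
    have "AE s in climb (Suc n). f (x + s) = f x"
      using f \<open>0 < x\<close> unfolding meander_invariant_def by blast
    then have "AE s in climb (Suc n). h s = 0" by eventually_elim (simp add: h_def)
    then have "(\<integral>\<^sup>+s. h s \<partial>climb (Suc n)) = 0"
      by (subst nn_integral_0_iff_AE) auto
    then have "(\<integral>\<^sup>+s. \<integral>\<^sup>+y. h (s + y) * indicator {0<..} (s + y) \<partial>\<mu> \<partial>climb n) = 0"
      by (subst (asm) nn_integral_stay_Suc) auto
    then have "AE s in climb n. (\<integral>\<^sup>+y. h (s + y) * indicator {0<..} (s + y) \<partial>\<mu>) = 0"
      by (subst (asm) nn_integral_0_iff_AE) auto
    then have "AE s in climb n. AE y in \<mu>. 0 < s + y \<longrightarrow> f (x + (s + y)) = f x"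
    proof eventually_elim
      case (elim s)
      then have "AE y in \<mu>. h (s + y) * indicator {0<..} (s + y) = 0"
        by (subst (asm) nn_integral_0_iff_AE) auto
      then show ?case by eventually_elim (auto simp: h_def indicator_eq_0_iff)
    qed
    moreover have "(AE s in climb n. AE y in \<mu>. 0 < s + y \<longrightarrow> f (x + (s + y)) = f x) \<longleftrightarrow>
        (AE y in \<mu>. AE s in climb n. 0 < s + y \<longrightarrow> f (x + (s + y)) = f x)"
      by (rule P.AE_commute) measurable
    ultimately show ?thesis by blast
  qed
  have "AE y in \<mu>. \<forall>n. AE s in climb n. 0 < s + y \<longrightarrow> f (x + (s + y)) = f x"
    using swap by (simp add: AE_all_countable)
  then show ?thesis
  proof eventually_elim
    case (elim y)
    show ?case
    proof
      assume xy: "0 < x + y"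
      obtain n where n: "\<not> (AE s in climb n. s \<le> - y)" using stay_unbounded by blast
      have "AE s in climb n. f ((x + y) + s) = f (x + y)"
        using f xy by (simp add: meander_invariant_def)
      show "f (x + y) = f x"
      proof (rule ccontr)
        assume ne: "f (x + y) \<noteq> f x"
        have "AE s in climb n. s \<le> - y"
          using \<open>AE s in climb n. f ((x + y) + s) = f (x + y)\<close> spec[OF elim, of n]
          by eventually_elim (use ne in \<open>auto simp: ac_simps not_le[symmetric]\<close>)
        then show False using n by simp
      qed
    qed
  qed
qed

lemma descent_mass_le_1: "emeasure descent_law UNIV \<le> 1"
proof -
  have sum: "emeasure (climb n) UNIV + (\<Sum>k<n. emeasure (leave {0<..} k) UNIV) = 1" for n
  proof (induction n)
    case 0
    then show ?case by simp
  next
    case (Suc n)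
    have "emeasure (climb n) UNIV = emeasure (climb (Suc n)) UNIV + emeasure (leave {0<..} n) UNIV"
      using nn_integral_stay_leave[of "{0<..}" "\<lambda>_. 1" n] emeasure_space_1
      by (simp del: stay.simps)
    then show ?case using Suc by (simp add: ac_simps del: stay.simps)
  qed
  have "emeasure descent_law UNIV = (\<Sum>k. emeasure (leave {0<..} k) UNIV)"
    unfolding descent_law_def by (rule emeasure_sum_measure) auto
  also have "\<dots> \<le> 1"
  proof (rule suminf_le_const)
    show "(\<Sum>k<n. emeasure (leave {0<..} k) UNIV) \<le> 1" for n
      unfolding sum[of n, symmetric] by simp
  qed auto
  finally show ?thesis .
qed

lemma AE_descent_nonpos: "AE z in descent_law. z \<le> 0"
proof -
  have "emeasure descent_law {0<..} = (\<Sum>n. emeasure (leave {0<..} n) {0<..})"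
    unfolding descent_law_def by (rule emeasure_sum_measure) auto
  also have "\<dots> = (\<Sum>n. 0)"
  proof (rule suminf_cong)
    fix n
    have "AE z in leave {0<..} n. z \<notin> {0<..}" by (rule AE_leave) simp
    then show "emeasure (leave {0<..} n) {0<..} = 0"
      by (subst (asm) AE_iff_measurable[OF _ refl]) (auto simp: greaterThan_def)
  qed
  finally have "emeasure descent_law {0<..} = 0" by simp
  then show ?thesis
    by (subst AE_iff_measurable[of "{0<..}"]) (auto simp: greaterThan_def)
qed

lemma descent_large_step:
  assumes "0 < \<delta>"
  shows "emeasure \<mu> {..-\<delta>} \<le> emeasure descent_law {..-\<delta>}"
proof -
  have "emeasure \<mu> {..-\<delta>} = (\<integral>\<^sup>+y. indicator {..-\<delta>} y \<partial>\<mu>)" by simp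
  also have "\<dots> = (\<integral>\<^sup>+y. indicator {..-\<delta>} (0 + y) * indicator (- {0<..}) (0 + y) \<partial>\<mu>)"
    using assms by (intro nn_integral_cong) (auto split: split_indicator)
  also have "\<dots> = emeasure (leave {0<..} 0) {..-\<delta>}"
    by (subst nn_integral_indicator[symmetric], simp, subst nn_integral_leave)
       (auto simp: nn_integral_return)
  also have "\<dots> \<le> (\<Sum>n. emeasure (leave {0<..} n) {..-\<delta>})"
    using sum_le_suminf[of "\<lambda>n. emeasure (leave {0<..} n) {..-\<delta>}" "{0}"] by simp
  also have "\<dots> = emeasure descent_law {..-\<delta>}"
    unfolding descent_law_def by (rule emeasure_sum_measure[symmetric]) auto
  finally show ?thesis .
qed

text \<open>
  The difference \<open>d\<close> of two killed harmonic functions with equal boundary values satisfies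
  \<open>d x \<le> E d (x + Z)\<close> with a descending ladder height \<open>Z\<close>.  With probability at least \<open>p\<close> the descent is at least \<open>\<delta>\<close>, and the remaining mass is at most \<open>1 - p\<close>.  So if \<open>d\<close> vanishes up to \<open>k * \<delta>\<close>, then any bound for \<open>d\<close> up to
  \<open>(k + 1) * \<delta>\<close> can be improved by the factor \<open>1 - p\<close>, and \<open>d\<close> vanishes there as well.
\<close>

lemma killed_harmonic_unique:
  assumes g: "killed_harmonic g" "killed_harmonic g'"
    and bound: "\<And>x. g x \<le> ennreal D * renewal_e x" "\<And>x. g' x \<le> ennreal D * renewal_e x"
    and eq: "\<And>x. 0 < x \<Longrightarrow> boundary g x = boundary g' x"
  shows "g = g'"
proof -
  note [measurable] = g[THEN killed_harmonic_measurable]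
  have fin: "ennreal D * renewal_e x < \<top>" for x by (simp add: ennreal_mult_less_top)
  define r where "r x = enn2real (g x)" for x
  define r' where "r' x = enn2real (g' x)" for x
  have gr: "g x = ennreal (r x)" "g' x = ennreal (r' x)" for x
    using order.strict_trans1[OF bound(1) fin, of x] order.strict_trans1[OF bound(2) fin, of x]
    by (simp_all add: r_def r'_def)
  have r0: "0 \<le> r x" "0 \<le> r' x" for x by (simp_all add: r_def r'_def)
  have [measurable]: "r \<in> borel_measurable borel" "r' \<in> borel_measurable borel"
    unfolding r_def[abs_def] r'_def[abs_def] by measurable
  define d where "d x = \<bar>r x - r' x\<bar>" for x
  have [measurable]: "d \<in> borel_measurable borel" unfolding d_def[abs_def] by measurable
  have d0: "0 \<le> d x" for x by (simp add: d_def)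
  have d_neg: "d x = 0" if "x \<le> 0" for x
    using g that by (simp add: d_def r_def r'_def killed_harmonic_def)
  have sub: "ennreal (d x) \<le> (\<integral>\<^sup>+s. ennreal (d (x + s)) \<partial>descent_law)" if "0 < x" for x
  proof -
    let ?I = "\<integral>\<^sup>+s. ennreal (d (x + s)) \<partial>descent_law"
    have half: "h1 x \<le> h2 x + ?I"
      if "killed_harmonic h1" "killed_harmonic h2" "boundary h1 x = boundary h2 x"
        "\<And>y. h1 y \<le> h2 y + ennreal (d y)" for h1 h2
    proof -
      note [measurable] = that(1,2)[THEN killed_harmonic_measurable]
      have "(\<integral>\<^sup>+s. h1 (x + s) \<partial>descent_law) \<le> (\<integral>\<^sup>+s. h2 (x + s) + ennreal (d (x + s)) \<partial>descent_law)"
        by (intro nn_integral_mono that(4))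
      also have "\<dots> = (\<integral>\<^sup>+s. h2 (x + s) \<partial>descent_law) + ?I" by (rule nn_integral_add) auto
      finally have "boundary h1 x + (\<integral>\<^sup>+s. h1 (x + s) \<partial>descent_law)
          \<le> boundary h2 x + ((\<integral>\<^sup>+s. h2 (x + s) \<partial>descent_law) + ?I)"
        unfolding that(3) by (rule add_left_mono)
      then show ?thesis
        using riesz_decomposition[OF that(1) \<open>0 < x\<close>] riesz_decomposition[OF that(2) \<open>0 < x\<close>]
        by (simp add: add.assoc)
    qed
    have le: "g y \<le> g' y + ennreal (d y)" "g' y \<le> g y + ennreal (d y)" for y
      unfolding gr using r0 d0 by (auto simp: ennreal_plus[symmetric] d_def intro!: ennreal_leI simp del: ennreal_plus)
    have b: "g x \<le> g' x + ?I" "g' x \<le> g x + ?I"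
      using half[OF g eq[OF \<open>0 < x\<close>] le(1)] half[OF g(2,1) eq[OF \<open>0 < x\<close>, symmetric] le(2)] by auto
    show ?thesis
    proof (cases "?I = \<top>")
      case False
      then obtain i where i: "?I = ennreal i" "0 \<le> i" by (cases ?I) auto
      have "r x \<le> r' x + i" "r' x \<le> r x + i"
        using b r0[of x] i(2) unfolding gr i(1)
        by (simp_all add: ennreal_plus[symmetric] ennreal_le_iff del: ennreal_plus)
      then show ?thesis unfolding i(1) by (intro ennreal_leI) (simp add: d_def)
    qed simp
  qed
  obtain \<delta> where \<delta>: "0 < \<delta>" "0 < measure \<mu> {..-\<delta>}" by (rule uniform_step)
  define p where "p = measure \<mu> {..-\<delta>}"
  have p: "0 < p" "p \<le> 1" using \<delta> by (simp_all add: p_def)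
  have short: "emeasure descent_law {-\<delta><..} \<le> ennreal (1 - p)"
  proof -
    have "emeasure descent_law {..-\<delta>} + emeasure descent_law {-\<delta><..} = emeasure descent_law ({..-\<delta>} \<union> {-\<delta><..})"
      by (rule plus_emeasure) auto
    also have "{..-\<delta>} \<union> {-\<delta><..} = UNIV" by auto
    finally have "emeasure \<mu> {..-\<delta>} + emeasure descent_law {-\<delta><..} \<le> 1"
      using descent_large_step[OF \<delta>(1)] descent_mass_le_1 by (metis add_right_mono order_trans)
    then have *: "ennreal p + emeasure descent_law {-\<delta><..} \<le> ennreal 1"
      by (simp add: p_def emeasure_eq_measure)
    then have "emeasure descent_law {-\<delta><..} \<noteq> \<top>" by (auto simp: top_unique)
    then obtain e where e: "emeasure descent_law {-\<delta><..} = ennreal e" "0 \<le> e"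
      by (cases "emeasure descent_law {-\<delta><..}") auto
    then show ?thesis using * p
      by (simp add: ennreal_plus[symmetric] ennreal_le_iff ennreal_leI del: ennreal_plus ennreal_1)
  qed
  obtain C where C: "0 \<le> C" "\<And>x. 0 < x \<Longrightarrow> renewal x \<le> (1 + 1) * x + C"
    using renewal_upper[of 1] by auto
  have zero: "\<forall>y \<le> real k * \<delta>. d y = 0" for k
  proof (induction k)
    case 0
    then show ?case using d_neg by simp
  next
    case (Suc k)
    define T where "T = real (Suc k) * \<delta>"
    define B where "B = max 0 D * (2 * T + C)"
    have T: "0 \<le> T" using \<delta>(1) by (simp add: T_def)
    have B: "0 \<le> B" using T C(1) by (simp add: B_def)
    have base: "d y \<le> B" if "y \<le> T" for y
    proof (cases "0 < y")
      case True
      have "max 0 D * renewal y \<le> B"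
        unfolding B_def using C(2)[OF True] that by (intro mult_left_mono) auto
      moreover have "ennreal D * renewal_e y = ennreal (max 0 D * renewal y)"
        using renewal_nonneg[of y] by (cases "0 \<le> D") (auto simp: ennreal_mult max_def ennreal_neg)
      ultimately have "ennreal (r y) \<le> ennreal B" "ennreal (r' y) \<le> ennreal B"
        using bound[of y] unfolding gr by (auto intro: order_trans ennreal_leI)
      then have "r y \<le> B" "r' y \<le> B" using B by (auto simp: ennreal_le_iff)
      then show ?thesis using r0[of y] by (simp add: d_def)
    qed (use d_neg B in simp)
    have iter: "\<forall>y\<le>T. d y \<le> (1 - p) ^ n * B" for n
    proof (induction n)
      case 0
      then show ?case using base by simp
    next
      case (Suc n)
      define b where "b = (1 - p) ^ n * B"
      have b: "0 \<le> b" using p B by (simp add: b_def)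
      have "d y \<le> (1 - p) * b" if "y \<le> T" for y
      proof (cases "0 < y")
        case True
        have "ennreal (d y) \<le> (\<integral>\<^sup>+s. ennreal (d (y + s)) \<partial>descent_law)" by (rule sub[OF True])
        also have "\<dots> \<le> (\<integral>\<^sup>+s. ennreal b * indicator {-\<delta><..} s \<partial>descent_law)"
        proof (rule nn_integral_mono_AE)
          show "AE s in descent_law. ennreal (d (y + s)) \<le> ennreal b * indicator {-\<delta><..} s"
            using AE_descent_nonpos
          proof eventually_elim
            case (elim s)
            show ?case
            proof (cases "s \<in> {-\<delta><..}")
              case True
              have "d (y + s) \<le> b" using Suc elim that by (simp add: b_def)
              then show ?thesis using True by (simp add: ennreal_leI)
            next
              case False
              then have "y + s \<le> real k * \<delta>" using that by (simp add: T_def algebra_simps)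
              then have "d (y + s) = 0" using \<open>\<forall>y\<le>real k * \<delta>. d y = 0\<close> by blast
              then show ?thesis by simp
            qed
          qed
        qed
        also have "\<dots> = ennreal b * emeasure descent_law {-\<delta><..}"
          by (rule nn_integral_cmult_indicator) simp
        also have "\<dots> \<le> ennreal b * ennreal (1 - p)" by (rule mult_left_mono[OF short]) simp
        also have "\<dots> = ennreal ((1 - p) * b)"
          using b p by (simp add: ennreal_mult[symmetric] mult.commute)
        finally show ?thesis using b p by (subst (asm) ennreal_le_iff) auto
      qed (use d_neg b p in simp)
      then show ?case by (simp add: b_def mult.assoc)
    qed
    have "(\<lambda>n. (1 - p) ^ n * B) \<longlonglongrightarrow> 0 * B"
      using p by (intro tendsto_mult_right LIMSEQ_power_zero) auto
    then have "d y \<le> 0" if "y \<le> T" for y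
      using iter that by (intro LIMSEQ_le_const[where X = "\<lambda>n. (1 - p) ^ n * B"]) auto
    then show ?case using d0 unfolding T_def by (meson order.antisym)
  qed
  show ?thesis
  proof
    fix x
    obtain k where "x < real k * \<delta>" using reals_Archimedean3[OF \<delta>(1)] by blast
    then have "d x = 0" using zero[of k] by (meson less_imp_le)
    then show "g x = g' x" by (simp add: gr d_def)
  qed
qed

text \<open>
  The normalized boundary value \<open>\<kappa>\<close> is invariant, so \<open>\<kappa>\<close> times the renewal function is again killed harmonic and has
  the same boundary value as \<open>g\<close>.
\<close>

lemma killed_harmonic_factorization:
  assumes g: "killed_harmonic g" "killed_harmonic g'"
    and sum: "\<And>x. g x + g' x = ennreal D * renewal_e x" and D: "0 \<le> D"
  obtains \<kappa> where "meander_invariant \<kappa>" "\<And>x. 0 \<le> \<kappa> x" "\<And>x. \<kappa> x \<le> D"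
    "\<And>x. g x = ennreal (\<kappa> x * renewal x)"
proof -
  note [measurable] = g[THEN killed_harmonic_measurable]
  obtain c where c: "ladder_mean = ennreal c" "0 < c"
    using ladder_mean_finite ladder_mean_pos by (cases ladder_mean) (auto simp: ennreal_zero_less_divide)
  note harm = boundary_ascent_harmonic[OF g sum]
  have le: "boundary g x \<le> ennreal (D * c)" if "0 < x" for x
  proof -
    have "boundary g x \<le> boundary g x + boundary g' x" by simp
    also have "\<dots> = ennreal (D * c)" using harm(2)[OF that] c D by (simp add: ennreal_mult)
    finally show ?thesis .
  qed
  define f where "f x = (if 0 < x then enn2real (boundary g x) else 0)" for x
  have [measurable]: "f \<in> borel_measurable borel" unfolding f_def[abs_def] by measurable
  have f0: "0 \<le> f x" for x by (simp add: f_def)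
  have fb: "boundary g x = ennreal (f x)" if "0 < x" for x
    using le[OF that] that by (simp add: f_def order.strict_trans1)
  have f_le: "f x \<le> D * c" for x
  proof (cases "0 < x")
    case True
    then show ?thesis using le[OF True] D c unfolding fb[OF True] by (simp add: ennreal_le_iff)
  qed (use D c in \<open>simp add: f_def\<close>)
  have f_harm: "(\<integral>z. f (x + z) \<partial>ascent_law) = f x" if "0 < x" for x
  proof -
    have "(\<integral>\<^sup>+z. ennreal (f (x + z)) \<partial>ascent_law) = (\<integral>\<^sup>+z. boundary g (x + z) \<partial>ascent_law)"
      by (intro nn_integral_cong_AE) (use AE_ascent_pos that in \<open>auto simp: fb elim!: eventually_mono\<close>)
    also have "\<dots> = ennreal (f x)" using harm(1)[OF that] fb[OF that] by simp
    finally show ?thesis using f0 by (subst integral_eq_nn_integral) auto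
  qed
  have inv: "AE z in ascent_law. f (x + z) = f x" if "0 < x" for x
    by (rule choquet_deny_half_line[OF prob_space_ascent _ AE_ascent_pos, of f "D * c"])
       (use f0 f_le f_harm that in \<open>auto simp: abs_of_nonneg\<close>)
  define \<kappa> where "\<kappa> x = f x / c" for x
  have \<kappa>_meas [measurable]: "\<kappa> \<in> borel_measurable borel" unfolding \<kappa>_def[abs_def] by measurable
  have \<kappa>_inv: "meander_invariant \<kappa>"
  proof (rule meander_invariantI)
    show "AE z in ascent_law. \<kappa> (x + z) = \<kappa> x" if "0 < x" for x
      using inv[OF that] by eventually_elim (simp add: \<kappa>_def)
  qed simp
  have \<kappa>0: "0 \<le> \<kappa> x" "\<kappa> x \<le> D" for x
    using f0[of x] f_le[of x] c by (auto simp: \<kappa>_def field_simps)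
  define h where "h x = ennreal (\<kappa> x * renewal x)" for x
  have h_alt: "h x = ennreal (\<kappa> x) * renewal_e x" for x
    using \<kappa>0 renewal_nonneg by (simp add: h_def ennreal_mult)
  have h_eq: "h (x + y) = ennreal (\<kappa> x) * renewal_e (x + y)" if "0 < x + y \<longrightarrow> \<kappa> (x + y) = \<kappa> x" for x y
    using that renewal_nonpos[of "x + y"] by (cases "0 < x + y") (auto simp: h_alt)
  have h_harm: "killed_harmonic h"
    unfolding killed_harmonic_def
  proof (intro conjI allI impI)
    show "h \<in> borel_measurable borel" unfolding h_def[abs_def] by measurable
    show "h x = 0" if "x \<le> 0" for x using renewal_nonpos[OF that] by (simp add: h_def)
    show "(\<integral>\<^sup>+y. h (x + y) \<partial>\<mu>) = h x" if "0 < x" for x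
    proof -
      have "(\<integral>\<^sup>+y. h (x + y) \<partial>\<mu>) = (\<integral>\<^sup>+y. ennreal (\<kappa> x) * renewal_e (x + y) \<partial>\<mu>)"
      proof (rule nn_integral_cong_AE)
        show "AE y in \<mu>. h (x + y) = ennreal (\<kappa> x) * renewal_e (x + y)"
          using meander_invariant_step[OF \<kappa>_inv that] by eventually_elim (rule h_eq)
      qed
      also have "\<dots> = h x"
        using renewal_harmonic[OF that] by (simp add: nn_integral_cmult h_alt)
      finally show ?thesis .
    qed
  qed
  have h_boundary: "boundary h x = boundary g x" if "0 < x" for x
  proof -
    have "meander n h x = ennreal (\<kappa> x) * meander n renewal_e x" for n
    proof -
      have "AE s in climb n. \<kappa> (x + s) = \<kappa> x"
        using \<kappa>_inv that by (simp add: meander_invariant_def)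
      then have "AE s in climb n. h (x + s) = ennreal (\<kappa> x) * renewal_e (x + s)"
        by eventually_elim (simp add: h_eq)
      then have "meander n h x = (\<integral>\<^sup>+s. ennreal (\<kappa> x) * renewal_e (x + s) \<partial>climb n)"
        unfolding meander_def by (rule nn_integral_cong_AE)
      then show ?thesis by (simp add: nn_integral_cmult meander_def)
    qed
    moreover have "(\<lambda>n. ennreal (\<kappa> x) * meander n renewal_e x) \<longlonglongrightarrow> ennreal (\<kappa> x) * boundary renewal_e x"
      by (intro ennreal_tendsto_cmult meander_tendsto killed_harmonic_renewal that) simp
    ultimately have "boundary h x = ennreal (\<kappa> x) * ladder_mean"
      using LIMSEQ_unique[OF meander_tendsto[OF h_harm that]] boundary_renewal[OF that] by simp
    also have "\<dots> = ennreal (f x)"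
      using c \<kappa>0 by (simp add: ennreal_mult[symmetric] \<kappa>_def)
    finally show ?thesis using fb[OF that] by simp
  qed
  have "g = h"
  proof (rule killed_harmonic_unique[OF g(1) h_harm, of D])
    show "g x \<le> ennreal D * renewal_e x" for x
      unfolding sum[of x, symmetric] by simp
    show "h x \<le> ennreal D * renewal_e x" for x
      unfolding h_alt using \<kappa>0 by (intro mult_right_mono ennreal_leI) auto
    show "boundary g x = boundary h x" if "0 < x" for x using h_boundary[OF that] by simp
  qed
  then show ?thesis using that[OF \<kappa>_inv \<kappa>0] by (simp add: h_def)
qed

lemma renewal_integrable:
  assumes "0 < x"
  shows "integrable \<mu> (\<lambda>y. renewal (x + y))" "(\<integral>y. renewal (x + y) \<partial>\<mu>) = renewal x"
proof -
  show int: "integrable \<mu> (\<lambda>y. renewal (x + y))"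
    by (rule integrableI_nonneg) (use renewal_harmonic[OF assms] renewal_nonneg in auto)
  have "ennreal (\<integral>y. renewal (x + y) \<partial>\<mu>) = ennreal (renewal x)"
    using renewal_harmonic[OF assms] nn_integral_eq_integral[OF int] renewal_nonneg by simp
  then show "(\<integral>y. renewal (x + y) \<partial>\<mu>) = renewal x"
    using renewal_nonneg by (simp add: integral_nonneg_AE)
qed

lemma harmonic_factorization:
  assumes [measurable]: "G \<in> borel_measurable borel"
    and G0: "\<And>x. x \<le> 0 \<Longrightarrow> G x = 0"
    and bound: "\<And>x. \<bar>G x\<bar> \<le> D * renewal x" and "0 \<le> D"
    and harm: "\<And>x. 0 < x \<Longrightarrow> (\<integral>y. G (x + y) \<partial>\<mu>) = G x"
  obtains \<kappa> where "meander_invariant \<kappa>" "\<And>x. \<bar>\<kappa> x\<bar> \<le> D" "\<And>x. G x = \<kappa> x * renewal x"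
proof -
  have kh: "killed_harmonic (\<lambda>x. ennreal (D * renewal x + \<sigma> * G x))" if \<sigma>: "\<bar>\<sigma>\<bar> = 1" for \<sigma>
    unfolding killed_harmonic_def
  proof (intro conjI allI impI)
    show "ennreal (D * renewal x + \<sigma> * G x) = 0" if "x \<le> 0" for x
      using G0[OF that] renewal_nonpos[OF that] by simp
    show "(\<integral>\<^sup>+y. ennreal (D * renewal (x + y) + \<sigma> * G (x + y)) \<partial>\<mu>) = ennreal (D * renewal x + \<sigma> * G x)"
      if "0 < x" for x
    proof -
      have intG: "integrable \<mu> (\<lambda>y. G (x + y))"
        by (rule Bochner_Integration.integrable_bound[of _ "\<lambda>y. D * renewal (x + y)"])
           (use renewal_integrable[OF that] bound \<open>0 \<le> D\<close> renewal_nonneg in \<open>auto simp: abs_mult\<close>)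
      have nn: "0 \<le> D * renewal y + \<sigma> * G y" for y
      proof -
        have "\<bar>\<sigma> * G y\<bar> \<le> D * renewal y" using bound[of y] \<sigma> by (simp add: abs_mult)
        then show ?thesis by linarith
      qed
      have "(\<integral>\<^sup>+y. ennreal (D * renewal (x + y) + \<sigma> * G (x + y)) \<partial>\<mu>)
          = ennreal (\<integral>y. D * renewal (x + y) + \<sigma> * G (x + y) \<partial>\<mu>)"
        by (rule nn_integral_eq_integral) (use renewal_integrable[OF that] intG nn in auto)
      also have "(\<integral>y. D * renewal (x + y) + \<sigma> * G (x + y) \<partial>\<mu>) = D * renewal x + \<sigma> * G x"
        using renewal_integrable[OF that] intG harm[OF that] by simp
      finally show ?thesis .
    qed
  qed simp
  obtain \<kappa> where \<kappa>: "meander_invariant \<kappa>" "\<And>x. 0 \<le> \<kappa> x" "\<And>x. \<kappa> x \<le> 2 * D"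
    "\<And>x. ennreal (D * renewal x + 1 * G x) = ennreal (\<kappa> x * renewal x)"
  proof (rule killed_harmonic_factorization[OF kh[of 1] kh[of "-1"], where D = "2 * D"])
    show "ennreal (D * renewal x + 1 * G x) + ennreal (D * renewal x + - 1 * G x)
        = ennreal (2 * D) * renewal_e x" for x
      using bound[of x] \<open>0 \<le> D\<close> renewal_nonneg[of x]
      by (subst ennreal_plus[symmetric]) (auto simp: ennreal_mult[symmetric] abs_le_iff)
  qed (use \<open>0 \<le> D\<close> in auto)
  show ?thesis
  proof (rule that[of "\<lambda>x. \<kappa> x - D"])
    show "meander_invariant (\<lambda>x. \<kappa> x - D)"
      using \<kappa>(1) by (auto simp: meander_invariant_def)
    show "\<bar>\<kappa> x - D\<bar> \<le> D" for x using \<kappa>(2,3)[of x] by linarith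
    show "G x = (\<kappa> x - D) * renewal x" for x
    proof -
      have "0 \<le> D * renewal x + 1 * G x" using bound[of x] by linarith
      then have "D * renewal x + 1 * G x = \<kappa> x * renewal x"
        using \<kappa>(4)[of x] \<kappa>(2)[of x] renewal_nonneg[of x] by simp
      then show ?thesis by (simp add: algebra_simps)
    qed
  qed
qed

text \<open>
  Neither factor of \<open>G = \<kappa> * renewal\<close> is continuous a priori.  Invariance replaces \<open>\<kappa>\<close> at \<open>x\<close> and at a sequence
  of points close to \<open>x\<close> by its values at a common translation \<open>s\<close> as large as desired.  There the
  relative oscillation of the renewal function is at most about \<open>\<eta>\<close>, and \<open>G\<close> is right-continuous.
\<close>

lemma factor_right_continuous:
  assumes \<kappa>: "meander_invariant \<kappa>" "\<And>x. \<bar>\<kappa> x\<bar> \<le> D" "\<And>x. G x = \<kappa> x * renewal x"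
    and G: "\<And>x. continuous (at_right x) G" and "0 < x"
  shows "continuous (at_right x) \<kappa>"
  unfolding continuous_within
proof (rule tendsto_at_right_sequentially[of x "x + 1"])
  fix S :: "nat \<Rightarrow> real" assume S: "\<And>n. x < S n" "S \<longlonglongrightarrow> x"
  show "(\<lambda>n. \<kappa> (S n)) \<longlonglongrightarrow> \<kappa> x"
  proof (rule LIMSEQ_I)
    fix r :: real assume r: "0 < r"
    have D: "0 \<le> D" using \<kappa>(2)[of 0] by linarith
    obtain \<eta> where \<eta>: "0 < \<eta>" and D\<eta>: "D * \<eta> \<le> r / 4"
    proof
      show "0 < r / 4 / (D + 1)" using r D by simp
      have "D / (D + 1) * (r / 4) \<le> 1 * (r / 4)"
        using r D by (intro mult_right_mono) auto
      then show "D * (r / 4 / (D + 1)) \<le> r / 4" by (simp add: ac_simps)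
    qed
    obtain C where C: "0 \<le> C" "\<And>x. 0 < x \<Longrightarrow> renewal x \<le> (1 + \<eta>) * x + C"
      using renewal_upper[OF \<eta>] by blast
    define L where "L = 1 + 4 * D * C / r"
    have L: "1 \<le> L" "D * C \<le> r / 4 * L"
      using r C(1) D by (auto simp: L_def field_simps)
    obtain N where N: "\<not> (AE s in climb N. s \<le> L)" using stay_unbounded by blast
    have inv: "AE s in climb N. \<kappa> (y + s) = \<kappa> y" if "0 < y" for y
      using \<kappa>(1) that by (simp add: meander_invariant_def)
    have "AE s in climb N. \<forall>n. \<kappa> (S n + s) = \<kappa> (S n)"
      unfolding AE_all_countable using inv S(1) \<open>0 < x\<close> by (meson order.strict_trans)
    then have "AE s in climb N. \<kappa> (x + s) = \<kappa> x \<and> (\<forall>n. \<kappa> (S n + s) = \<kappa> (S n))"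
      using inv[OF \<open>0 < x\<close>] by eventually_elim simp
    then obtain s where s: "L < s" "\<kappa> (x + s) = \<kappa> x" "\<And>n. \<kappa> (S n + s) = \<kappa> (S n)"
    proof -
      have "\<exists>s>L. \<kappa> (x + s) = \<kappa> x \<and> (\<forall>n. \<kappa> (S n + s) = \<kappa> (S n))"
      proof (rule ccontr)
        assume no: "\<not> ?thesis"
        have "AE s in climb N. s \<le> L"
          using \<open>AE s in climb N. \<kappa> (x + s) = \<kappa> x \<and> (\<forall>n. \<kappa> (S n + s) = \<kappa> (S n))\<close>
          by eventually_elim (use no not_le in blast)
        then show False using N by simp
      qed
      then show ?thesis using that by blast
    qed
    define v where "v = x + s"
    have v: "L < v" "1 \<le> v" using s(1) \<open>0 < x\<close> L by (auto simp: v_def)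
    have lim_u: "(\<lambda>n. S n + s) \<longlonglongrightarrow> v" unfolding v_def by (intro tendsto_add S(2) tendsto_const)
    have u_gt: "v < S n + s" for n using S(1)[of n] by (simp add: v_def)
    have limG: "((\<lambda>n. G (S n + s)) \<longlonglongrightarrow> G v)"
    proof -
      have "(G \<longlongrightarrow> G v) (at_right v)" using G[of v] by (simp add: continuous_within)
      moreover have "filterlim (\<lambda>n. S n + s) (at_right v) sequentially"
        by (rule filterlim_at_withinI[OF lim_u]) (use u_gt in auto)
      ultimately show ?thesis by (rule filterlim_compose)
    qed
    have "0 < r / 8" using r by simp
    from tendstoD[OF limG this] have "eventually (\<lambda>n. \<bar>G (S n + s) - G v\<bar> < r / 8) sequentially"
      unfolding dist_real_def .
    moreover have "(\<lambda>n. D * (1 + \<eta>) * (S n + s - v)) \<longlonglongrightarrow> D * (1 + \<eta>) * (v - v)"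
      by (intro tendsto_mult tendsto_diff tendsto_const lim_u)
    then have "eventually (\<lambda>n. D * (1 + \<eta>) * (S n + s - v) < r / 8) sequentially"
      using r by (intro order_tendstoD(2)) auto
    ultimately have "eventually (\<lambda>n. norm (\<kappa> (S n) - \<kappa> x) < r) sequentially"
    proof eventually_elim
      case (elim n)
      define u where "u = S n + s"
      have u: "v < u" using u_gt by (simp add: u_def)
      have Hv: "v \<le> renewal v" "v \<le> renewal u" "u \<le> renewal u" using renewal_ge[of v] renewal_ge[of u] u by auto
      have Hdiff: "\<bar>renewal u - renewal v\<bar> \<le> (1 + \<eta>) * (u - v) + \<eta> * v + C"
      proof -
        have "renewal u \<le> (1 + \<eta>) * u + C" "renewal v \<le> (1 + \<eta>) * v + C" using C(2) u v by auto
        moreover have "0 \<le> \<eta> * (u - v)" using \<eta> u by simp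
        ultimately show ?thesis using Hv u by (simp add: algebra_simps abs_le_iff)
      qed
      have "\<kappa> (S n) - \<kappa> x = \<kappa> u - \<kappa> v" using s by (simp add: u_def v_def)
      have "(\<kappa> u - \<kappa> v) * renewal v = (G u - G v) + \<kappa> u * (renewal v - renewal u)"
        by (simp add: \<kappa>(3) algebra_simps)
      then have "\<bar>\<kappa> u - \<kappa> v\<bar> * renewal v \<le> \<bar>G u - G v\<bar> + D * \<bar>renewal u - renewal v\<bar>"
      proof -
        have "\<bar>\<kappa> u - \<kappa> v\<bar> * renewal v = \<bar>(G u - G v) + \<kappa> u * (renewal v - renewal u)\<bar>"
          using \<open>(\<kappa> u - \<kappa> v) * renewal v = _\<close> renewal_nonneg[of v] by (metis abs_mult abs_of_nonneg)
        also have "\<dots> \<le> \<bar>G u - G v\<bar> + \<bar>\<kappa> u\<bar> * \<bar>renewal v - renewal u\<bar>"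
          by (metis abs_mult abs_triangle_ineq)
        also have "\<dots> \<le> \<bar>G u - G v\<bar> + D * \<bar>renewal u - renewal v\<bar>"
          using \<kappa>(2)[of u] by (simp add: abs_minus_commute mult_right_mono)
        finally show ?thesis .
      qed
      also have "\<dots> < r * v"
      proof -
        have "D * \<bar>renewal u - renewal v\<bar> \<le> D * ((1 + \<eta>) * (u - v) + \<eta> * v + C)"
          by (rule mult_left_mono[OF Hdiff D])
        also have "\<dots> = D * (1 + \<eta>) * (u - v) + D * \<eta> * v + D * C" by (simp add: algebra_simps)
        also have "\<dots> \<le> r / 8 + r / 4 * v + r / 4 * v"
        proof (intro add_mono)
          show "D * (1 + \<eta>) * (u - v) \<le> r / 8" using elim(2) by (simp add: u_def)
          show "D * \<eta> * v \<le> r / 4 * v" using D\<eta> v by (intro mult_right_mono) auto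
          have "r / 4 * L \<le> r / 4 * v" using v r by (intro mult_left_mono) auto
          then show "D * C \<le> r / 4 * v" using L(2) by linarith
        qed
        finally have "D * \<bar>renewal u - renewal v\<bar> \<le> r / 8 + r / 2 * v" by simp
        moreover have "\<bar>G u - G v\<bar> < r / 8" using elim(1) by (simp add: u_def)
        moreover have "r / 4 \<le> r / 4 * v" using v r by simp
        moreover have "0 < r * v" using v r by simp
        ultimately show ?thesis by linarith
      qed
      finally have "\<bar>\<kappa> u - \<kappa> v\<bar> * renewal v < r * v" .
      moreover have "\<bar>\<kappa> u - \<kappa> v\<bar> * v \<le> \<bar>\<kappa> u - \<kappa> v\<bar> * renewal v"
        by (intro mult_left_mono Hv) simp
      ultimately have "\<bar>\<kappa> u - \<kappa> v\<bar> * v < r * v" by linarith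
      then have "\<bar>\<kappa> u - \<kappa> v\<bar> < r" using v by simp
      then show ?case using \<open>\<kappa> (S n) - \<kappa> x = _\<close> by simp
    qed
    then show "\<exists>no. \<forall>n\<ge>no. norm (\<kappa> (S n) - \<kappa> x) < r" by (simp add: eventually_sequentially)
  qed
qed simp

end

section \<open>Periods\<close>

text \<open>
  Periods on the open half-line.  Negative \<open>z\<close> are included; this makes the set of all periods a group.
\<close>

definition period :: "(real \<Rightarrow> real) \<Rightarrow> real \<Rightarrow> bool" where
  "period \<kappa> z \<longleftrightarrow> (\<forall>x. 0 < x \<longrightarrow> 0 < x + z \<longrightarrow> \<kappa> (x + z) = \<kappa> x)"

lemma period_zero: "period \<kappa> 0"
  by (simp add: period_def)

lemma period_uminus:
  assumes "period \<kappa> z"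
  shows "period \<kappa> (- z)"
  unfolding period_def
proof (intro allI impI)
  fix x assume "0 < x" "0 < x + - z"
  then have "\<kappa> ((x + - z) + z) = \<kappa> (x + - z)"
    using assms unfolding period_def by (metis add.commute add_minus_cancel)
  then show "\<kappa> (x + - z) = \<kappa> x" by simp
qed

lemma period_add:
  assumes "period \<kappa> p" "period \<kappa> q"
  shows "period \<kappa> (p + q)"
  unfolding period_def
proof (intro allI impI)
  fix x assume x: "0 < x" "0 < x + (p + q)"
  show "\<kappa> (x + (p + q)) = \<kappa> x"
  proof (cases "0 < x + p")
    case True
    then have "\<kappa> (x + p + q) = \<kappa> (x + p)" "\<kappa> (x + p) = \<kappa> x"
      using assms x unfolding period_def by (auto simp: add.assoc)
    then show ?thesis by (simp add: add.assoc)
  next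
    case False
    then have "0 < x + q" using x by linarith
    then have "\<kappa> (x + q + p) = \<kappa> (x + q)" "\<kappa> (x + q) = \<kappa> x"
      using assms x unfolding period_def by (auto simp: ac_simps)
    then show ?thesis by (simp add: ac_simps)
  qed
qed

lemma period_diff: "period \<kappa> p \<Longrightarrow> period \<kappa> q \<Longrightarrow> period \<kappa> (p - q)"
  using period_add[OF _ period_uminus, of \<kappa> p q] by simp

lemma period_int_mult:
  assumes "period \<kappa> z"
  shows "period \<kappa> (z * of_int k)"
proof -
  have nat: "period \<kappa> (z * of_nat n)" for n
    by (induction n) (use assms period_zero period_add in \<open>auto simp: distrib_left\<close>)
  show ?thesis
  proof (cases "0 \<le> k")
    case True
    then show ?thesis using nat[of "nat k"] by simp
  next
    case False
    then show ?thesis using period_uminus[OF nat[of "nat (- k)"]] by simp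
  qed
qed

lemma right_continuous_eq_const:
  fixes \<phi> :: "real \<Rightarrow> real"
  assumes "continuous (at_right x) \<phi>" "\<And>q. q \<in> \<rat> \<Longrightarrow> x < q \<Longrightarrow> \<phi> q = c"
  shows "\<phi> x = c"
proof (rule ccontr)
  assume "\<phi> x \<noteq> c"
  moreover have "(\<phi> \<longlongrightarrow> \<phi> x) (at_right x)" using assms(1) by (simp add: continuous_within)
  ultimately have "eventually (\<lambda>t. \<phi> t \<noteq> c) (at_right x)" by (intro tendsto_imp_eventually_ne)
  then obtain b where b: "x < b" "\<And>t. x < t \<Longrightarrow> t < b \<Longrightarrow> \<phi> t \<noteq> c"
    unfolding eventually_at_right[OF less_add_one] by blast
  obtain q where "q \<in> \<rat>" "x < q" "q < b" using Rats_dense_in_real[OF b(1)] by blast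
  then show False using b(2) assms(2) by blast
qed

context centered_law
begin

text \<open>
  For each fixed \<open>x\<close> almost every step leaves \<open>\<kappa> x\<close> unchanged.  Countably many \<open>x\<close> can be treated
  simultaneously, and right continuity passes from rational to real \<open>x\<close>.
\<close>

lemma AE_period:
  assumes \<kappa>: "meander_invariant \<kappa>" and rc: "\<And>x. 0 < x \<Longrightarrow> continuous (at_right x) \<kappa>"
  shows "AE y in \<mu>. period \<kappa> y"
proof -
  have "AE y in \<mu>. \<forall>q\<in>\<rat>. 0 < q \<longrightarrow> 0 < q + y \<longrightarrow> \<kappa> (q + y) = \<kappa> q"
  proof (subst AE_ball_countable[OF countable_rat], intro ballI)
    fix q :: real
    show "AE y in \<mu>. 0 < q \<longrightarrow> 0 < q + y \<longrightarrow> \<kappa> (q + y) = \<kappa> q"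
      using meander_invariant_step[OF \<kappa>, of q] by (cases "0 < q") auto
  qed
  then show ?thesis
  proof eventually_elim
    case (elim y)
    show ?case unfolding period_def
    proof (intro allI impI)
      fix x assume x: "0 < x" "0 < x + y"
      have "filterlim (\<lambda>t. t + y) (at_right (x + y)) (at_right x)"
        by (rule filterlim_at_withinI) (auto intro!: tendsto_eq_intros eventually_at_right_less simp: eventually_at_filter)
      moreover have "(\<kappa> \<longlongrightarrow> \<kappa> (x + y)) (at_right (x + y))"
        using rc[OF x(2)] by (simp add: continuous_within)
      ultimately have "((\<lambda>t. \<kappa> (t + y)) \<longlongrightarrow> \<kappa> (x + y)) (at_right x)"
        by (rule filterlim_compose[rotated])
      then have "continuous (at_right x) (\<lambda>t. \<kappa> (t + y) - \<kappa> t)"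
        using rc[OF x(1)] by (simp add: continuous_within tendsto_diff)
      then have "\<kappa> (x + y) - \<kappa> x = 0"
        by (rule right_continuous_eq_const) (use elim x in auto)
      then show "\<kappa> (x + y) = \<kappa> x" by simp
    qed
  qed
qed

lemma nonzero_period:
  assumes "AE y in \<mu>. P y"
  shows "\<exists>y. P y \<and> y \<noteq> 0"
proof (rule ccontr)
  assume "\<not> ?thesis"
  then have "AE y in \<mu>. y = 0" using assms by (auto elim!: eventually_mono)
  then show False using not_AE_zero by simp
qed

text \<open>
  The periods in \<open>d * \<int>\<close> form a subgroup \<open>d * m * \<int>\<close> that carries the step law, and maximality
  of \<open>d\<close> gives \<open>m = 1\<close>.
\<close>

lemma span_is_period:
  assumes per: "AE y in \<mu>. period \<kappa> y" and "0 < d"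
    and lattice: "AE y in \<mu>. \<exists>k::int. y = d * of_int k"
    and maximal: "\<And>d'. 0 < d' \<Longrightarrow> (AE y in \<mu>. \<exists>k::int. y = d' * of_int k) \<Longrightarrow> d' \<le> d"
  shows "period \<kappa> d"
proof -
  have "AE y in \<mu>. period \<kappa> y \<and> (\<exists>k::int. y = d * of_int k)" using per lattice by eventually_elim simp
  from nonzero_period[OF this] obtain k :: int where k: "period \<kappa> (d * of_int k)" "k \<noteq> 0"
    by auto
  define P where "P m \<longleftrightarrow> 0 < m \<and> period \<kappa> (d * real m)" for m :: nat
  have "P (nat \<bar>k\<bar>)"
    using k period_uminus[OF k(1)] unfolding P_def by (cases "0 \<le> k") auto
  then have Pm: "P (LEAST m. P m)" by (rule LeastI)
  define m where "m = (LEAST m. P m)"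
  have m: "0 < m" "period \<kappa> (d * real m)" using Pm by (auto simp: m_def P_def)
  have div: "int m dvd j" if "period \<kappa> (d * of_int j)" for j
  proof -
    have "period \<kappa> (d * of_int j - d * real m * of_int (j div int m))"
      by (intro period_diff that period_int_mult m(2))
    also have "d * of_int j - d * real m * of_int (j div int m) = d * real_of_int (j - int m * (j div int m))"
      by (simp add: algebra_simps)
    also have "j - int m * (j div int m) = j mod int m" by (simp add: minus_mult_div_eq_mod)
    finally have per: "period \<kappa> (d * real (nat (j mod int m)))" using m(1) by simp
    have "nat (j mod int m) < m" using m(1) by (simp add: nat_less_iff)
    then have "\<not> P (nat (j mod int m))" unfolding m_def by (rule not_less_Least)
    then have "j mod int m = 0" using per m(1) unfolding P_def
      by (metis Euclidean_Rings.pos_mod_sign nat_0_iff neq0_conv of_nat_0_less_iff order.antisym)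
    then show ?thesis by (simp add: dvd_eq_mod_eq_0)
  qed
  have "AE y in \<mu>. \<exists>k::int. y = (d * real m) * of_int k"
    using per lattice
  proof eventually_elim
    case (elim y)
    then obtain j :: int where j: "y = d * of_int j" by blast
    then obtain i where "j = int m * i" using div elim(1) by (metis dvdE)
    then show ?case using j by (intro exI[of _ i]) simp
  qed
  then have "d * real m \<le> d" using maximal[of "d * real m"] m(1) \<open>0 < d\<close> by simp
  then have "m = 1" using m(1) \<open>0 < d\<close> by simp
  then show ?thesis using m(2) by simp
qed

text \<open>
  The span is defined as a maximum, so its existence needs an argument: the step law has an atom \<open>a \<noteq> 0\<close>, up to sign,
  and every admissible lattice constant is of the form \<open>a / n\<close>.
\<close>

lemma maximal_lattice:
  assumes "0 < \<rho>" and lattice: "AE y in \<mu>. \<exists>k::int. y = \<rho> * of_int k"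
  shows "\<exists>d>0. (AE y in \<mu>. \<exists>k::int. y = d * of_int k)
    \<and> (\<forall>d'>0. (AE y in \<mu>. \<exists>k::int. y = d' * of_int k) \<longrightarrow> d' \<le> d)"
proof -
  have "\<exists>k::int. k \<noteq> 0 \<and> \<not> (AE y in \<mu>. y \<noteq> \<rho> * of_int k)"
  proof (rule ccontr)
    assume "\<not> ?thesis"
    then have "AE y in \<mu>. \<forall>k::int. k \<noteq> 0 \<longrightarrow> y \<noteq> \<rho> * of_int k"
      unfolding AE_all_countable by auto
    then have "AE y in \<mu>. y = 0"
      using lattice by eventually_elim (metis mult_zero_right of_int_0)
    then show False using not_AE_zero by simp
  qed
  then obtain k0 :: int where k0: "k0 \<noteq> 0" "\<not> (AE y in \<mu>. y \<noteq> \<rho> * of_int k0)" by blast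
  \<comment> \<open>every lattice carrying the step law contains the atom \<open>\<rho> * k0\<close>, hence \<open>a\<close>\<close>
  define a where "a = \<rho> * of_int \<bar>k0\<bar>"
  have a: "0 < a" using k0(1) assms(1) by (simp add: a_def)
  have divisor: "\<exists>n::nat. 0 < n \<and> t = a / real n" if "0 < t" "AE y in \<mu>. \<exists>k::int. y = t * of_int k" for t
  proof -
    have "\<exists>k::int. \<rho> * of_int k0 = t * of_int k"
    proof (rule ccontr)
      assume no: "\<not> ?thesis"
      have "AE y in \<mu>. y \<noteq> \<rho> * of_int k0" using that(2) by eventually_elim (use no in blast)
      then show False using k0(2) by simp
    qed
    then obtain k :: int where k: "\<rho> * of_int k0 = t * of_int k" by blast
    then have "\<bar>\<rho> * of_int k0\<bar> = \<bar>t * of_int k\<bar>" by simp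
    then have "a = t * of_int \<bar>k\<bar>" using assms(1) that(1) by (simp add: a_def abs_mult)
    moreover have "k \<noteq> 0" using k k0(1) assms(1) by auto
    ultimately show ?thesis
      by (intro exI[of _ "nat \<bar>k\<bar>"]) (simp add: field_simps)
  qed
  define P where "P n \<longleftrightarrow> 0 < n \<and> (AE y in \<mu>. \<exists>k::int. y = (a / real n) * of_int k)" for n :: nat
  obtain n where "0 < n" "\<rho> = a / real n" using divisor[OF assms] by blast
  then have "P n" using lattice by (simp only: P_def)
  then have PL: "P (LEAST n. P n)" by (rule LeastI)
  define m where "m = (LEAST n. P n)"
  have m: "0 < m" "AE y in \<mu>. \<exists>k::int. y = (a / real m) * of_int k"
    using PL[folded m_def] by (simp_all only: P_def)
  show ?thesis
  proof (intro exI[of _ "a / real m"] conjI allI impI)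
    show "0 < a / real m" using a m(1) by simp
    show "AE y in \<mu>. \<exists>k::int. y = (a / real m) * of_int k" by (rule m(2))
    fix t assume t: "0 < t" "AE y in \<mu>. \<exists>k::int. y = t * of_int k"
    obtain n where n: "0 < n" "t = a / real n" using divisor[OF t] by blast
    have "P n" unfolding P_def using n(1) t(2) unfolding n(2) by blast
    then have "m \<le> n" unfolding m_def by (rule Least_le)
    then show "t \<le> a / real m"
      unfolding n(2) using a m(1) by (intro divide_left_mono) auto
  qed
qed

text \<open>
  If the periods were bounded away from \<open>0\<close>, they would be the multiples of a least positive one, and
  the step law would be carried by a lattice.  So there are arbitrarily small periods.
\<close>

lemma nonlattice_constant:
  assumes per: "AE y in \<mu>. period \<kappa> y"
    and rc: "\<And>x. 0 < x \<Longrightarrow> continuous (at_right x) \<kappa>"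
    and nonlattice: "\<And>\<rho>. 0 < \<rho> \<Longrightarrow> \<not> (AE y in \<mu>. \<exists>k::int. y = \<rho> * of_int k)"
    and ab: "0 < a" "a < b"
  shows "\<kappa> a = \<kappa> b"
proof -
  have small: "\<exists>z. period \<kappa> z \<and> 0 < z \<and> z < e" if "0 < e" for e
  proof (rule ccontr)
    assume no: "\<not> ?thesis"
    obtain y where y: "period \<kappa> y" "y \<noteq> 0" using nonzero_period[OF per] by blast
    define Q where "Q = {z. period \<kappa> z \<and> 0 < z}"
    have "\<bar>y\<bar> \<in> Q" using y period_uminus[OF y(1)] by (auto simp: Q_def abs_if)
    then have ne: "Q \<noteq> {}" by blast
    have low: "e \<le> z" if "z \<in> Q" for z using no that by (force simp: Q_def)
    have bdd: "bdd_below Q" using low by (auto simp: bdd_below_def)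
    define \<rho> where "\<rho> = Inf Q"
    have \<rho>e: "e \<le> \<rho>" unfolding \<rho>_def by (rule cInf_greatest[OF ne low])
    have \<rho>_le: "\<rho> \<le> z" if "z \<in> Q" for z unfolding \<rho>_def by (rule cInf_lower[OF that bdd])
    have near: "\<exists>z\<in>Q. z < t" if "\<rho> < t" for t
      using cInf_lessD[OF ne] that by (auto simp: \<rho>_def)
    have \<rho>Q: "\<rho> \<in> Q"
    proof (rule ccontr)
      assume nQ: "\<rho> \<notin> Q"
      obtain z1 where z1: "z1 \<in> Q" "z1 < \<rho> + e" using near[of "\<rho> + e"] \<open>0 < e\<close> by auto
      then have "\<rho> < z1" using \<rho>_le nQ by (metis order.order_iff_strict)
      then obtain z2 where z2: "z2 \<in> Q" "z2 < z1" using near by blast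
      have "period \<kappa> (z1 - z2)" using z1 z2 by (auto simp: Q_def intro: period_diff)
      then have "z1 - z2 \<in> Q" using z2 by (simp add: Q_def)
      then show False using low[of "z1 - z2"] \<rho>_le[OF z2(1)] z1(2) by linarith
    qed
    have \<rho>0: "0 < \<rho>" using \<rho>e \<open>0 < e\<close> by simp
    have "AE y in \<mu>. \<exists>k::int. y = \<rho> * of_int k"
      using per
    proof eventually_elim
      case (elim y)
      define z where "z = y - \<rho> * of_int \<lfloor>y / \<rho>\<rfloor>"
      have zp: "period \<kappa> z"
        unfolding z_def using \<rho>Q by (intro period_diff elim period_int_mult) (simp add: Q_def)
      have "of_int \<lfloor>y / \<rho>\<rfloor> \<le> y / \<rho>" "y / \<rho> < of_int \<lfloor>y / \<rho>\<rfloor> + 1" by linarith+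
      then have "of_int \<lfloor>y / \<rho>\<rfloor> * \<rho> \<le> y" "y < (of_int \<lfloor>y / \<rho>\<rfloor> + 1) * \<rho>"
        unfolding pos_le_divide_eq[OF \<rho>0] pos_divide_less_eq[OF \<rho>0] .
      then have "0 \<le> z" "z < \<rho>" by (auto simp: z_def algebra_simps)
      then have "z = 0" using zp \<rho>_le[of z] by (force simp: Q_def)
      then show ?case by (auto simp: z_def)
    qed
    then show False using nonlattice[OF \<rho>0] by blast
  qed
  show ?thesis
  proof (rule ccontr)
    assume ne: "\<kappa> a \<noteq> \<kappa> b"
    have "(\<kappa> \<longlongrightarrow> \<kappa> b) (at_right b)" using rc[of b] ab by (simp add: continuous_within)
    then have "eventually (\<lambda>t. \<kappa> t \<noteq> \<kappa> a) (at_right b)"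
      using ne by (intro tendsto_imp_eventually_ne) auto
    then obtain c where c: "b < c" "\<And>t. b < t \<Longrightarrow> t < c \<Longrightarrow> \<kappa> t \<noteq> \<kappa> a"
      unfolding eventually_at_right[OF less_add_one] by blast
    obtain z where z: "period \<kappa> z" "0 < z" "z < c - b" using small[of "c - b"] c(1) by auto
    define k where "k = \<lfloor>(b - a) / z\<rfloor> + 1"
    have "(b - a) / z < of_int k" "of_int k \<le> (b - a) / z + 1" unfolding k_def by linarith+
    then have k: "b < a + z * of_int k" "a + z * of_int k \<le> b + z" using z(2) by (auto simp: field_simps)
    have "\<kappa> (a + z * of_int k) = \<kappa> a"
      using period_int_mult[OF z(1), of k] k(1) ab unfolding period_def by auto
    then show False using c(2)[OF k(1)] k(2) z(3) by linarith
  qed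
qed

end

section \<open>The killed walk on the path space\<close>

lemma borel_measurable_right_continuous:
  fixes G :: "real \<Rightarrow> real"
  assumes "\<And>x. continuous (at_right x) G"
  shows "G \<in> borel_measurable borel"
proof (rule borel_measurable_LIMSEQ_real)
  \<comment> \<open>grid points that approach \<open>x\<close> strictly from the right\<close>
  define r where "r n x = (of_int \<lfloor>x * real (Suc n)\<rfloor> + 1) / real (Suc n)" for n x
  have r: "x < r n x" "r n x \<le> x + 1 / real (Suc n)" for n x
  proof -
    have "x * real (Suc n) < of_int \<lfloor>x * real (Suc n)\<rfloor> + 1" "of_int \<lfloor>x * real (Suc n)\<rfloor> \<le> x * real (Suc n)"
      by linarith+
    then show "x < r n x" "r n x \<le> x + 1 / real (Suc n)"
      unfolding r_def by (simp_all add: field_simps del: of_nat_Suc)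
  qed
  show "(\<lambda>n. G (r n x)) \<longlonglongrightarrow> G x" for x
  proof -
    have "(\<lambda>n. x + 1 / real (Suc n)) \<longlonglongrightarrow> x + 0"
      by (intro tendsto_add tendsto_const) (rule LIMSEQ_Suc[OF lim_1_over_n])
    then have upper: "(\<lambda>n. x + 1 / real (Suc n)) \<longlonglongrightarrow> x" by simp
    have "(\<lambda>n. r n x) \<longlonglongrightarrow> x"
    proof (rule tendsto_sandwich[OF _ _ tendsto_const upper])
      show "eventually (\<lambda>n. x \<le> r n x) sequentially"
        by (rule always_eventually, rule allI, rule less_imp_le[OF r(1)])
      show "eventually (\<lambda>n. r n x \<le> x + 1 / real (Suc n)) sequentially"
        by (rule always_eventually, rule allI, rule r(2))
    qed
    then have "filterlim (\<lambda>n. r n x) (at_right x) sequentially"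
      by (rule filterlim_at_withinI) (use r(1) in auto)
    then show ?thesis
      using assms[of x] unfolding continuous_within by (rule filterlim_compose[rotated])
  qed
  show "(\<lambda>x. G (r n x)) \<in> borel_measurable borel" for n
  proof -
    have "(\<lambda>k::int. G ((of_int k + 1) / real (Suc n))) \<in> measurable (count_space UNIV) borel" by simp
    moreover have "(\<lambda>x::real. \<lfloor>x * real (Suc n)\<rfloor>) \<in> measurable borel (count_space UNIV)" by measurable
    ultimately show ?thesis unfolding r_def by (rule measurable_compose[rotated])
  qed
qed

context random_walk
begin

definition increment :: "nat \<Rightarrow> 'a \<Rightarrow> real" where
  "increment n \<omega> = S (Suc n) \<omega> - S n \<omega>"

abbreviation step_law :: "real measure" where
  "step_law \<equiv> distr M borel (S (Suc 0))"

lemma increment_measurable [measurable]: "increment n \<in> borel_measurable M"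
  using indep_increments unfolding indep_vars_def increment_def[abs_def] by simp

lemma walk_measurable [measurable]: "S n \<in> borel_measurable M"
proof (induction n)
  case 0
  show ?case by (rule start_measurable)
next
  case (Suc n)
  have "S (Suc n) = (\<lambda>\<omega>. S n \<omega> + increment n \<omega>)" by (auto simp: increment_def)
  then show ?case using Suc by simp
qed

lemma AE_walk_sum: "AE \<omega> in M. \<forall>n. S n \<omega> = (\<Sum>j<n. increment j \<omega>)"
  using start
proof eventually_elim
  case (elim \<omega>)
  show ?case
  proof
    fix n
    show "S n \<omega> = (\<Sum>j<n. increment j \<omega>)"
      by (induction n) (use elim in \<open>auto simp: increment_def\<close>)
  qed
qed

lemma increment_law: "distr M borel (increment n) = step_law"
proof -
  have "distr M borel (increment n) = distr M borel (\<lambda>\<omega>. S 1 \<omega> - S 0 \<omega>)"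
    using ident_increments[of n] by (simp add: increment_def[abs_def])
  also have "\<dots> = step_law"
    by (rule distr_cong_AE) (use start in \<open>auto elim!: eventually_mono\<close>)
  finally show ?thesis .
qed

lemma prob_space_step: "prob_space step_law"
  by (rule prob_space_distr) simp

definition alive :: "real \<Rightarrow> nat \<Rightarrow> 'a \<Rightarrow> ennreal" where
  "alive x n \<omega> = (if \<forall>i\<le>n. 0 < x + S i \<omega> then 1 else 0)"

lemma alive_measurable [measurable]: "alive x n \<in> borel_measurable M"
  unfolding alive_def[abs_def] by measurable

text \<open>
  The Markov property at time \<open>n\<close>.  Survival up to time \<open>n\<close> is almost surely a function of the first \<open>n\<close> increments, which are
  independent of the next one.
\<close>

lemma markov_step:
  assumes [measurable]: "f \<in> borel_measurable borel"
  shows "(\<integral>\<^sup>+\<omega>. alive x n \<omega> * f (x + S (Suc n) \<omega>) \<partial>M)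
    = (\<integral>\<^sup>+\<omega>. alive x n \<omega> * (\<integral>\<^sup>+y. f (x + S n \<omega> + y) \<partial>step_law) \<partial>M)"
proof -
  define U where "U \<omega> = restrict (\<lambda>i. increment i \<omega>) {..<n}" for \<omega>
  define P where "P = PiM {..<n} (\<lambda>_. borel :: real measure)"
  define W where "W \<omega> = restrict (\<lambda>i. increment i \<omega>) {n}" for \<omega>
  define Q where "Q = PiM {n} (\<lambda>_. borel :: real measure)"
  define s where "s i u = (\<Sum>j<i. u j)" for i and u :: "nat \<Rightarrow> real"
  define A where "A u \<longleftrightarrow> (\<forall>i\<in>{..n}. 0 < x + s i u)" for u
  have s_meas: "s i \<in> borel_measurable P" if "i \<le> n" for i
    unfolding s_def[abs_def] P_def
    by (intro borel_measurable_sum measurable_component_singleton) (use that in auto)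
  have A_meas [measurable]: "Measurable.pred P A"
    unfolding A_def[abs_def]
  proof (rule pred_intros_finite)
    fix i assume "i \<in> {..n}"
    then have [measurable]: "s i \<in> borel_measurable P" using s_meas by simp
    show "Measurable.pred P (\<lambda>u. 0 < x + s i u)" by measurable
  qed simp
  have [measurable]: "s n \<in> borel_measurable P" using s_meas by simp
  have s_U: "s i (U \<omega>) = (\<Sum>j<i. increment j \<omega>)" if "i \<le> n" for i \<omega>
    unfolding s_def U_def using that by (intro sum.cong) auto
  have "indep_vars (\<lambda>_. borel) increment UNIV"
    using indep_increments unfolding increment_def[abs_def] .
  then have ind: "indep_var P U Q W"
    unfolding P_def U_def[abs_def] Q_def W_def[abs_def] by (rule indep_var_restrict) auto
  then have U_meas [measurable]: "U \<in> measurable M P" and W_meas [measurable]: "W \<in> measurable M Q"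
    by (rule indep_var_rv1, rule indep_var_rv2)
  have joint: "distr M P U \<Otimes>\<^sub>M distr M Q W = distr M (P \<Otimes>\<^sub>M Q) (\<lambda>\<omega>. (U \<omega>, W \<omega>))"
    using ind unfolding indep_var_distribution_eq by blast
  have [measurable]: "(\<lambda>w. w n) \<in> borel_measurable Q"
    unfolding Q_def by (rule measurable_component_singleton) simp
  have law_W: "(\<integral>\<^sup>+w. h (w n) \<partial>distr M Q W) = (\<integral>\<^sup>+y. h y \<partial>step_law)"
    if [measurable]: "h \<in> borel_measurable borel" for h
  proof -
    have "(\<integral>\<^sup>+w. h (w n) \<partial>distr M Q W) = (\<integral>\<^sup>+\<omega>. h (increment n \<omega>) \<partial>M)"
      by (subst nn_integral_distr) (auto simp: W_def)
    also have "\<dots> = (\<integral>\<^sup>+y. h y \<partial>distr M borel (increment n))"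
      by (rule nn_integral_distr[symmetric]) auto
    finally show ?thesis unfolding increment_law .
  qed
  interpret W: sigma_finite_measure "distr M Q W"
    using prob_space_distr[OF W_meas] by (rule prob_space_imp_sigma_finite)
  define F where "F = (\<lambda>(u, w). indicator {u. A u} u * f (x + s n u + w n))"
  have F_meas [measurable]: "F \<in> borel_measurable (P \<Otimes>\<^sub>M Q)"
    unfolding F_def by measurable
  have path: "AE \<omega> in M. (\<forall>i\<le>n. 0 < x + S i \<omega>) = A (U \<omega>) \<and> S n \<omega> = s n (U \<omega>) \<and> S (Suc n) \<omega> = s n (U \<omega>) + increment n \<omega>"
    using AE_walk_sum by eventually_elim (auto simp: A_def s_U)
  have "(\<integral>\<^sup>+\<omega>. alive x n \<omega> * f (x + S (Suc n) \<omega>) \<partial>M)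
      = (\<integral>\<^sup>+\<omega>. F (U \<omega>, W \<omega>) \<partial>M)"
  proof (rule nn_integral_cong_AE)
    show "AE \<omega> in M. alive x n \<omega> * f (x + S (Suc n) \<omega>) = F (U \<omega>, W \<omega>)"
      using path by eventually_elim (simp add: F_def W_def add.assoc indicator_def alive_def)
  qed
  also have "\<dots> = (\<integral>\<^sup>+z. F z \<partial>(distr M P U \<Otimes>\<^sub>M distr M Q W))"
    unfolding joint by (subst nn_integral_distr) auto
  also have "\<dots> = (\<integral>\<^sup>+u. \<integral>\<^sup>+w. F (u, w) \<partial>distr M Q W \<partial>distr M P U)"
    by (rule W.nn_integral_fst[symmetric]) simp
  also have "\<dots> = (\<integral>\<^sup>+\<omega>. \<integral>\<^sup>+w. F (U \<omega>, w) \<partial>distr M Q W \<partial>M)"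
    by (rule nn_integral_distr) auto
  also have "\<dots> = (\<integral>\<^sup>+\<omega>. alive x n \<omega> * (\<integral>\<^sup>+y. f (x + S n \<omega> + y) \<partial>step_law) \<partial>M)"
  proof (rule nn_integral_cong_AE)
    show "AE \<omega> in M. (\<integral>\<^sup>+w. F (U \<omega>, w) \<partial>distr M Q W)
        = alive x n \<omega> * (\<integral>\<^sup>+y. f (x + S n \<omega> + y) \<partial>step_law)"
      using path
    proof eventually_elim
      case (elim \<omega>)
      have "(\<integral>\<^sup>+w. F (U \<omega>, w) \<partial>distr M Q W)
          = (\<integral>\<^sup>+y. indicator {u. A u} (U \<omega>) * f (x + s n (U \<omega>) + y) \<partial>step_law)"
        unfolding F_def split by (rule law_W) simp
      also have "\<dots> = indicator {u. A u} (U \<omega>) * (\<integral>\<^sup>+y. f (x + s n (U \<omega>) + y) \<partial>step_law)"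
        by (rule nn_integral_cmult) simp
      finally show ?case using elim by (simp add: indicator_def alive_def)
    qed
  qed
  finally show ?thesis .
qed

text \<open>
  The depth \<open>-(x + S_\<tau>)\<close> on the event \<open>\<tau> = n + 1\<close>: if the walk is still positive after the next step,
  the coercion of a negative number to \<open>ennreal\<close> gives \<open>0\<close>.
\<close>

definition exit_depth :: "real \<Rightarrow> nat \<Rightarrow> 'a \<Rightarrow> ennreal" where
  "exit_depth x n \<omega> = alive x n \<omega> * ennreal (- (x + S (Suc n) \<omega>))"

lemma exit_depth_measurable [measurable]: "exit_depth x n \<in> borel_measurable M"
  unfolding exit_depth_def[abs_def] by measurable

lemma exit_position_eq:
  "exit_position S x \<omega> = (if x + S 0 \<omega> \<le> 0 then x + S 0 \<omega> else - enn2real (\<Sum>n. exit_depth x n \<omega>))"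
proof (cases "\<exists>n. x + S n \<omega> \<le> 0")
  case False
  then have alive: "0 < x + S n \<omega>" for n by (simp add: not_le)
  have "exit_time S x \<omega> = Inf {}" unfolding exit_time_def using False by (intro arg_cong[where f = Inf]) auto
  then have "exit_time S x \<omega> = \<infinity>" by (simp add: top_enat_def)
  then have "exit_position S x \<omega> = 0" by (simp add: exit_position_def)
  moreover have "exit_depth x n \<omega> = 0" for n
    using alive[of "Suc n"] by (simp add: exit_depth_def ennreal_neg)
  ultimately show ?thesis using alive[of 0] by simp
next
  case True
  define N where "N = (LEAST n. x + S n \<omega> \<le> 0)"
  have N: "x + S N \<omega> \<le> 0" unfolding N_def by (rule LeastI_ex[OF True])
  have before: "0 < x + S n \<omega>" if "n < N" for n
    using not_less_Least[of n "\<lambda>n. x + S n \<omega> \<le> 0"] that by (simp add: N_def)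
  have "exit_time S x \<omega> = enat N"
    unfolding exit_time_def
  proof (rule antisym)
    show "Inf {enat n |n. x + S n \<omega> \<le> 0} \<le> enat N" by (rule Inf_lower) (use N in auto)
    show "enat N \<le> Inf {enat n |n. x + S n \<omega> \<le> 0}"
      by (rule Inf_greatest) (auto simp: N_def intro: Least_le)
  qed
  then have pos: "exit_position S x \<omega> = x + S N \<omega>" by (simp add: exit_position_def)
  show ?thesis
  proof (cases N)
    case 0
    then show ?thesis using pos N by simp
  next
    case (Suc m)
    have other: "exit_depth x n \<omega> = 0" if "n \<noteq> m" for n
    proof (cases "n < m")
      case True
      then have "0 < x + S (Suc n) \<omega>" using Suc by (intro before) simp
      then show ?thesis by (simp add: exit_depth_def ennreal_neg)
    next
      case False
      then have "N \<le> n" using that Suc by simp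
      then have "\<not> (\<forall>i\<le>n. 0 < x + S i \<omega>)" using N by (auto simp: not_less)
      then show ?thesis by (auto simp: exit_depth_def alive_def)
    qed
    have "(\<Sum>n. exit_depth x n \<omega>) = (\<Sum>n\<in>{m}. exit_depth x n \<omega>)"
      by (rule suminf_finite) (use other in auto)
    also have "\<dots> = ennreal (- (x + S N \<omega>))"
      using before Suc by (simp add: exit_depth_def alive_def less_Suc_eq_le)
    finally have "enn2real (\<Sum>n. exit_depth x n \<omega>) = - (x + S N \<omega>)" using N by simp
    then show ?thesis using pos before[of 0] Suc by simp
  qed
qed

lemma exit_position_measurable [measurable]: "exit_position S x \<in> borel_measurable M"
  unfolding exit_position_eq[abs_def] by measurable

text \<open>
  Optional stopping, one step at a time: killing the walk at time \<open>n + 1\<close> increases the mean of the surviving position by the mean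
  depth at exit.  Monotone convergence then applies to both sides, and the value of \<open>exit_position\<close> on \<open>\<tau> = \<infinity>\<close> is the correct limit.
\<close>

lemma H_fun_eq_renewal:
  assumes "centered_law step_law"
  shows "H_fun M S x = centered_law.renewal step_law x"
proof -
  interpret L: centered_law step_law by fact
  show ?thesis
  proof (cases "0 < x")
    case False
    have "(\<integral>\<omega>. exit_position S x \<omega> \<partial>M) = (\<integral>\<omega>. x \<partial>M)"
      by (rule integral_cong_AE) (use start False in \<open>auto simp: exit_position_eq elim!: eventually_mono\<close>)
    then show ?thesis using L.renewal_nonpos[of x] False by (simp add: H_fun_def prob_space)
  next
    case True
    have killed: "(\<integral>\<^sup>+\<omega>. alive x n \<omega> * f (x + S n \<omega>) \<partial>M) = L.killed n f x"
      if "f \<in> borel_measurable borel" for n f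
      using that
    proof (induction n arbitrary: f)
      case 0
      have "AE \<omega> in M. alive x 0 \<omega> * f (x + S 0 \<omega>) = f x"
        using start by eventually_elim (use True in \<open>simp add: alive_def\<close>)
      then have "(\<integral>\<^sup>+\<omega>. alive x 0 \<omega> * f (x + S 0 \<omega>) \<partial>M) = (\<integral>\<^sup>+\<omega>. f x \<partial>M)"
        by (rule nn_integral_cong_AE)
      then show ?case by (simp add: emeasure_space_1)
    next
      case (Suc n)
      note [measurable] = Suc.prems
      have "(\<integral>\<^sup>+\<omega>. alive x (Suc n) \<omega> * f (x + S (Suc n) \<omega>) \<partial>M)
          = (\<integral>\<^sup>+\<omega>. alive x n \<omega> * (f (x + S (Suc n) \<omega>) * indicator {0<..} (x + S (Suc n) \<omega>)) \<partial>M)"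
        by (intro nn_integral_cong) (auto simp: alive_def le_Suc_eq indicator_def)
      also have "\<dots> = (\<integral>\<^sup>+\<omega>. alive x n \<omega> * L.kill_op f (x + S n \<omega>) \<partial>M)"
        unfolding L.kill_op_def by (rule markov_step[where f = "\<lambda>t. f t * indicator {0<..} t"]) simp
      also have "\<dots> = L.killed (Suc n) f x"
        unfolding L.killed_Suc by (rule Suc.IH) simp
      finally show ?case .
    qed
    define e where "e n = (\<integral>\<^sup>+\<omega>. exit_depth x n \<omega> \<partial>M)" for n
    define neg where "neg t = (\<integral>\<^sup>+y. ennreal (- (t + y)) \<partial>step_law)" for t
    have [measurable]: "neg \<in> borel_measurable borel" unfolding neg_def[abs_def] by measurable
    have balance: "L.kill_op ennreal t = ennreal t + neg t" if "0 < t" for t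
    proof -
      have int1: "integrable step_law (\<lambda>y. max 0 (t + y))"
        by (rule L.integrable_linear_growth[of _ "\<bar>t\<bar>" 1]) auto
      have int2: "integrable step_law (\<lambda>y. max 0 (- (t + y)))"
        by (rule L.integrable_linear_growth[of _ "\<bar>t\<bar>" 1]) auto
      have "L.kill_op ennreal t = (\<integral>\<^sup>+y. ennreal (max 0 (t + y)) \<partial>step_law)"
        unfolding L.kill_op_def by (intro nn_integral_cong) (auto split: split_indicator simp: max_def ennreal_neg)
      also have "\<dots> = ennreal (\<integral>y. max 0 (t + y) \<partial>step_law)"
        by (rule nn_integral_eq_integral) (use int1 in auto)
      also have "(\<integral>y. max 0 (t + y) \<partial>step_law) = (\<integral>y. (t + y) + max 0 (- (t + y)) \<partial>step_law)"
        by (intro Bochner_Integration.integral_cong) auto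
      also have "\<dots> = t + (\<integral>y. max 0 (- (t + y)) \<partial>step_law)"
        by (subst Bochner_Integration.integral_add) (use int2 in auto)
      also have "ennreal \<dots> = ennreal t + ennreal (\<integral>y. max 0 (- (t + y)) \<partial>step_law)"
        using that by (intro ennreal_plus) (auto intro: integral_nonneg_AE)
      also have "ennreal (\<integral>y. max 0 (- (t + y)) \<partial>step_law) = (\<integral>\<^sup>+y. ennreal (max 0 (- (t + y))) \<partial>step_law)"
        by (rule nn_integral_eq_integral[symmetric]) (use int2 in auto)
      also have "\<dots> = neg t"
        unfolding neg_def by (intro nn_integral_cong) (auto simp: max_def ennreal_neg)
      finally show ?thesis .
    qed
    have partial: "L.killed n ennreal x = ennreal x + (\<Sum>k<n. e k)" for n
    proof (induction n)
      case (Suc n)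
      have "L.killed (Suc n) ennreal x = (\<integral>\<^sup>+\<omega>. alive x n \<omega> * L.kill_op ennreal (x + S n \<omega>) \<partial>M)"
        unfolding L.killed_Suc by (rule killed[symmetric]) simp
      also have "\<dots> = (\<integral>\<^sup>+\<omega>. alive x n \<omega> * ennreal (x + S n \<omega>) + alive x n \<omega> * neg (x + S n \<omega>) \<partial>M)"
        by (intro nn_integral_cong) (auto simp: alive_def balance split: split_indicator)
      also have "\<dots> = (\<integral>\<^sup>+\<omega>. alive x n \<omega> * ennreal (x + S n \<omega>) \<partial>M) + (\<integral>\<^sup>+\<omega>. alive x n \<omega> * neg (x + S n \<omega>) \<partial>M)"
        by (rule nn_integral_add) auto
      also have "(\<integral>\<^sup>+\<omega>. alive x n \<omega> * ennreal (x + S n \<omega>) \<partial>M) = L.killed n ennreal x"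
        by (rule killed) simp
      also have "(\<integral>\<^sup>+\<omega>. alive x n \<omega> * neg (x + S n \<omega>) \<partial>M) = e n"
        unfolding neg_def e_def exit_depth_def
        by (rule markov_step[where f = "\<lambda>t. ennreal (- t)", symmetric]) simp
      finally show ?case using Suc by (simp add: add.assoc)
    qed simp
    have "(\<lambda>n. L.killed n ennreal x) \<longlonglongrightarrow> ennreal (L.renewal x)"
      unfolding L.ennreal_renewal_SUP[OF True] by (rule LIMSEQ_SUP[OF L.killed_positive_part_incseq])
    moreover have "(\<lambda>n. L.killed n ennreal x) \<longlonglongrightarrow> ennreal x + (\<Sum>k. e k)"
      unfolding partial by (intro tendsto_add tendsto_const summable_LIMSEQ) auto
    ultimately have ren: "ennreal (L.renewal x) = ennreal x + (\<Sum>k. e k)" by (rule LIMSEQ_unique)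
    then have "(\<Sum>k. e k) \<noteq> \<top>" by (metis ennreal_add_eq_top ennreal_neq_top)
    then obtain E where E: "(\<Sum>k. e k) = ennreal E" "0 \<le> E" by (cases "\<Sum>k. e k") auto
    have renE: "L.renewal x = x + E"
      using ren True E(2) L.renewal_nonneg[of x] unfolding E(1) by (simp add: ennreal_plus[symmetric] del: ennreal_plus)
    define D where "D \<omega> = (\<Sum>n. exit_depth x n \<omega>)" for \<omega>
    have [measurable]: "D \<in> borel_measurable M" unfolding D_def[abs_def] by measurable
    have intD: "(\<integral>\<^sup>+\<omega>. D \<omega> \<partial>M) = ennreal E"
      unfolding D_def E(1)[symmetric] e_def by (rule nn_integral_suminf) simp
    have finD: "AE \<omega> in M. D \<omega> \<noteq> \<infinity>" by (rule nn_integral_PInf_AE) (use intD in auto)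
    have "(\<integral>\<^sup>+\<omega>. ennreal (enn2real (D \<omega>)) \<partial>M) = ennreal E"
      unfolding intD[symmetric] by (rule nn_integral_cong_AE) (use finD in \<open>auto simp: less_top elim!: eventually_mono\<close>)
    then have "(\<integral>\<omega>. enn2real (D \<omega>) \<partial>M) = E"
      using E(2) by (subst integral_eq_nn_integral) auto
    moreover have "(\<integral>\<omega>. exit_position S x \<omega> \<partial>M) = (\<integral>\<omega>. - enn2real (D \<omega>) \<partial>M)"
      by (rule integral_cong_AE) (use start True in \<open>auto simp: exit_position_eq D_def elim!: eventually_mono\<close>)
    ultimately show ?thesis by (simp add: H_fun_def renE)
  qed
qed

end

section \<open>Harmonic functions of the killed walk\<close>

theorem proposition4p1:
  fixes M :: "'a measure" and S :: "nat \<Rightarrow> 'a \<Rightarrow> real" and G :: "real \<Rightarrow> real" and d :: real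
  assumes "random_walk M S"
    and "nontrivial_walk M S"
    and "centered_walk M S"
    and "has_lattice_span M S d"
    and "integrable M (\<lambda>\<omega>. (S 1 \<omega>)\<^sup>2)"
    and "\<And>x. continuous (at_right x) G"
    and "\<And>x. x \<le> 0 \<Longrightarrow> G x = 0"
    and "\<And>x. x > 0 \<Longrightarrow>
           G x = (\<integral>\<omega>. G (x + S 1 \<omega>) * indicator {0<..} (x + S 1 \<omega>) \<partial>M)"
    and "bdd_above ((\<lambda>x. \<bar>G x / (1 + \<bar>x\<bar>)\<bar>) ` {0..})"
  shows "\<exists>\<kappa> :: real \<Rightarrow> real.
           (d > 0 \<longrightarrow> (\<forall>x. \<kappa> (x + d) = \<kappa> x)) \<and>
           (d = 0 \<longrightarrow> (\<exists>c. \<forall>x. \<kappa> x = c)) \<and>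
           (\<forall>x. G x = \<kappa> x * H_fun M S x)"
proof -
  interpret random_walk M S by fact
  have law: "centered_law step_law"
  proof (intro centered_law.intro centered_law_axioms.intro prob_space_step)
    have centered: "integrable M (S 1)" "(\<integral>\<omega>. S 1 \<omega> \<partial>M) = 0"
      using assms(3) by (auto simp: centered_walk_def)
    show "integrable step_law (\<lambda>x. x)" using centered by (subst integrable_distr_eq) auto
    show "(\<integral>x. x \<partial>step_law) = 0" using centered by (subst integral_distr) auto
    show "integrable step_law (\<lambda>x. x\<^sup>2)" using assms(5) by (subst integrable_distr_eq) auto
    have "measure step_law {0} = prob {\<omega> \<in> space M. S 1 \<omega> = 0}"
      by (subst measure_distr) (auto intro!: arg_cong[where f = prob])
    then show "measure step_law {0} < 1" using assms(2) by (simp add: nontrivial_walk_def)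
  qed simp
  interpret L: centered_law step_law by fact
  note G0 = assms(7)
  have [measurable]: "G \<in> borel_measurable borel"
    using assms(6) by (rule borel_measurable_right_continuous)
  have harm: "(\<integral>y. G (x + y) \<partial>step_law) = G x" if "0 < x" for x
  proof -
    have "G x = (\<integral>y. G (x + y) * indicator {0<..} (x + y) \<partial>step_law)"
      using assms(8)[OF that] by (subst integral_distr) auto
    also have "\<dots> = (\<integral>y. G (x + y) \<partial>step_law)"
      by (intro Bochner_Integration.integral_cong) (auto simp: G0 split: split_indicator)
    finally show ?thesis by simp
  qed
  obtain C where "\<forall>x\<in>{0..}. \<bar>G x / (1 + \<bar>x\<bar>)\<bar> \<le> C"
    using assms(9) unfolding bdd_above_def by auto
  then have growth: "\<bar>G x\<bar> \<le> C * (1 + x)" if "0 \<le> x" for x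
    using that by (force simp: field_simps)
  have C: "0 \<le> C" using growth[of 0] by simp
  have bound: "\<bar>G x\<bar> \<le> C * L.renewal x" for x
  proof (cases "0 < x")
    case False
    then show ?thesis using G0 L.renewal_nonpos by simp
  next
    case True
    have "ennreal \<bar>G x\<bar> \<le> ennreal C * ennreal (L.renewal x)"
    proof (rule L.subharmonic_le_renewal[OF _ _ _ True])
      show "(\<lambda>x. ennreal \<bar>G x\<bar>) \<in> borel_measurable borel" by measurable
      show "ennreal \<bar>G x\<bar> \<le> ennreal C * (1 + ennreal x)" if "0 < x" for x
        using growth[of x] C that
        by (subst ennreal_1[symmetric], subst ennreal_plus[symmetric], simp, simp,
            subst ennreal_mult[symmetric]) (auto intro: ennreal_leI)
      show "ennreal \<bar>G x\<bar> \<le> L.kill_op (\<lambda>x. ennreal \<bar>G x\<bar>) x" if "0 < x" for x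
      proof (cases "integrable step_law (\<lambda>y. G (x + y))")
        case True
        have "ennreal \<bar>G x\<bar> = ennreal (norm (\<integral>y. G (x + y) \<partial>step_law))" using harm[OF that] by simp
        also have "\<dots> \<le> (\<integral>\<^sup>+y. ennreal (norm (G (x + y))) \<partial>step_law)"
          by (rule integral_norm_bound_ennreal[OF True])
        also have "\<dots> = L.kill_op (\<lambda>x. ennreal \<bar>G x\<bar>) x"
          unfolding L.kill_op_def by (intro nn_integral_cong) (auto simp: G0 split: split_indicator)
        finally show ?thesis .
      next
        case False
        then show ?thesis using harm[OF that] not_integrable_integral_eq[OF False] by simp
      qed
    qed
    also have "\<dots> = ennreal (C * L.renewal x)" using C L.renewal_nonneg by (simp add: ennreal_mult)
    finally show ?thesis using C L.renewal_nonneg by (simp add: ennreal_le_iff)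
  qed
  obtain \<kappa> where \<kappa>: "L.meander_invariant \<kappa>" "\<And>x. \<bar>\<kappa> x\<bar> \<le> C" "\<And>x. G x = \<kappa> x * L.renewal x"
    using L.harmonic_factorization[OF _ G0 bound C harm] by auto
  have rc: "continuous (at_right x) \<kappa>" if "0 < x" for x
    by (rule L.factor_right_continuous[OF \<kappa> assms(6) that])
  have per: "AE y in step_law. period \<kappa> y" by (rule L.AE_period[OF \<kappa>(1) rc])
  have lattice_iff: "(AE y in step_law. \<exists>k::int. y = t * of_int k)
      \<longleftrightarrow> \<P>(\<omega> in M. \<exists>k::int. S 1 \<omega> = t * of_int k) = 1" for t
    by (subst AE_distr_iff, simp, measurable, subst prob_Collect_eq_1) auto
  have ren: "H_fun M S x = L.renewal x" for x by (rule H_fun_eq_renewal[OF law])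
  have transfer: ?thesis
    if \<kappa>': "d > 0 \<longrightarrow> (\<forall>x. \<kappa>' (x + d) = \<kappa>' x)" "d = 0 \<longrightarrow> (\<exists>c. \<forall>x. \<kappa>' x = c)"
      "\<And>x. 0 < x \<Longrightarrow> \<kappa>' x = \<kappa> x" for \<kappa>'
  proof (intro exI[of _ \<kappa>'] conjI allI \<kappa>'(1,2))
    show "G x = \<kappa>' x * H_fun M S x" for x
      using \<kappa>(3)[of x] \<kappa>'(3)[of x] L.renewal_nonpos[of x] ren[of x] by (cases "0 < x") auto
  qed
  show ?thesis
  proof (cases "arithmetic_walk M S d")
    case True
    then have d: "0 < d" "AE y in step_law. \<exists>k::int. y = d * of_int k"
      "\<And>d'. 0 < d' \<Longrightarrow> (AE y in step_law. \<exists>k::int. y = d' * of_int k) \<Longrightarrow> d' \<le> d"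
      unfolding arithmetic_walk_def lattice_iff by auto
    have pd: "period \<kappa> d" by (rule L.span_is_period[OF per d])
    \<comment> \<open>the representative of \<open>x\<close> modulo \<open>d\<close> in \<open>(0, d]\<close>; \<open>\<kappa>\<close> is only periodic on the half-line\<close>
    define r where "r x = x + d * of_int (1 - \<lceil>x / d\<rceil>)" for x
    have r_pos: "0 < r x" for x
    proof -
      have "of_int \<lceil>x / d\<rceil> < x / d + 1" by linarith
      then have "of_int \<lceil>x / d\<rceil> * d < (x / d + 1) * d" using d(1) by (intro mult_strict_right_mono)
      then show ?thesis using d(1) by (simp add: r_def algebra_simps)
    qed
    show ?thesis
    proof (rule transfer[of "\<lambda>x. \<kappa> (r x)"])
      have "r (x + d) = r x" for x
      proof -
        have "(x + d) / d = x / d + 1" using d(1) by (simp add: field_simps)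
        then have "\<lceil>(x + d) / d\<rceil> = \<lceil>x / d\<rceil> + 1" by simp
        then show ?thesis by (simp add: r_def algebra_simps)
      qed
      then show "d > 0 \<longrightarrow> (\<forall>x. \<kappa> (r (x + d)) = \<kappa> (r x))" by simp
      show "d = 0 \<longrightarrow> (\<exists>c. \<forall>x. \<kappa> (r x) = c)" using d(1) by simp
      show "\<kappa> (r x) = \<kappa> x" if "0 < x" for x
        using period_int_mult[OF pd, of "1 - \<lceil>x / d\<rceil>"] that r_pos[of x]
        unfolding period_def r_def by blast
    qed
  next
    case False
    then have d0: "d = 0" and none: "\<And>d'. \<not> arithmetic_walk M S d'"
      using assms(4) by (auto simp: has_lattice_span_def)
    have nonlattice: "\<not> (AE y in step_law. \<exists>k::int. y = \<rho> * of_int k)" if "0 < \<rho>" for \<rho>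
    proof
      assume "AE y in step_law. \<exists>k::int. y = \<rho> * of_int k"
      from L.maximal_lattice[OF that this] obtain d' where "arithmetic_walk M S d'"
        unfolding arithmetic_walk_def lattice_iff by auto
      then show False using none by blast
    qed
    have const: "\<kappa> a = \<kappa> b" if "0 < a" "a < b" for a b
      by (rule L.nonlattice_constant[OF per rc nonlattice that])
    show ?thesis
    proof (rule transfer[of "\<lambda>_. \<kappa> 1"])
      show "\<kappa> 1 = \<kappa> x" if "0 < x" for x
        using const[of 1 x] const[of x 1] that by (cases x "1 :: real" rule: linorder_cases) auto
    qed (use d0 in auto)
  qed
qed

end
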